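(* Let $\mathbb{K}$ be a field and let $P=\begin{pmatrix}P_1&P_2\\P_3&P_4\end{pmatrix}\in GL_{m+n}(\mathbb{K})$ be partitioned so that $P_1$ is $m\times m$ (hence $P_4$ is $n\times n$). Let $p_i=\operatorname{rk}P_i$ for $i=1,2,3,4$. Then there exist matrices $L,R\in\mathbb{K}^{n\times m}$, $C_1\in\mathbb{K}^{m\times m}$, $C_2\in\mathbb{K}^{m\times n}$, $C_4\in\mathbb{K}^{n\times n}$ such that $$P=\begin{pmatrix}I_m&0\\L&I_n\end{pmatrix}\begin{pmatrix}C_1&C_2\\0&C_4\end{pmatrix}\begin{pmatrix}I_m&0\\R&I_n\end{pmatrix},$$ $$\operatorname{rk}R+\operatorname{rk}L=\max(p_3,\;n+m-p_4-p_1)\quad\text{and}\quad \operatorname{rk}L=n-p_4.$$ Additionally, such a decomposition can be computed from $P$ with $O((m+n)^3)$ arithmetic operations.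
   Context: $I_k$ denotes the $k\times k$ identity matrix and $\operatorname{rk}$ denotes matrix rank. Arithmetic operations are operations in the field $\mathbb{K}$. *)

theory Defs
  imports "Jordan_Normal_Form.DL_Rank"
begin

section \<open>The block decomposition\<close>

text \<open>The library's rank takes the dimension of the ambient column space as a parameter.\<close>

abbreviation rk :: "'a::field mat \<Rightarrow> nat" where
  "rk A \<equiv> vec_space.rank (dim_row A) A"

definition partitioned_GL ::
    "nat \<Rightarrow> nat \<Rightarrow> 'a::field mat \<Rightarrow> 'a mat \<Rightarrow> 'a mat \<Rightarrow> 'a mat \<Rightarrow> bool" where
  "partitioned_GL m n P1 P2 P3 P4 \<longleftrightarrow>
     P1 \<in> carrier_mat m m \<and> P2 \<in> carrier_mat m n \<and>
     P3 \<in> carrier_mat n m \<and> P4 \<in> carrier_mat n n \<and>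
     invertible_mat (four_block_mat P1 P2 P3 P4)"

text \<open>The subtractions below are on natural numbers but never truncate, because
  \<open>rk P1 \<le> m\<close> and \<open>rk P4 \<le> n\<close>.\<close>

definition block_decomposition ::
    "nat \<Rightarrow> nat \<Rightarrow> 'a::field mat \<Rightarrow> 'a mat \<Rightarrow> 'a mat \<Rightarrow> 'a mat \<Rightarrow>
     'a mat \<Rightarrow> 'a mat \<Rightarrow> 'a mat \<Rightarrow> 'a mat \<Rightarrow> 'a mat \<Rightarrow> bool" where
  "block_decomposition m n P1 P2 P3 P4 L R C1 C2 C4 \<longleftrightarrow>
     L \<in> carrier_mat n m \<and> R \<in> carrier_mat n m \<and>
     C1 \<in> carrier_mat m m \<and> C2 \<in> carrier_mat m n \<and> C4 \<in> carrier_mat n n \<and>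
     four_block_mat P1 P2 P3 P4 =
       four_block_mat (1\<^sub>m m) (0\<^sub>m m n) L (1\<^sub>m n) *
       four_block_mat C1 C2 (0\<^sub>m n m) C4 *
       four_block_mat (1\<^sub>m m) (0\<^sub>m m n) R (1\<^sub>m n) \<and>
     rk R + rk L = max (rk P3) (n + m - rk P4 - rk P1) \<and>
     rk L = n - rk P4"


section \<open>Programs over a field\<close>

text \<open>
  Algorithms are programs for a random access machine over the field. The memory consists of
  two-dimensional arrays of field elements, numbered by natural numbers, together with index
  variables that hold natural numbers and are used for addressing and loop control. Field
  elements influence the control flow only through zero tests, and index values never enter
  the field arithmetic.

  The type of programs does not mention the field: the only field constants are 0 and 1, and
  one program has to serve for all matrix sizes. All loops are bounded, so every program
  terminates and its meaning is a total function on states.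
\<close>

datatype index_expr =
    Const nat
  | Var nat
  | Plus index_expr index_expr
  | Minus index_expr index_expr

datatype cell = Cell nat index_expr index_expr

datatype arith_op = Add | Sub | Mult | Divide

datatype prog =
    Skip
  | Seq prog prog
  | SetIndex nat index_expr
  | SetZero cell
  | SetOne cell
  | Copy cell cell
  | Arith cell arith_op cell cell
  | IfLess index_expr index_expr prog prog
  | IfZero cell prog prog
  | For nat index_expr prog

text \<open>The component \<open>ops\<close> counts the field operations performed so far.\<close>

record 'a state =
  idx :: "nat \<Rightarrow> nat"
  mem :: "nat \<Rightarrow> nat \<Rightarrow> nat \<Rightarrow> 'a"
  ops :: nat

primrec index_val :: "index_expr \<Rightarrow> (nat \<Rightarrow> nat) \<Rightarrow> nat" where
  "index_val (Const k) v = k"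
| "index_val (Var x) v = v x"
| "index_val (Plus e f) v = index_val e v + index_val f v"
| "index_val (Minus e f) v = index_val e v - index_val f v"

definition set_index :: "nat \<Rightarrow> nat \<Rightarrow> 'a state \<Rightarrow> 'a state" where
  "set_index x k s = s\<lparr>idx := (idx s)(x := k)\<rparr>"

primrec read_cell :: "cell \<Rightarrow> 'a state \<Rightarrow> 'a" where
  "read_cell (Cell a e f) s = mem s a (index_val e (idx s)) (index_val f (idx s))"

primrec write_cell :: "cell \<Rightarrow> 'a \<Rightarrow> 'a state \<Rightarrow> 'a state" where
  "write_cell (Cell a e f) x s =
     (let i = index_val e (idx s); j = index_val f (idx s)
      in s\<lparr>mem := (mem s)(a := (mem s a)(i := (mem s a i)(j := x)))\<rparr>)"

text \<open>Division by zero yields 0, as in the class \<^class>\<open>field\<close>. Since zero tests are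
  available at unit cost, this affects operation counts by at most a constant factor.\<close>

primrec arith_val :: "arith_op \<Rightarrow> 'a::field \<Rightarrow> 'a \<Rightarrow> 'a" where
  "arith_val Add x y = x + y"
| "arith_val Sub x y = x - y"
| "arith_val Mult x y = x * y"
| "arith_val Divide x y = x / y"

definition tick :: "'a state \<Rightarrow> 'a state" where
  "tick s = s\<lparr>ops := ops s + 1\<rparr>"

text \<open>Each of \<open>+\<close>, \<open>-\<close>, \<open>*\<close>, \<open>/\<close> and each zero test in the field costs one operation. Moving
  field elements, index arithmetic and loop control are not operations in the field and are
  free. The bound of a loop is evaluated once, on entry.\<close>

primrec exec :: "prog \<Rightarrow> 'a::field state \<Rightarrow> 'a state" where
  "exec Skip s = s"
| "exec (Seq p q) s = exec q (exec p s)"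
| "exec (SetIndex x e) s = set_index x (index_val e (idx s)) s"
| "exec (SetZero c) s = write_cell c 0 s"
| "exec (SetOne c) s = write_cell c 1 s"
| "exec (Copy c d) s = write_cell c (read_cell d s) s"
| "exec (Arith c f d e) s =
     tick (write_cell c (arith_val f (read_cell d s) (read_cell e s)) s)"
| "exec (IfLess e f p q) s =
     (if index_val e (idx s) < index_val f (idx s) then exec p s else exec q s)"
| "exec (IfZero c p q) s =
     (if read_cell c s = 0 then exec p (tick s) else exec q (tick s))"
| "exec (For x e p) s =
     fold (\<lambda>k t. exec p (set_index x k t)) [0..<index_val e (idx s)] s"

text \<open>Inputs are \<open>m\<close> and \<open>n\<close> in the index variables 0 and 1, and the matrix in array 0;
  all other memory is initially zero.\<close>

definition initial_state :: "nat \<Rightarrow> nat \<Rightarrow> 'a::field mat \<Rightarrow> 'a state" where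
  "initial_state m n P =
     \<lparr>idx = (\<lambda>_. 0)(0 := m, 1 := n),
      mem = (\<lambda>a i j. if a = 0 \<and> i < dim_row P \<and> j < dim_col P then P $$ (i, j) else 0),
      ops = 0\<rparr>"

definition read_mat :: "'a state \<Rightarrow> nat \<Rightarrow> nat \<Rightarrow> nat \<Rightarrow> 'a mat" where
  "read_mat s a r c = mat r c (\<lambda>(i, j). mem s a i j)"

end

theory Submission
  imports Defs
begin

text \<open>Multiplying out the three factors gives \<open>C2 = P2\<close>, \<open>C1 = P1 - P2 * R\<close>, \<open>C4 = P4 - L * P2\<close>, and one
  condition that links \<open>L\<close> and \<open>R\<close>:
  with \<open>S3 = P3 - L * P1\<close> and \<open>S4 = P4 - L * P2\<close> it reads \<open>S4 * R = S3\<close>. So a decomposition is the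
  choice of a matrix \<open>L\<close> that makes \<open>S4\<close> invertible; then \<open>R\<close> is determined and has the rank of \<open>S3\<close>.
  Every decomposition satisfies \<open>n - rk P4 \<le> rk L\<close>, \<open>rk P3 \<le> rk L + rk R\<close> and \<open>m - rk P1 \<le> rk R\<close>, so the
  claim is that \<open>L\<close> can be chosen to have rank \<open>n - rk P4\<close> and to make the rank of \<open>S3\<close> as small as these
  bounds permit.

  Such an \<open>L\<close> is built greedily from zero by rank-one updates \<open>L - S3 * v * s * (y * F)\<close>, where \<open>F\<close> is the
  lower left block of the inverse of the matrix with the lower blocks \<open>S3\<close> and \<open>S4\<close>, \<open>y\<close> is a row, \<open>v\<close> a
  column and \<open>s\<close> a nonzero scalar. The update raises the rank of \<open>S4\<close> by one
  if \<open>y\<close> is nonzero on the right kernel of \<open>S4\<close> and \<open>S3 * v\<close> lies outside its column space. It changes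
  \<open>S3\<close> into \<open>S3 - S3 * v * s * (y * M)\<close> with \<open>M = Q4 * S3\<close>, where \<open>Q4\<close> is the lower right block of the
  inverse of \<open>P\<close>. If \<open>y * M * v\<close> is nonzero and \<open>s\<close> is its inverse, then this is Wedderburn's rank reduction
  and lowers the rank of \<open>S3\<close> by one. The three conditions on \<open>y\<close> and \<open>v\<close> can be met together as long
  as \<open>M\<close> is nonzero. If \<open>M\<close> is zero, then it remains zero, \<open>S3\<close> no longer changes, and
  \<open>rk S3 + rk P1 \<le> m\<close>. Hence after \<open>n - rk P4\<close> updates \<open>S4\<close> is invertible, and either every update has
  lowered the rank of \<open>S3\<close>, or it has reached \<open>m - rk P1\<close>; these are the two terms of the maximum.
  The lemmas \<open>loop_inv_step\<close> and \<open>loop_inv_end\<close> contain this argument; they rest on \<open>rk_wedderburn\<close> and on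
  the inequality \<open>rk_mult_eq_zero\<close>.

  For the algorithm, \<open>M\<close>, a projection \<open>X\<close> onto the right kernel of \<open>S4\<close>, and the product \<open>W\<close> of such a
  projection for the left kernel with \<open>S3\<close> are kept up to date along with \<open>L\<close>.
  All of these change by rank-one updates, so one of the \<open>n\<close> rounds costs \<open>O((m + n)\<^sup>2)\<close>
  operations. Inverses and initial projections come from generalized inverses, which are themselves sums of
  at most as many rank-one terms as the matrix has rows. The program is thus composed of products with
  vectors, a few products of matrices, and searches for nonzero entries. Its effect is derived step by step with
  the predicate \<open>snapshot\<close>; \<open>exec_decompose\<close> is the result.\<close>

section \<open>Matrix arithmetic with dimension side conditions\<close>

text \<open>With membership in \<^const>\<open>carrier_mat\<close> as premises, the ring laws for matrices involve sizes that do not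
  occur in the equation. With equations between dimensions as premises they work as conditional
  rewrite rules.\<close>

lemma mult_assoc_dim:
  fixes A B C :: "'a::comm_ring_1 mat"
  assumes "dim_col A = dim_row B" "dim_col B = dim_row C"
  shows "(A * B) * C = A * (B * C)"
  using assms by (intro assoc_mult_mat[of _ "dim_row A" "dim_row B" _ "dim_row C" _ "dim_col C"]) auto

lemma add_mult_dim:
  fixes A B C :: "'a::comm_ring_1 mat"
  assumes "dim_row A = dim_row B" "dim_col A = dim_col B" "dim_col B = dim_row C"
  shows "(A + B) * C = A * C + B * C"
  using assms by (intro add_mult_distrib_mat[of _ "dim_row A" "dim_row C" _ _ "dim_col C"]) auto

lemma mult_add_dim:
  fixes A B C :: "'a::comm_ring_1 mat"
  assumes "dim_row C = dim_row B" "dim_col C = dim_col B" "dim_col A = dim_row B"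
  shows "A * (B + C) = A * B + A * C"
  using assms by (intro mult_add_distrib_mat[of _ "dim_row A" "dim_row B" _ "dim_col B"]) auto

lemma minus_mult_dim:
  fixes A B C :: "'a::comm_ring_1 mat"
  assumes "dim_row A = dim_row B" "dim_col A = dim_col B" "dim_col B = dim_row C"
  shows "(A - B) * C = A * C - B * C"
  using assms by (intro minus_mult_distrib_mat[of _ "dim_row A" "dim_row C" _ _ "dim_col C"]) auto

lemma mult_minus_dim:
  fixes A B C :: "'a::comm_ring_1 mat"
  assumes "dim_row C = dim_row B" "dim_col C = dim_col B" "dim_col A = dim_row B"
  shows "A * (B - C) = A * B - A * C"
  using assms by (intro mult_minus_distrib_mat[of _ "dim_row A" "dim_row B" _ "dim_col B"]) auto

lemma one_mult_dim: "dim_row A = n \<Longrightarrow> 1\<^sub>m n * A = (A :: 'a::comm_ring_1 mat)"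
  by (intro left_mult_one_mat) auto
lemma mult_one_dim: "dim_col A = n \<Longrightarrow> A * 1\<^sub>m n = (A :: 'a::comm_ring_1 mat)"
  by (intro right_mult_one_mat) auto
lemma zero_mult_dim: "dim_row A = n \<Longrightarrow> 0\<^sub>m k n * A = (0\<^sub>m k (dim_col A) :: 'a::comm_ring_1 mat)"
  by (intro left_mult_zero_mat) auto
lemma mult_zero_dim: "dim_col A = n \<Longrightarrow> A * 0\<^sub>m n k = (0\<^sub>m (dim_row A) k :: 'a::comm_ring_1 mat)"
  by (intro right_mult_zero_mat) auto
lemma uminus_mult_dim: "dim_col A = dim_row B \<Longrightarrow> (- A) * B = - (A * (B:: 'a::comm_ring_1 mat))"
  by (rule uminus_mult_left_mat)
lemma mult_uminus_dim: "dim_col A = dim_row B \<Longrightarrow> A * (- B) = - (A * (B:: 'a::comm_ring_1 mat))"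
  by (rule uminus_mult_right_mat)

lemma minus_self_dim: "A - A = (0\<^sub>m (dim_row A) (dim_col A) :: 'a::comm_ring_1 mat)"
  by (rule eq_matI) simp_all
lemma add_zero_dim: "dim_row A = r \<Longrightarrow> dim_col A = c \<Longrightarrow> A + 0\<^sub>m r c = (A :: 'a::comm_ring_1 mat)"
  by (rule eq_matI) simp_all
lemma zero_add_dim: "dim_row A = r \<Longrightarrow> dim_col A = c \<Longrightarrow> 0\<^sub>m r c + A = (A :: 'a::comm_ring_1 mat)"
  by (rule eq_matI) simp_all
lemma minus_zero_dim: "dim_row A = r \<Longrightarrow> dim_col A = c \<Longrightarrow> A - 0\<^sub>m r c = (A :: 'a::comm_ring_1 mat)"
  by (rule eq_matI) simp_all

lemmas mat_ring = minus_self_dim add_zero_dim zero_add_dim minus_zero_dim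
  mult_assoc_dim add_mult_dim mult_add_dim minus_mult_dim mult_minus_dim
  one_mult_dim mult_one_dim zero_mult_dim mult_zero_dim uminus_mult_dim mult_uminus_dim

section \<open>Rank\<close>

text \<open>Together with \<open>rank_factorization\<close> this says that the rank of a matrix is the least inner
  dimension of a factorization. The behaviour of rank under products is read off from factorizations.\<close>

lemma rank_le_inner_dim:
  fixes B C :: "'a::field mat"
  assumes "B \<in> carrier_mat n k" "C \<in> carrier_mat k c"
  shows "vec_space.rank n (B * C) \<le> k"
  using assms
proof (induction k arbitrary: B C)
  case 0
  then have "B * C = 0\<^sub>m n c"
    by (intro eq_matI) (auto simp: scalar_prod_def)
  then show ?case using vec_space.rank_0I[of n c] by simp
next
  case (Suc k)
  define B1 where "B1 = mat n k (\<lambda>(i,j). B $$ (i,j))"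
  define C1 where "C1 = mat k c (\<lambda>(i,j). C $$ (i,j))"
  define D where "D = mat n c (\<lambda>(i,j). B $$ (i,k) * C $$ (k,j))"
  have "B * C = B1 * C1 + D"
    using Suc.prems by (intro eq_matI) (auto simp: B1_def C1_def D_def scalar_prod_def)
  moreover have "vec_space.rank n D \<le> 1"
    by (rule vec_space.rank_le_1_product_entries[where f="\<lambda>i. B $$ (i,k)" and g="\<lambda>j. C $$ (k,j)"])
       (auto simp: D_def)
  moreover have "vec_space.rank n (B1 * C1 + D) \<le> vec_space.rank n (B1 * C1) + vec_space.rank n D"
    by (rule vec_space.rank_subadditive[of _ _ c]) (auto simp: B1_def C1_def D_def)
  moreover have "vec_space.rank n (B1 * C1) \<le> k"
    by (rule Suc.IH) (auto simp: B1_def C1_def)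
  ultimately show ?case by simp
qed

context vec_space
begin

lemma rank_factorization:
  assumes A: "A \<in> carrier_mat n nc"
  obtains B C where "B \<in> carrier_mat n (rank A)" "C \<in> carrier_mat (rank A) nc" "A = B * C"
proof -
  let ?P = "\<lambda>T. T \<subseteq> set (cols A) \<and> lin_indpt T"
  have colsA: "set (cols A) \<subseteq> carrier_vec n" using A cols_dim by blast
  obtain S where S: "maximal S ?P"
    using maximal_exists[of ?P "card (set (cols A))" "{}"]
    by (meson List.finite_set card_mono empty_iff empty_subsetI finite_lin_indpt2 rev_finite_subset)
  have Ssub: "S \<subseteq> set (cols A)" and Sli: "lin_indpt S"
    using S by (auto simp: maximal_def)
  have finS: "finite S" using Ssub finite_subset by blast
  have Sc: "S \<subseteq> carrier_vec n" using Ssub colsA by auto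
  have r: "rank A = card S" by (rule rank_card_indpt[OF A S])
  obtain ss where ss: "set ss = S" "distinct ss" using finite_distinct_list[OF finS] by blast
  have len: "length ss = rank A" using ss r distinct_card by fastforce
  define B where "B = mat_of_cols n ss"
  have B: "B \<in> carrier_mat n (rank A)" by (simp add: B_def len[symmetric])
  have colsB: "cols B = ss" using ss Sc by (simp add: B_def)
  have "\<exists>c. c \<in> carrier_vec (rank A) \<and> col A j = B *\<^sub>v c" if j: "j < nc" for j
  proof -
    have v: "col A j \<in> set (cols A)" using A j
      by (metis carrier_matD(2) cols_length cols_nth nth_mem)
    have "col A j \<in> span S"
    proof (rule ccontr)
      assume ns: "col A j \<notin> span S"
      then have "col A j \<notin> S" using Sc span_mem by blast
      moreover have "lin_indpt (S \<union> {col A j})"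
        using ns lin_dep_iff_in_span[OF _ Sli _ \<open>col A j \<notin> S\<close>] Sc v colsA by auto
      ultimately show False using S v Ssub unfolding maximal_def by blast
    qed
    then obtain a where "lincomb a S = col A j"
      using finite_in_span[OF finS, of "col A j"] Sc by auto
    then have "col A j = lincomb a S" by simp
    also have "\<dots> = B *\<^sub>v vec (rank A) (\<lambda>i. a (col B i))"
      using mat_mult_eq_lincomb[OF B, of a] colsB ss by simp
    finally show ?thesis by (intro exI[of _ "vec (rank A) (\<lambda>i. a (col B i))"]) auto
  qed
  then obtain c where c: "\<And>j. j < nc \<Longrightarrow> c j \<in> carrier_vec (rank A) \<and> col A j = B *\<^sub>v c j"
    by metis
  define C where "C = mat_of_cols (rank A) (map c [0..<nc])"
  have C: "C \<in> carrier_mat (rank A) nc" using mat_of_cols_carrier(1)[of "rank A" "map c [0..<nc]"] by (simp add: C_def)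
  have "A = B * C"
  proof (rule mat_col_eqI)
    fix j assume "j < dim_col (B * C)"
    then have j: "j < nc" using C by simp
    have "col C j = c j" using c j by (simp add: C_def)
    then show "col A j = col (B * C) j"
      using c[OF j] col_mult2[OF B C j] by simp
  qed (use A B C in auto)
  with B C show ?thesis by (rule that)
qed

end

lemma rk_le_inner:
  assumes "B \<in> carrier_mat n k" "C \<in> carrier_mat k c"
  shows "rk (B * C) \<le> k"
proof -
  have "dim_row (B * C) = n" using assms(1) by simp
  then show ?thesis using rank_le_inner_dim[OF assms] by (simp only:)
qed

lemma rk_factorization:
  fixes A :: "'a::field mat"
  obtains B C where "B \<in> carrier_mat (dim_row A) (rk A)" "C \<in> carrier_mat (rk A) (dim_col A)" "A = B * C"
  using vec_space.rank_factorization[OF carrier_matI[OF refl refl, of A]] by blast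

lemma rk_mult_left:
  fixes A B :: "'a::field mat"
  assumes "dim_col A = dim_row B" shows "rk (A * B) \<le> rk A"
proof -
  obtain S T where S: "S \<in> carrier_mat (dim_row A) (rk A)" and T: "T \<in> carrier_mat (rk A) (dim_col A)" and A: "A = S * T"
    by (rule rk_factorization)
  note d = carrier_matD[OF S] carrier_matD[OF T]
  have "A * B = S * (T * B)" by (subst A) (use d assms in \<open>simp add: mat_ring\<close>)
  moreover have "rk (S * (T * B)) \<le> rk A"
    by (rule rk_le_inner[OF S]) (rule carrier_matI, use d in simp_all)
  ultimately show ?thesis by simp
qed

lemma rk_mult_right:
  fixes A B :: "'a::field mat"
  assumes "dim_col A = dim_row B" shows "rk (A * B) \<le> rk B"
proof -
  obtain S T where S: "S \<in> carrier_mat (dim_row B) (rk B)" and T: "T \<in> carrier_mat (rk B) (dim_col B)" and B: "B = S * T"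
    by (rule rk_factorization)
  note d = carrier_matD[OF S] carrier_matD[OF T]
  have "A * B = (A * S) * T" by (subst B) (use d assms in \<open>simp add: mat_ring\<close>)
  moreover have "rk (A * S * T) \<le> rk B"
    by (rule rk_le_inner[OF _ T]) (rule carrier_matI, use d in simp_all)
  ultimately show ?thesis by simp
qed

lemma rk_add:
  fixes A B :: "'a::field mat"
  assumes "dim_row A = dim_row B" "dim_col A = dim_col B" shows "rk (A + B) \<le> rk A + rk B"
proof -
  have "A \<in> carrier_mat (dim_row A) (dim_col A)" "B \<in> carrier_mat (dim_row A) (dim_col A)"
    using assms by (intro carrier_matI; simp)+
  from vec_space.rank_subadditive[OF this] show ?thesis using assms by simp
qed

lemma rk_uminus: "rk (- A) \<le> rk (A :: 'a::field mat)"
  using rk_mult_right[of "- (1\<^sub>m (dim_row A))" A] by (simp add: mat_ring)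

lemma rk_minus:
  fixes A B :: "'a::field mat"
  assumes "dim_row A = dim_row B" "dim_col A = dim_col B" shows "rk (A - B) \<le> rk A + rk B"
proof -
  have eq: "A - B = A + (- B)" by (rule eq_matI) (simp_all add: assms)
  have "rk (A - B) \<le> rk A + rk (- B)" unfolding eq by (rule rk_add) (simp_all add: assms)
  with rk_uminus[of B] show ?thesis by linarith
qed

lemma rk_one: "rk (1\<^sub>m n :: 'a::field mat) = n"
  using vec_space.low_rank_det_zero[of "1\<^sub>m n" n] by simp

lemma rk_le_row: "rk (A :: 'a::field mat) \<le> dim_row A"
  using rk_le_inner[OF one_carrier_mat carrier_matI[OF refl refl], of A] by (simp add: mat_ring)

text \<open>Wedderburn's rank reduction. In a minimal factorization \<open>A = S * T\<close> the update replaces the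
  identity between \<open>S\<close> and \<open>T\<close> by a square matrix \<open>E\<close> that the nonzero row \<open>u * S\<close> annihilates
  from the left, so the inner dimension can be lowered.\<close>

lemma rk_wedderburn:
  fixes A :: "'a::field mat"
  assumes A: "A \<in> carrier_mat r c" and v: "v \<in> carrier_mat c 1" and u: "u \<in> carrier_mat 1 r"
    and t: "t \<in> carrier_mat 1 1" and inv: "u * A * v * t = 1\<^sub>m 1"
  shows "rk (A - A * v * t * (u * A)) < rk A"
proof -
  define k where "k = rk A"
  obtain S T where S: "S \<in> carrier_mat r k" and T: "T \<in> carrier_mat k c" and A': "A = S * T"
    using rk_factorization[of A thesis] unfolding carrier_matD[OF A] k_def by blast
  note d = carrier_matD[OF S] carrier_matD[OF T] carrier_matD[OF v] carrier_matD[OF u] carrier_matD[OF t]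
  define E where "E = 1\<^sub>m k - T * v * t * (u * S)"
  have E: "E \<in> carrier_mat k k" using d by (auto simp: E_def)
  have eq: "A - A * v * t * (u * A) = S * E * T"
    unfolding A' E_def using d by (simp add: mat_ring)
  \<comment> \<open>The correction term is normalized by \<open>inv\<close> so that it reproduces \<open>u * S\<close>.\<close>
  have b0: "(u * S) * E = 0\<^sub>m 1 k"
  proof -
    have "(u * S) * E = u * S - (u * A * v * t) * (u * S)"
      unfolding A' E_def using d by (simp add: mat_ring)
    then show ?thesis using d by (simp add: inv mat_ring)
  qed
  have "det E = 0"
  proof (rule ccontr)
    assume "det E \<noteq> 0"
    then obtain F where F: "F \<in> carrier_mat k k" "E * F = 1\<^sub>m k"
      using det_non_zero_imp_unit[OF E] by (auto simp: Units_def ring_mat_def)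
    have "u * S = (u * S) * (E * F)" using d F by (simp add: mat_ring)
    also have "\<dots> = ((u * S) * E) * F" using d F E by (simp add: mat_ring)
    also have "\<dots> = 0\<^sub>m 1 k" using F by (simp add: b0 mat_ring)
    finally have "u * S = 0\<^sub>m 1 k" .
    moreover have "u * A * v * t = (u * S) * (T * v * t)" unfolding A' using d by (simp add: mat_ring)
    ultimately have "(1\<^sub>m 1 :: 'a mat) = 0\<^sub>m 1 1" using inv d by (simp add: mat_ring)
    then have "(1\<^sub>m 1 :: 'a mat) $$ (0,0) = 0\<^sub>m 1 1 $$ (0,0)" by simp
    then show False by simp
  qed
  then have "rk E < k" using vec_space.det_zero_low_rank[OF E] E by simp
  moreover have "rk (S * E * T) \<le> rk E"
    using rk_mult_left[of "S * E" T] rk_mult_right[of S E] d E by simp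
  ultimately show ?thesis using eq k_def by simp
qed

lemma rk_zero: "rk (0\<^sub>m r c :: 'a::field mat) = 0"
  using vec_space.rank_0I[of r c] by simp

lemma scalar_recip:
  fixes S :: "'a::field mat"
  assumes "dim_row S = 1" "dim_col S = 1" "S $$ (0,0) \<noteq> 0"
  shows "S * mat 1 1 (\<lambda>_. 1 / S $$ (0,0)) = 1\<^sub>m 1"
  using assms by (intro eq_matI) (simp_all add: scalar_prod_def)

lemma scalar_inverse_comm:
  fixes S T :: "'a::field mat"
  assumes "dim_row S = 1" "dim_col S = 1" "dim_row T = 1" "dim_col T = 1" "S * T = 1\<^sub>m 1"
  shows "T * S = 1\<^sub>m 1"
  by (rule mat_mult_left_right_inverse[of S 1]) (use assms in \<open>auto intro: carrier_matI\<close>)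

definition unit_row :: "nat \<Rightarrow> nat \<Rightarrow> 'a::field mat" where
  "unit_row n i = mat 1 n (\<lambda>(_, j). if j = i then 1 else 0)"

definition unit_col :: "nat \<Rightarrow> nat \<Rightarrow> 'a::field mat" where
  "unit_col n j = mat n 1 (\<lambda>(i, _). if i = j then 1 else 0)"

lemma dim_unit [simp]:
  "dim_row (unit_row n i) = 1" "dim_col (unit_row n i) = n"
  "dim_row (unit_col n i) = n" "dim_col (unit_col n i) = 1"
  by (simp_all add: unit_row_def unit_col_def)

lemma unit_row_mult: "i < dim_row A \<Longrightarrow> j < dim_col A \<Longrightarrow> dim_row A = n \<Longrightarrow> (unit_row n i * A) $$ (0, j) = A $$ (i, j)"
  by (auto simp: unit_row_def scalar_prod_def if_distrib[of "\<lambda>x. x * _"] cong: if_cong)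

lemma mult_unit_col: "i < dim_row A \<Longrightarrow> j < dim_col A \<Longrightarrow> dim_col A = n \<Longrightarrow> (A * unit_col n j) $$ (i, 0) = A $$ (i, j)"
  by (auto simp: unit_col_def scalar_prod_def if_distrib[of "\<lambda>x. _ * x"] cong: if_cong)

lemma row_matrix_eqI:
  assumes d: "dim_row A = r" "dim_col A = c" "dim_row B = r" "dim_col B = c"
    and eq: "\<And>i. i < r \<Longrightarrow> unit_row r i * A = unit_row r i * B"
  shows "A = B"
proof (rule eq_matI)
  fix i j assume "i < dim_row B" "j < dim_col B"
  then show "A $$ (i,j) = B $$ (i,j)"
    using d eq[of i] unit_row_mult[of i A j r] unit_row_mult[of i B j r] by simp
qed (simp_all add: d)

section \<open>Generalized inverses by rank-one updates\<close>

text \<open>One matrix \<open>B\<close> with \<open>A * B * A = A\<close> serves as an inverse of \<open>A\<close> if there is one, and otherwise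
  yields the projections \<open>1 - B * A\<close> and \<open>1 - A * B\<close> onto the two kernels of \<open>A\<close>. It is built by clearing
  the residual \<open>A - A * B * A\<close> row by row; \<open>ginv_upto i A B\<close> holds when the first \<open>i\<close> rows are clear.
  The rank condition counts the rank-one terms of \<open>B\<close>: each adds at most one to \<open>rk B\<close> and takes at least
  one from \<open>rk (1 - B * A)\<close>.\<close>

definition ginv_upto :: "nat \<Rightarrow> 'a::field mat \<Rightarrow> 'a mat \<Rightarrow> bool" where
  "ginv_upto i A B \<longleftrightarrow> dim_row B = dim_col A \<and> dim_col B = dim_row A \<and>
     (\<forall>k<i. unit_row (dim_row A) k * (A - A * B * A) = 0\<^sub>m 1 (dim_col A)) \<and>
     rk B + rk (1\<^sub>m (dim_col A) - B * A) \<le> dim_col A"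

lemma ginv_upto_0: "ginv_upto 0 A (0\<^sub>m (dim_col A) (dim_row A))"
  by (simp add: ginv_upto_def mat_ring rk_one[simplified] rk_zero[simplified])

lemma ginv_upto_skip:
  assumes "ginv_upto i A B"
    and "(unit_row (dim_row A) i - unit_row (dim_row A) i * A * B) * A = 0\<^sub>m 1 (dim_col A)"
  shows "ginv_upto (Suc i) A B"
  using assms by (auto simp: ginv_upto_def less_Suc_eq mat_ring)

text \<open>The residual and \<open>1 - B * A\<close> both undergo a rank reduction with the same pivot, namely the entry
  of the residual in row \<open>i\<close> that \<open>e\<close> selects. It clears row \<open>i\<close> and keeps zero rows zero.\<close>

lemma ginv_upto_step:
  fixes A B :: "'a::field mat"
  assumes inv: "ginv_upto i A B" and i: "i < dim_row A"
    and q: "q = unit_row (dim_row A) i - unit_row (dim_row A) i * A * B"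
    and p: "dim_row e = dim_col A" "dim_col e = 1"
    and s: "dim_row s = 1" "dim_col s = 1" "q * A * e * s = 1\<^sub>m 1"
  shows "ginv_upto (Suc i) A (B + (e - B * (A * e)) * s * q)" (is "ginv_upto _ _ ?B'")
proof -
  have d: "dim_row B = dim_col A" "dim_col B = dim_row A"
    and z: "\<And>k. k < i \<Longrightarrow> unit_row (dim_row A) k * (A - A * B * A) = 0\<^sub>m 1 (dim_col A)"
    and r: "rk B + rk (1\<^sub>m (dim_col A) - B * A) \<le> dim_col A"
    using inv by (auto simp: ginv_upto_def)
  have dq: "dim_row q = 1" "dim_col q = dim_row A" using q d by simp_all
  define X where "X = 1\<^sub>m (dim_col A) - B * A"
  define R where "R = A - A * B * A"
  have dX: "dim_row X = dim_col A" "dim_col X = dim_col A" using d by (simp_all add: X_def)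
  have dR: "dim_row R = dim_row A" "dim_col R = dim_col A" using d by (simp_all add: R_def)
  let ?u = "unit_row (dim_row A) i * A"
  have qA: "q * A = ?u * X" and qA': "q * A = unit_row (dim_row A) i * R"
    using d by (simp_all add: q X_def R_def mat_ring)
  have "1\<^sub>m (dim_col A) - ?B' * A = X - X * e * s * (?u * X)"
    using d p s dq unfolding qA[symmetric]
    by (intro eq_matI) (simp_all add: X_def mat_ring)
  moreover have "rk (X - X * e * s * (?u * X)) < rk X"
    by (rule rk_wedderburn[of _ "dim_col A" "dim_col A"])
       (use d p s dX qA in \<open>auto intro!: carrier_matI\<close>)
  ultimately have "rk (1\<^sub>m (dim_col A) - ?B' * A) < rk X" by simp
  moreover have "rk ?B' \<le> rk B + rk ((e - B * (A * e)) * s * q)"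
    by (rule rk_add) (use d p s dq in simp_all)
  moreover have "rk ((e - B * (A * e)) * s * q) \<le> rk q"
    by (rule rk_mult_right) (use d p s dq in simp_all)
  moreover have "rk q \<le> 1" using rk_le_row[of q] dq by simp
  ultimately have rk': "rk ?B' + rk (1\<^sub>m (dim_col A) - ?B' * A) \<le> dim_col A"
    using r unfolding X_def by linarith
  have R': "A - A * ?B' * A = R - R * e * s * (q * A)"
    using d p s dq by (intro eq_matI) (simp_all add: R_def mat_ring)
  have "unit_row (dim_row A) k * (A - A * ?B' * A) = 0\<^sub>m 1 (dim_col A)" if "k < Suc i" for k
  proof (cases "k < i")
    case True
    have "unit_row (dim_row A) k * (R - R * e * s * (q * A)) =
       unit_row (dim_row A) k * R - (unit_row (dim_row A) k * R) * (e * s * (q * A))"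
      using dR p s dq by (simp add: mat_ring)
    then show ?thesis using z[OF True] p s dq unfolding R' R_def[symmetric] by (simp add: mat_ring)
  next
    case False
    then have k: "k = i" using that by simp
    have "unit_row (dim_row A) k * (R - R * e * s * (q * A)) =
       q * A - (q * A * e * s) * (q * A)"
      using dR p s(1,2) dq unfolding k qA' by (simp add: mat_ring)
    then show ?thesis using p s(1,2) dq k unfolding R' s(3) by (simp add: mat_ring)
  qed
  then show ?thesis using rk' d p s dq by (simp add: ginv_upto_def)
qed

definition is_ginv :: "'a::field mat \<Rightarrow> 'a mat \<Rightarrow> bool" where
  "is_ginv A B \<longleftrightarrow> dim_row B = dim_col A \<and> dim_col B = dim_row A \<and> A * B * A = A \<and>
     rk B + rk (1\<^sub>m (dim_col A) - B * A) \<le> dim_col A"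

lemma ginv_upto_is_ginv:
  assumes "ginv_upto (dim_row A) A B" shows "is_ginv A B"
proof -
  have d: "dim_row B = dim_col A" "dim_col B = dim_row A"
    and z: "\<And>k. k < dim_row A \<Longrightarrow> unit_row (dim_row A) k * (A - A * B * A) = 0\<^sub>m 1 (dim_col A)"
    and r: "rk B + rk (1\<^sub>m (dim_col A) - B * A) \<le> dim_col A"
    using assms by (auto simp: ginv_upto_def)
  have "A - A * B * A = 0\<^sub>m (dim_row A) (dim_col A)"
    by (rule row_matrix_eqI[OF _ _ refl refl]) (use d z in \<open>simp_all add: mult_zero_dim\<close>)
  then have "\<And>i j. i < dim_row A \<Longrightarrow> j < dim_col A \<Longrightarrow> (A - A * B * A) $$ (i,j) = 0" by simp
  then have "A * B * A = A" using d by (intro eq_matI) (simp_all del: index_mult_mat(1))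
  then show ?thesis using d r by (simp add: is_ginv_def)
qed

lemma ginv_exists: "\<exists>B. is_ginv (A :: 'a::field mat) B"
proof -
  have "\<exists>B. ginv_upto i A B" if "i \<le> dim_row A" for i
    using that
  proof (induction i)
    case 0
    show ?case using ginv_upto_0 by blast
  next
    case (Suc i)
    then obtain B where B: "ginv_upto i A B" by auto
    define q where "q = unit_row (dim_row A) i - unit_row (dim_row A) i * A * B"
    have dq: "dim_row (q * A) = 1" "dim_col (q * A) = dim_col A" using B by (auto simp: q_def ginv_upto_def)
    show ?case
    proof (cases "q * A = 0\<^sub>m 1 (dim_col A)")
      case True
      then show ?thesis using ginv_upto_skip[OF B] by (auto simp: q_def)
    next
      case False
      then obtain j where j: "j < dim_col A" "(q * A) $$ (0, j) \<noteq> 0"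
        using dq by (metis eq_matI index_zero_mat less_one)
      let ?e = "unit_col (dim_col A) j"
      have "(q * A * ?e) $$ (0,0) \<noteq> 0" using mult_unit_col[of 0 "q * A" j "dim_col A"] j dq by simp
      from scalar_recip[OF _ _ this]
      have "q * A * ?e * mat 1 1 (\<lambda>_. 1 / (q * A * ?e) $$ (0,0)) = 1\<^sub>m 1" using dq by simp
      from ginv_upto_step[OF B _ q_def _ _ _ _ this] Suc.prems show ?thesis by auto
    qed
  qed
  then show ?thesis using ginv_upto_is_ginv by blast
qed

text \<open>The columns of \<open>B\<close> are fixed by \<open>1 - G * A\<close>, and the rank condition of a generalized inverse bounds
  the rank of this matrix by \<open>dim_col A - rk A\<close>.\<close>

lemma rk_mult_eq_zero:
  fixes A B :: "'a::field mat"
  assumes d: "dim_col A = dim_row B" and z: "A * B = 0\<^sub>m (dim_row A) (dim_col B)"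
  shows "rk A + rk B \<le> dim_col A"
proof -
  obtain G where G: "dim_row G = dim_col A" "dim_col G = dim_row A" "A * G * A = A"
     "rk G + rk (1\<^sub>m (dim_col A) - G * A) \<le> dim_col A"
    using ginv_exists[of A] by (auto simp: is_ginv_def)
  have "rk (A * G * A) \<le> rk (A * G)" by (rule rk_mult_left) (use G in simp)
  also have "\<dots> \<le> rk G" by (rule rk_mult_right) (use G in simp)
  finally have "rk A \<le> rk G" using G by simp
  moreover have "(1\<^sub>m (dim_col A) - G * A) * B = B"
    using G d z by (simp add: mat_ring)
  moreover have "rk ((1\<^sub>m (dim_col A) - G * A) * B) \<le> rk (1\<^sub>m (dim_col A) - G * A)"
    by (rule rk_mult_left) (use G d in simp)
  ultimately show ?thesis using G by simp
qed
section \<open>Greedy construction of the lower factor\<close>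

text \<open>The blocks of two mutually inverse matrices, with block equations oriented as rewrite rules.\<close>

locale inverse_blocks =
  fixes m n :: nat and P1 P2 P3 P4 Q1 Q2 Q3 Q4 :: "'a::field mat"
  assumes dims:
    "dim_row P1 = m" "dim_col P1 = m" "dim_row P2 = m" "dim_col P2 = n"
    "dim_row P3 = n" "dim_col P3 = m" "dim_row P4 = n" "dim_col P4 = n"
    "dim_row Q1 = m" "dim_col Q1 = m" "dim_row Q2 = m" "dim_col Q2 = n"
    "dim_row Q3 = n" "dim_col Q3 = m" "dim_row Q4 = n" "dim_col Q4 = n"
  and QP: "Q1 * P1 = 1\<^sub>m m - Q2 * P3" "Q3 * P1 = - (Q4 * P3)" "Q3 * P2 = 1\<^sub>m n - Q4 * P4"
  and PQ: "P1 * Q1 = 1\<^sub>m m - P2 * Q3" "P1 * Q2 = - (P2 * Q4)"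
    "P3 * Q1 = - (P4 * Q3)" "P3 * Q2 = 1\<^sub>m n - P4 * Q4"
begin

text \<open>\<open>S3 L\<close> and \<open>S4 L\<close> are the lower blocks of \<open>P\<close> after the row operation that the factor with \<open>L\<close>
  undoes; \<open>F1 L\<close> and \<open>F L\<close> are the left blocks of the inverse of that matrix, whose right blocks remain
  \<open>Q2\<close> and \<open>Q4\<close>. The lemmas up to \<open>F1_P\<close> are block equations for this pair of inverse matrices.\<close>

definition S3 where "S3 L = P3 - L * P1"
definition S4 where "S4 L = P4 - L * P2"
definition F where "F L = Q3 + Q4 * L"
definition F1 where "F1 L = Q1 + Q2 * L"

lemma dims_S [simp]:
  "dim_row (S3 L) = dim_row L" "dim_col (S3 L) = m"
  "dim_row (S4 L) = dim_row L" "dim_col (S4 L) = n"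
  "dim_row (F L) = n" "dim_col (F L) = dim_col L"
  "dim_row (F1 L) = m" "dim_col (F1 L) = dim_col L"
  by (simp_all add: S3_def S4_def F_def F1_def dims)

context
  fixes L :: "'a mat"
  assumes L: "dim_row L = n" "dim_col L = m"
begin

lemma F_P1: "F L * P1 = - (Q4 * S3 L)"
  by (rule eq_matI) (simp_all add: F_def S3_def mat_ring dims L QP)

lemma F_P2: "F L * P2 = 1\<^sub>m n - Q4 * S4 L"
  by (rule eq_matI) (simp_all add: F_def S4_def mat_ring dims L QP)

lemma S_Q: "S3 L * Q2 + S4 L * Q4 = 1\<^sub>m n"
  by (rule eq_matI) (simp_all add: S4_def S3_def mat_ring dims L PQ)

lemma P_F: "P1 * F1 L + P2 * F L = 1\<^sub>m m"
proof -
  have "P1 * (Q2 * L) = - (P2 * (Q4 * L))"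
    by (simp add: mult_assoc_dim[symmetric] dims L PQ uminus_mult_dim)
  then show ?thesis
    by (intro eq_matI) (simp_all add: F_def F1_def mat_ring dims L PQ)
qed

lemma S_F: "S3 L * F1 L + S4 L * F L = 0\<^sub>m n m"
proof -
  have "P1 * (Q2 * L) = - (P2 * (Q4 * L))" "P3 * (Q2 * L) = L - P4 * (Q4 * L)"
    by (simp_all add: mult_assoc_dim[symmetric] dims L PQ) (simp_all add: mat_ring dims L)
  then show ?thesis
    by (intro eq_matI) (simp_all add: F_def F1_def S3_def S4_def mat_ring dims L PQ)
qed

lemma F1_P: "F1 L * P1 + Q2 * S3 L = 1\<^sub>m m"
  by (rule eq_matI) (simp_all add: F1_def S3_def mat_ring dims L QP)

text \<open>The case in which the rank of \<open>S3 L\<close> cannot be lowered any further. If \<open>Q4 * S3 L = 0\<close>, then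
  \<open>Q2 * S3 L\<close> still has the rank of \<open>S3 L\<close>, because \<open>S3 L * (Q2 * S3 L) = S3 L\<close>, and its columns lie in
  the kernel of \<open>P1\<close>.\<close>

lemma rk_S3_if_product_zero:
  assumes M: "Q4 * S3 L = 0\<^sub>m n m"
  shows "rk (S3 L) + rk P1 \<le> m"
proof -
  have FP: "F L * P1 = 0\<^sub>m n m" using F_P1 M by (intro eq_matI) simp_all
  have "S3 L = S3 L * (F1 L * P1 + Q2 * S3 L)" by (simp add: F1_P mat_ring L)
  also have "\<dots> = (S3 L * F1 L + S4 L * F L) * P1 - S4 L * (F L * P1) + S3 L * (Q2 * S3 L)"
    by (rule eq_matI) (simp_all add: mat_ring dims L)
  also have "\<dots> = S3 L * (Q2 * S3 L)"
    by (rule eq_matI) (simp_all add: S_F FP mat_ring dims L)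
  finally have "rk (S3 L) = rk (S3 L * (Q2 * S3 L))" by simp
  also have "\<dots> \<le> rk (Q2 * S3 L)" by (rule rk_mult_right) (simp add: dims L)
  finally have le: "rk (S3 L) \<le> rk (Q2 * S3 L)" .
  have "P1 * (Q2 * S3 L) = - (P2 * (Q4 * S3 L))"
    by (simp add: mult_assoc_dim[symmetric] dims L PQ uminus_mult_dim)
  also have "\<dots> = 0\<^sub>m m m" unfolding M by (rule eq_matI) (simp_all add: mat_ring dims)
  finally have "P1 * (Q2 * S3 L) = 0\<^sub>m m m" .
  then have "rk P1 + rk (Q2 * S3 L) \<le> m"
    using rk_mult_eq_zero[of P1 "Q2 * S3 L"] by (simp add: dims)
  with le show ?thesis by linarith
qed

end

text \<open>The state of the loop. \<open>X\<close> is a projection onto the right kernel of \<open>S4 L\<close>, and \<open>Z\<close> acts in the same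
  way on its left kernel; the algorithm needs \<open>Z\<close> only through \<open>W = Z * S3 L\<close>, since \<open>S3 L * v\<close> lies outside
  the column space of \<open>S4 L\<close> if and only if \<open>W * v\<close> is nonzero. Round \<open>i\<close> clears row \<open>i\<close> of \<open>W\<close>.
  The number \<open>k\<close> counts the updates made so far. Once \<open>M\<close> is zero, neither \<open>M\<close>
  nor \<open>S3 L\<close> changes any more.\<close>

definition loop_inv :: "nat \<Rightarrow> 'a mat \<Rightarrow> 'a mat \<Rightarrow> 'a mat \<Rightarrow> 'a mat \<Rightarrow> bool" where
  "loop_inv i L M W X \<longleftrightarrow>
     dim_row L = n \<and> dim_col L = m \<and> M = Q4 * S3 L \<and>
     dim_row X = n \<and> dim_col X = n \<and> S4 L * X = 0\<^sub>m n n \<and>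
     (\<forall>T. dim_row T = n \<and> dim_col T = n \<and> S4 L * T = 0\<^sub>m n n \<longrightarrow> X * T = T) \<and>
     (\<exists>Z. dim_row Z = n \<and> dim_col Z = n \<and> W = Z * S3 L \<and> Z * S4 L = 0\<^sub>m n n \<and>
       (\<forall>T. dim_row T = n \<and> dim_col T = n \<and> T * S4 L = 0\<^sub>m n n \<longrightarrow> T * Z = T)) \<and>
     (\<forall>k<i. unit_row n k * W = 0\<^sub>m 1 m) \<and>
     (\<exists>k. rk L \<le> k \<and> rk P4 + k \<le> rk (S4 L) \<and> (rk (S3 L) + k \<le> rk P3 \<or> M = 0\<^sub>m n m))"

lemma loop_inv_init:
  assumes G: "is_ginv P4 G"
  shows "loop_inv 0 (0\<^sub>m n m) (Q4 * P3) ((1\<^sub>m n - P4 * G) * P3) (1\<^sub>m n - G * P4)"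
proof -
  have d: "dim_row G = n" "dim_col G = n" and g: "P4 * G * P4 = P4"
    using G dims by (auto simp: is_ginv_def)
  have S: "S3 (0\<^sub>m n m) = P3" "S4 (0\<^sub>m n m) = P4"
    by (simp_all add: S3_def S4_def mat_ring dims)
  have g': "P4 * (G * P4) = P4" using g by (simp add: mat_ring dims d)
  have "(1\<^sub>m n - G * P4) * T = T"
    if "dim_row T = n" "dim_col T = n" "P4 * T = 0\<^sub>m n n" for T
    using that by (simp add: mat_ring dims d)
  moreover have "T * (1\<^sub>m n - P4 * G) = T"
    if "dim_row T = n" "dim_col T = n" "T * P4 = 0\<^sub>m n n" for T
  proof -
    have "T * (1\<^sub>m n - P4 * G) = T - (T * P4) * G"
      using that(1,2) by (simp add: mat_ring dims d)
    then show ?thesis unfolding that(3) using that(1,2) by (simp add: mat_ring dims d)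
  qed
  moreover have "P4 * (1\<^sub>m n - G * P4) = 0\<^sub>m n n" "(1\<^sub>m n - P4 * G) * P4 = 0\<^sub>m n n"
    by (simp_all add: mat_ring dims d g')
  ultimately show ?thesis unfolding loop_inv_def S
    by (intro conjI exI[of _ "1\<^sub>m n - P4 * G"] exI[of _ 0])
       (simp_all add: dims d rk_zero[simplified])
qed

lemma loop_inv_skip:
  "loop_inv i L M W X \<Longrightarrow> unit_row n i * W = 0\<^sub>m 1 m \<Longrightarrow> loop_inv (Suc i) L M W X"
  by (auto simp: loop_inv_def less_Suc_eq)

text \<open>A nonzero row of \<open>W\<close> comes from a nonzero vector in the left kernel of the square matrix \<open>S4 L\<close>,
  so that its right kernel is nonzero as well.\<close>

lemma loop_inv_X_nonzero:
  assumes inv: "loop_inv i L M W X" and w: "unit_row n i * W \<noteq> 0\<^sub>m 1 m"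
  shows "X \<noteq> 0\<^sub>m n n"
proof
  assume X0: "X = 0\<^sub>m n n"
  obtain Z where L: "dim_row L = n" "dim_col L = m" and
    ker: "\<And>T. dim_row T = n \<Longrightarrow> dim_col T = n \<Longrightarrow> S4 L * T = 0\<^sub>m n n \<Longrightarrow> X * T = T" and
    Z: "dim_row Z = n" "dim_col Z = n" "W = Z * S3 L" "Z * S4 L = 0\<^sub>m n n"
    using inv by (auto simp: loop_inv_def)
  obtain G where G: "is_ginv (S4 L) G" using ginv_exists by blast
  then have d: "dim_row G = n" "dim_col G = n" and g: "S4 L * G * S4 L = S4 L"
    by (auto simp: is_ginv_def L)
  have "X * (1\<^sub>m n - G * S4 L) = 1\<^sub>m n - G * S4 L"
  proof (rule ker)
    show "S4 L * (1\<^sub>m n - G * S4 L) = 0\<^sub>m n n"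
      using g by (simp add: mat_ring d L)
  qed (simp_all add: d L)
  then have "1\<^sub>m n - G * S4 L = 0\<^sub>m n n" using X0 by (simp add: mat_ring d L)
  then have e: "\<And>i j. i < n \<Longrightarrow> j < n \<Longrightarrow> (1\<^sub>m n - G * S4 L) $$ (i,j) = 0" by simp
  have GS: "G * S4 L = 1\<^sub>m n"
    using e by (intro eq_matI) (simp_all add: d L del: index_mult_mat(1))
  have "S4 L * G = 1\<^sub>m n"
    by (rule mat_mult_left_right_inverse[OF _ _ GS]) (simp_all add: carrier_matI d L)
  then have "Z = Z * (S4 L * G)" by (simp add: mat_ring Z)
  also have "\<dots> = (Z * S4 L) * G" by (simp add: mat_ring Z(1,2) d L)
  also have "\<dots> = 0\<^sub>m n n" by (simp add: Z mat_ring d)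
  finally show False using w Z(3) by (simp add: mat_ring L)
qed

text \<open>One update. With \<open>E = S3 L * v\<close>, \<open>f = y * F L\<close> and \<open>g = f * P2\<close>, the block equations turn the rank-one
  update of \<open>L\<close> into \<open>S3 L - E * s * (y * M)\<close> and \<open>S4 L + E * s * g\<close>, where \<open>g\<close> agrees with \<open>y\<close> on the right
  kernel of \<open>S4 L\<close>. Since \<open>g * x\<close> and \<open>z * E\<close> are nonzero for a right kernel vector \<open>x\<close> and a left kernel
  vector \<open>z\<close>, both kernels shrink: \<open>X\<close> and \<open>W\<close> are cut down to the vectors that \<open>g\<close> and \<open>E\<close> annihilate.
  Conversely the old \<open>S4 L\<close> is a rank reduction of the new one, which is why the rank has increased.
  The rank of \<open>S3 L\<close> goes down by a rank reduction, unless \<open>M\<close> and with it the change of \<open>S3 L\<close> vanishes.\<close>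

lemma loop_inv_step:
  assumes inv: "loop_inv i L M W X" and i: "i < n"
    and dx: "dim_row e = n" "dim_col e = 1" and x: "x = X * e"
    and dy: "dim_row y = 1" "dim_col y = n" and dv: "dim_row v = m" "dim_col v = 1"
    and w: "w = unit_row n i * W"
    and s: "dim_row s = 1" "dim_col s = 1" "dim_row s' = 1" "dim_col s' = 1" "s * s' = 1\<^sub>m 1"
    and a: "dim_row a = 1" "dim_col a = 1" "(w * v) * a = 1\<^sub>m 1"
    and b: "dim_row b = 1" "dim_col b = 1" "(y * x) * b = 1\<^sub>m 1"
    and yMv: "M = 0\<^sub>m n m \<or> y * M * v * s = 1\<^sub>m 1"
  shows "loop_inv (Suc i) (L - S3 L * v * s * (y * F L)) (M - M * v * s * (y * M))
           (W - W * v * a * w) (X - x * b * (y * X))"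
    (is "loop_inv _ ?L ?M ?W ?X")
proof -
  obtain Z k where L: "dim_row L = n" "dim_col L = m" and M: "M = Q4 * S3 L" and
    X: "dim_row X = n" "dim_col X = n" "S4 L * X = 0\<^sub>m n n" and
    kerX: "\<And>T. dim_row T = n \<Longrightarrow> dim_col T = n \<Longrightarrow> S4 L * T = 0\<^sub>m n n \<Longrightarrow> X * T = T" and
    Z: "dim_row Z = n" "dim_col Z = n" "Z * S4 L = 0\<^sub>m n n" and W: "W = Z * S3 L" and
    kerZ: "\<And>T. dim_row T = n \<Longrightarrow> dim_col T = n \<Longrightarrow> T * S4 L = 0\<^sub>m n n \<Longrightarrow> T * Z = T" and
    W0: "\<And>k. k < i \<Longrightarrow> unit_row n k * W = 0\<^sub>m 1 m" and
    k: "rk L \<le> k" "rk P4 + k \<le> rk (S4 L)" "rk (S3 L) + k \<le> rk P3 \<or> M = 0\<^sub>m n m"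
    using inv by (auto simp: loop_inv_def)
  note d = dims L X(1,2) Z(1,2) dx dy dv s(1-4) a(1,2) b(1,2)
  have dM: "dim_row M = n" "dim_col M = m" by (simp_all add: M d)
  have dW: "dim_row W = n" "dim_col W = m" by (simp_all add: W d)
  have dw: "dim_row w = 1" "dim_col w = m" by (simp_all add: w dW)
  have dx': "dim_row x = n" "dim_col x = 1" by (simp_all add: x d)
  define E where "E = S3 L * v"
  define f where "f = y * F L"
  define g where "g = f * P2"
  define z where "z = unit_row n i * Z"
  have dE: "dim_row E = n" "dim_col E = 1" by (simp_all add: E_def d)
  have df: "dim_row f = 1" "dim_col f = m" by (simp_all add: f_def d)
  have dg: "dim_row g = 1" "dim_col g = n" by (simp_all add: g_def f_def d)
  have dz: "dim_row z = 1" "dim_col z = n" by (simp_all add: z_def d)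
  note d' = d dM dW dw dx' dE df dg dz
  have L': "?L = L - E * s * f" by (simp add: E_def f_def)
  have fP1: "f * P1 = - (y * M)"
    using F_P1[OF L] by (simp add: f_def M mat_ring d)
  have g: "g = y - y * Q4 * S4 L"
    using F_P2[OF L] by (simp add: g_def f_def mat_ring d)
  have gX: "g * T = y * T" if T: "dim_row T = n" "S4 L * T = 0\<^sub>m n (dim_col T)" for T
    unfolding g using T by (simp add: mat_ring d)
  have SX: "S4 L * x = 0\<^sub>m n 1"
  proof -
    have "S4 L * x = (S4 L * X) * e" by (simp add: x mat_ring d)
    then show ?thesis unfolding X(3) by (simp add: mat_ring d)
  qed
  have gx: "g * x = y * x" by (rule gX) (simp_all add: SX d')
  have S4': "S4 ?L = S4 L + E * s * g"
    unfolding L' by (rule eq_matI) (simp_all add: S4_def g_def mat_ring d')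
  have S3': "S3 ?L = S3 L - E * s * (y * M)"
  proof -
    have "S3 ?L = S3 L + E * s * (f * P1)"
      unfolding L' by (rule eq_matI) (simp_all add: S3_def mat_ring d')
    then show ?thesis unfolding fP1
      by (intro eq_matI) (simp_all add: mat_ring d')
  qed
  have wz: "w = z * S3 L" "w * v = z * E" "W * v = Z * E"
    by (simp_all add: w z_def W E_def mat_ring d)
  have aw: "a * (z * E) = 1\<^sub>m 1"
    using scalar_inverse_comm[of "w * v" a] a by (simp add: wz(2) d' dE dz)
  have zE: "z * E * a = 1\<^sub>m 1" using a(3) by (simp add: wz(2))
  have bx: "b * (y * x) = 1\<^sub>m 1"
    using scalar_inverse_comm[of "y * x" b] b by (simp add: d')
  have ss: "s' * s = 1\<^sub>m 1" using scalar_inverse_comm[of s s'] s by simp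
  have M': "?M = Q4 * S3 ?L"
    unfolding S3' by (simp add: M E_def mat_ring d)

  define Z' where "Z' = Z - Z * E * a * z"
  have dZ': "dim_row Z' = n" "dim_col Z' = n" by (simp_all add: Z'_def d')
  have zS4: "z * S4 L = 0\<^sub>m 1 n"
  proof -
    have "z * S4 L = unit_row n i * (Z * S4 L)" by (simp add: z_def mat_ring d)
    then show ?thesis unfolding Z(3) by (simp add: mat_ring)
  qed
  have Z'E: "Z' * E = 0\<^sub>m n 1"
  proof -
    have "Z' * E = Z * E - Z * E * (a * (z * E))" by (simp add: Z'_def mat_ring d')
    then show ?thesis unfolding aw by (simp add: mat_ring d')
  qed
  have W': "?W = Z' * S3 ?L"
  proof -
    have "Z' * S3 ?L = Z' * S3 L - (Z' * E) * (s * (y * M))"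
      unfolding S3' by (simp add: mat_ring d' dZ')
    also have "\<dots> = Z' * S3 L" unfolding Z'E by (simp add: mat_ring d' dZ')
    also have "\<dots> = ?W" unfolding W wz(1) by (simp add: Z'_def E_def mat_ring d dz)
    finally show ?thesis by simp
  qed
  have Z'S4: "Z' * S4 ?L = 0\<^sub>m n n"
  proof -
    have "Z' * S4 ?L = Z * S4 L - Z * E * a * (z * S4 L) + (Z' * E) * (s * g)"
      unfolding S4' Z'_def by (simp add: mat_ring d')
    then show ?thesis unfolding Z(3) zS4 Z'E by (simp add: mat_ring d')
  qed
  have kerZ': "T * Z' = T" if T: "dim_row T = n" "dim_col T = n" and T0: "T * S4 ?L = 0\<^sub>m n n" for T
  proof -
    \<comment> \<open>Multiplication by \<open>x\<close> kills the first summand and isolates \<open>T * E\<close>.\<close>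
    have sum: "T * S4 L + T * E * (s * g) = 0\<^sub>m n n"
      using T0 unfolding S4' by (simp add: mat_ring d' T)
    have "(T * S4 L + T * E * (s * g)) * x = T * (S4 L * x) + T * E * (s * (g * x))"
      by (simp add: mat_ring d' T)
    then have 0: "T * E * (s * (y * x)) = 0\<^sub>m n 1"
      unfolding sum SX gx by (simp add: mat_ring d' T)
    have "T * E = T * E * (s * ((y * x) * b) * s')"
      unfolding b(3) by (simp add: mat_ring d' T s(5))
    also have "\<dots> = T * E * (s * (y * x)) * (b * s')" by (simp add: mat_ring d' T)
    also have "\<dots> = 0\<^sub>m n 1" unfolding 0 by (simp add: mat_ring d')
    finally have TE: "T * E = 0\<^sub>m n 1" .
    have "T * S4 L = 0\<^sub>m n n" using sum unfolding TE by (simp add: mat_ring d' T)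
    then have TZ: "T * Z = T" using kerZ T by simp
    have "T * Z' = T * Z - T * Z * E * (a * z)" by (simp add: Z'_def mat_ring d' T)
    then show ?thesis unfolding TZ TE by (simp add: mat_ring d' T)
  qed
  have dX': "dim_row ?X = n" "dim_col ?X = n" by (simp_all add: d')
  have SX': "S4 L * ?X = 0\<^sub>m n n"
  proof -
    have "S4 L * ?X = S4 L * X - (S4 L * x) * (b * (y * X))" by (simp add: mat_ring d')
    then show ?thesis unfolding X(3) SX by (simp add: mat_ring d')
  qed
  have X'0: "S4 ?L * ?X = 0\<^sub>m n n"
  proof -
    have "y * ?X = y * X - (y * x * b) * (y * X)" by (simp add: mat_ring d')
    then have "y * ?X = 0\<^sub>m 1 n" unfolding b(3) by (simp add: mat_ring d')
    then have gX': "g * ?X = 0\<^sub>m 1 n" using gX[of ?X] SX' dX' by simp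
    have "S4 ?L * ?X = S4 L * ?X + E * s * (g * ?X)"
      unfolding S4' using dX' by (simp add: add_mult_dim mult_assoc_dim d')
    then show ?thesis unfolding SX' gX' by (simp add: mat_ring d')
  qed
  have kerX': "?X * T = T" if T: "dim_row T = n" "dim_col T = n" and T0: "S4 ?L * T = 0\<^sub>m n n" for T
  proof -
    \<comment> \<open>Multiplication by \<open>z\<close> kills the first summand and isolates \<open>g * T\<close>.\<close>
    have sum: "S4 L * T + E * (s * (g * T)) = 0\<^sub>m n n"
      using T0 unfolding S4' by (simp add: mat_ring d' T)
    have "z * (S4 L * T + E * (s * (g * T))) = z * S4 L * T + z * E * (s * (g * T))"
      by (simp add: mat_ring d' T)
    then have 0: "z * E * (s * (g * T)) = 0\<^sub>m 1 n"
      unfolding sum zS4 by (simp add: mat_ring d' T)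
    have "g * T = s' * (a * (z * E)) * (s * (g * T))"
      unfolding aw by (simp add: mult_assoc_dim[symmetric] mult_one_dim one_mult_dim d' T ss)
    also have "\<dots> = s' * a * (z * E * (s * (g * T)))" by (simp add: mat_ring d' T)
    also have "\<dots> = 0\<^sub>m 1 n" unfolding 0 by (simp add: mat_ring d')
    finally have gT: "g * T = 0\<^sub>m 1 n" .
    have ST: "S4 L * T = 0\<^sub>m n n" using sum unfolding gT by (simp add: mat_ring d' T)
    then have XT: "X * T = T" using kerX T by simp
    have yT: "y * T = 0\<^sub>m 1 n" using gX[of T] ST T gT by simp
    have "?X * T = X * T - x * b * (y * (X * T))" by (simp add: mat_ring d' T)
    then show ?thesis unfolding XT yT by (simp add: mat_ring d' T)
  qed
  have rows: "unit_row n k * ?W = 0\<^sub>m 1 m" if "k < Suc i" for k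
  proof (cases "k < i")
    case True
    have "unit_row n k * ?W = unit_row n k * W - (unit_row n k * W) * (v * (a * w))"
      by (simp add: mat_ring d')
    then show ?thesis unfolding W0[OF True] by (simp add: mat_ring d')
  next
    case False
    then have "k = i" using that by simp
    then have "unit_row n k * ?W = w - (w * v * a) * w"
      unfolding w by (simp add: mat_ring d')
    then show ?thesis unfolding a(3) by (simp add: mat_ring d')
  qed
  have "rk ?L \<le> rk L + rk (E * s * f)" unfolding L' by (rule rk_minus) (simp_all add: d')
  also have "rk (E * s * f) \<le> rk f" by (rule rk_mult_right) (simp add: d')
  also have "rk f \<le> 1" using rk_le_row[of f] df by simp
  finally have rkL: "rk ?L \<le> Suc k" using k(1) by simp
  \<comment> \<open>The rank reduction of the new matrix with the pivot \<open>z * S4 ?L * x\<close> gives back the old one.\<close>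
  have "rk (S4 L) < rk (S4 ?L)"
  proof -
    let ?t = "b * s' * a" and ?A = "S4 ?L"
    have Ax: "?A * x = E * s * (y * x)"
    proof -
      have "?A * x = S4 L * x + E * s * (g * x)" unfolding S4' by (simp add: mat_ring d')
      then show ?thesis unfolding SX gx by (simp add: mat_ring d')
    qed
    have zA: "z * ?A = z * E * s * g"
    proof -
      have "z * ?A = z * S4 L + z * E * s * g" unfolding S4' by (simp add: mat_ring d')
      then show ?thesis unfolding zS4 by (simp add: mat_ring d')
    qed
    have one: "z * ?A * x * ?t = 1\<^sub>m 1"
    proof -
      have "z * ?A * x * ?t = z * (?A * x) * ?t" by (simp add: mult_assoc_dim d')
      also have "\<dots> = z * E * (s * (y * x * b) * s') * a" unfolding Ax by (simp add: mat_ring d')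
      also have "\<dots> = 1\<^sub>m 1" unfolding b(3) by (simp add: mult_one_dim d' s(5) zE)
      finally show ?thesis .
    qed
    have "?A * x * ?t * (z * ?A) = E * s * (y * x * b) * s' * (a * (z * E)) * (s * g)"
      unfolding Ax zA by (simp add: mat_ring d')
    also have "\<dots> = E * (s * s') * (s * g)" unfolding b(3) aw by (simp add: mat_ring d')
    also have "\<dots> = E * s * g" unfolding s(5) by (simp add: mat_ring d')
    finally have "?A - ?A * x * ?t * (z * ?A) = S4 L"
      unfolding S4' by (intro eq_matI) (simp_all add: d')
    moreover have "rk (?A - ?A * x * ?t * (z * ?A)) < rk ?A"
      by (rule rk_wedderburn[OF _ _ _ _ one]) (rule carrier_matI; simp add: d')+
    ultimately show ?thesis by simp
  qed
  then have rk4: "rk P4 + Suc k \<le> rk (S4 ?L)" using k(2) by linarith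
  have rk3: "rk (S3 ?L) + Suc k \<le> rk P3 \<or> ?M = 0\<^sub>m n m"
  proof (cases "M = 0\<^sub>m n m")
    case True
    then show ?thesis by (simp add: mat_ring d')
  next
    case False
    then have "y * Q4 * S3 L * v * s = 1\<^sub>m 1" using yMv by (simp add: M mat_ring d')
    then have "rk (S3 L - S3 L * v * s * (y * Q4 * S3 L)) < rk (S3 L)"
      by (rule rk_wedderburn[rotated 4]) (rule carrier_matI; simp add: d')+
    moreover have "S3 L - S3 L * v * s * (y * Q4 * S3 L) = S3 ?L"
      unfolding S3' by (simp add: M E_def mat_ring d')
    ultimately show ?thesis using False k(3) by simp
  qed
  show ?thesis unfolding loop_inv_def
  proof (intro conjI exI[of _ Z'] exI[of _ "Suc k"] allI impI)
    show "?M = Q4 * S3 ?L" by (rule M')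
  qed (use W' Z'S4 kerZ' X'0 kerX' rows rkL rk4 rk3 in \<open>auto simp: d' dZ'\<close>)
qed

text \<open>When \<open>W\<close> is zero, the left kernel of \<open>S4 L\<close> is annihilated by \<open>S3 L\<close> too; as the rows of these two
  blocks together are independent, the kernel is zero and \<open>S4 L\<close> is invertible. The count of updates gives
  the upper bounds on the two ranks. The lower bounds hold for every decomposition: they come from
  \<open>S4 L = P4 - L * P2\<close>, from \<open>P3 = L * P1 + S4 L * R\<close>, and from the right inverse \<open>F1 L\<close> of \<open>P1 - P2 * R\<close>.\<close>

lemma loop_inv_end:
  assumes inv: "loop_inv n L M W X" and G: "is_ginv (S4 L) G"
  defines "R \<equiv> G * S3 L"
  shows "S4 L * R = S3 L"
    and "rk L = n - rk P4" and "rk R + rk L = max (rk P3) (n + m - rk P4 - rk P1)"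
proof -
  obtain Z k where L: "dim_row L = n" "dim_col L = m" and M: "M = Q4 * S3 L" and
    Z: "dim_row Z = n" "dim_col Z = n" "Z * S4 L = 0\<^sub>m n n" and W: "W = Z * S3 L" and
    kerZ: "\<And>T. dim_row T = n \<Longrightarrow> dim_col T = n \<Longrightarrow> T * S4 L = 0\<^sub>m n n \<Longrightarrow> T * Z = T" and
    W0: "\<And>k. k < n \<Longrightarrow> unit_row n k * W = 0\<^sub>m 1 m" and
    k: "rk L \<le> k" "rk P4 + k \<le> rk (S4 L)" "rk (S3 L) + k \<le> rk P3 \<or> M = 0\<^sub>m n m"
    using inv by (auto simp: loop_inv_def)
  have dG: "dim_row G = n" "dim_col G = n" and g: "S4 L * G * S4 L = S4 L"
    using G by (auto simp: is_ginv_def L)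
  have dR: "dim_row R = n" "dim_col R = m" by (simp_all add: R_def dG)
  note d = dims L Z(1,2) dG dR
  have "Z * S3 L = 0\<^sub>m n m"
    by (rule row_matrix_eqI[where r = n and c = m]) (use W0 in \<open>simp_all add: W d mult_zero_dim\<close>)
  then have "Z * (S3 L * Q2 + S4 L * Q4) = 0\<^sub>m n m * Q2 + 0\<^sub>m n n * Q4"
    unfolding Z(3)[symmetric] by (simp add: mult_add_dim mult_assoc_dim[symmetric] d)
  then have Z0: "Z = 0\<^sub>m n n" unfolding S_Q[OF L] by (simp add: mat_ring d)
  have "(1\<^sub>m n - S4 L * G) * Z = 1\<^sub>m n - S4 L * G"
  proof (rule kerZ)
    show "(1\<^sub>m n - S4 L * G) * S4 L = 0\<^sub>m n n"
      by (simp add: minus_mult_dim one_mult_dim d g minus_self_dim)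
  qed (simp_all add: d)
  then have "1\<^sub>m n - S4 L * G = 0\<^sub>m n n" unfolding Z0 by (simp add: mat_ring d)
  then have e: "\<And>i j. i < n \<Longrightarrow> j < n \<Longrightarrow> (1\<^sub>m n - S4 L * G) $$ (i,j) = 0" by simp
  have SG: "S4 L * G = 1\<^sub>m n"
    using e by (intro eq_matI) (simp_all add: d del: index_mult_mat(1))
  have GS: "G * S4 L = 1\<^sub>m n"
    by (rule mat_mult_left_right_inverse[OF _ _ SG]) (simp_all add: carrier_matI d)
  show SR: "S4 L * R = S3 L"
    by (simp add: R_def mult_assoc_dim[symmetric] d SG one_mult_dim)
  have "n = rk (S4 L * G)" by (simp add: SG rk_one[simplified])
  also have "\<dots> \<le> rk (S4 L)" by (rule rk_mult_left) (simp add: d)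
  finally have n4: "n \<le> rk (S4 L)" .
  moreover have "rk (S4 L) \<le> n" using rk_le_row[of "S4 L"] by (simp add: d)
  ultimately have rS4: "rk (S4 L) = n" by simp
  have "rk (S4 L) \<le> rk P4 + rk (L * P2)" unfolding S4_def by (rule rk_minus) (simp_all add: d)
  also have "rk (L * P2) \<le> rk L" by (rule rk_mult_left) (simp add: d)
  finally have kL: "rk L = k" "rk P4 + k = n" using k rS4 by simp_all
  then show rL: "rk L = n - rk P4" by simp
  have R_le: "rk R \<le> rk (S3 L)" unfolding R_def by (rule rk_mult_right) (simp add: d)
  have "rk P3 \<le> rk L + rk R"
  proof -
    have "P3 = L * P1 + S4 L * R" unfolding SR by (rule eq_matI) (simp_all add: S3_def d)
    then have "rk P3 = rk (L * P1 + S4 L * R)" by simp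
    also have "\<dots> \<le> rk (L * P1) + rk (S4 L * R)" by (rule rk_add) (simp_all add: d)
    also have "rk (L * P1) \<le> rk L" by (rule rk_mult_left) (simp add: d)
    also have "rk (S4 L * R) \<le> rk R" by (rule rk_mult_right) (simp add: d)
    finally show ?thesis by simp
  qed
  moreover have "m \<le> rk P1 + rk R"
  proof -
    have "R * F1 L + F L = G * (S3 L * F1 L + S4 L * F L)"
      by (simp add: R_def mult_add_dim mult_assoc_dim d)
         (simp add: mult_assoc_dim[symmetric] d GS one_mult_dim)
    also have "\<dots> = 0\<^sub>m n m" unfolding S_F[OF L] by (simp add: mat_ring d)
    finally have 0: "R * F1 L + F L = 0\<^sub>m n m" .
    have "(P1 - P2 * R) * F1 L = P1 * F1 L + P2 * F L - P2 * (R * F1 L + F L)"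
      by (rule eq_matI) (simp_all add: mat_ring d)
    also have "\<dots> = 1\<^sub>m m" unfolding 0 P_F[OF L] by (simp add: mat_ring d)
    finally have "m = rk ((P1 - P2 * R) * F1 L)" by (simp add: rk_one[simplified])
    also have "\<dots> \<le> rk (P1 - P2 * R)" by (rule rk_mult_left) (simp add: d)
    also have "\<dots> \<le> rk P1 + rk (P2 * R)" by (rule rk_minus) (simp_all add: d)
    also have "rk (P2 * R) \<le> rk R" by (rule rk_mult_right) (simp add: d)
    finally show ?thesis by simp
  qed
  moreover have "rk R + rk L \<le> rk P3 \<or> rk R + rk P1 \<le> m"
    using k(3) kL R_le rk_S3_if_product_zero[OF L] unfolding M by linarith
  moreover have "rk P4 \<le> n" using rk_le_row[of P4] by (simp add: d)
  moreover have "rk P1 \<le> m" using rk_le_row[of P1] by (simp add: d)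
  ultimately show "rk R + rk L = max (rk P3) (n + m - rk P4 - rk P1)"
    unfolding rL by linarith
qed

end

section \<open>Symbolic execution of programs\<close>

primrec known_val :: "(nat \<rightharpoonup> nat) \<Rightarrow> index_expr \<Rightarrow> nat option" where
  "known_val V (Const k) = Some k"
| "known_val V (Var x) = V x"
| "known_val V (Plus e f) = (case (known_val V e, known_val V f) of (Some a, Some b) \<Rightarrow> Some (a + b) | _ \<Rightarrow> None)"
| "known_val V (Minus e f) = (case (known_val V e, known_val V f) of (Some a, Some b) \<Rightarrow> Some (a - b) | _ \<Rightarrow> None)"

lemma known_val_sound:
  "(\<And>x k. V x = Some k \<Longrightarrow> v x = k) \<Longrightarrow> known_val V e = Some r \<Longrightarrow> index_val e v = r"
  by (induction e arbitrary: r) (auto split: option.splits)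

text \<open>What is known about a state: the values of some index variables, the contents of some arrays, and a
  bound on the number of operations. The rules below transform snapshots symbolically. The index variables from
  20 on and array 99 are left out of every snapshot, so that the loops inside the primitive programs
  can use them freely.\<close>

definition snapshot :: "(nat \<rightharpoonup> nat) \<Rightarrow> (nat \<rightharpoonup> 'a::field mat) \<Rightarrow> nat \<Rightarrow> 'a state \<Rightarrow> bool" where
  "snapshot V E c s \<longleftrightarrow>
     (\<forall>x k. V x = Some k \<longrightarrow> idx s x = k) \<and>
     (\<forall>a A i j. E a = Some A \<longrightarrow> i < dim_row A \<longrightarrow> j < dim_col A \<longrightarrow> mem s a i j = A $$ (i, j)) \<and>
     ops s \<le> c \<and> dom V \<subseteq> {..<20} \<and> E 99 = None"

lemma snapshot_known_val: "snapshot V E c s \<Longrightarrow> known_val V e = Some r \<Longrightarrow> index_val e (idx s) = r"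
  by (rule known_val_sound[of V]) (auto simp: snapshot_def)

lemma snapshot_mem: "snapshot V E c s \<Longrightarrow> E a = Some A \<Longrightarrow> i < dim_row A \<Longrightarrow> j < dim_col A \<Longrightarrow> mem s a i j = A $$ (i, j)"
  by (auto simp: snapshot_def)

lemma snapshot_weaken:
  assumes "snapshot V E c s" "V' \<subseteq>\<^sub>m V" "E' \<subseteq>\<^sub>m E" "c \<le> c'"
  shows "snapshot V' E' c' s"
proof -
  have V: "V x = Some k" if "V' x = Some k" for x k
    using that assms(2) by (metis domI map_le_def)
  have E: "E x = Some k" if "E' x = Some k" for x k
    using that assms(3) by (metis domI map_le_def)
  have "dom V' \<subseteq> dom V" using assms(2) by (rule map_le_implies_dom_le)
  moreover have "E' 99 = None"
    using assms(1) E[of 99] by (cases "E' 99") (auto simp: snapshot_def)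
  ultimately show ?thesis using assms(1,4) V E unfolding snapshot_def
    by (meson le_trans subset_trans)
qed

lemma snapshot_set_index: "snapshot V E c s \<Longrightarrow> x < 20 \<Longrightarrow> snapshot (V(x \<mapsto> k)) E c (set_index x k s)"
  by (auto simp: snapshot_def set_index_def)

lemma exec_SetIndex:
  "snapshot V E c s \<Longrightarrow> known_val V e = Some k \<Longrightarrow> x < 20 \<Longrightarrow> snapshot (V(x \<mapsto> k)) E c (exec (SetIndex x e) s)"
  by (simp add: snapshot_known_val snapshot_set_index)

lemma exec_IfLess:
  "snapshot V E c s \<Longrightarrow> known_val V e = Some a \<Longrightarrow> known_val V f = Some b \<Longrightarrow>
   exec (IfLess e f p q) s = (if a < b then exec p s else exec q s)"
  by (simp add: snapshot_known_val)

lemma exec_IfZero: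
  "snapshot V E c s \<Longrightarrow> known_val V e = Some i \<Longrightarrow> known_val V f = Some j \<Longrightarrow> E a = Some A \<Longrightarrow>
   i < dim_row A \<Longrightarrow> j < dim_col A \<Longrightarrow>
   exec (IfZero (Cell a e f) p q) s = (if A $$ (i,j) = 0 then exec p (tick s) else exec q (tick s))"
  by (simp add: snapshot_known_val snapshot_mem)

lemma snapshot_tick: "snapshot V E c s \<Longrightarrow> snapshot V E (Suc c) (tick s)"
  by (simp add: snapshot_def tick_def)

lemma For_rule:
  assumes "Inv 0 s" "index_val e (idx s) = N"
    "\<And>k t. k < N \<Longrightarrow> Inv k t \<Longrightarrow> Inv (Suc k) (exec p (set_index x k t))"
  shows "Inv N (exec (For x e p) s)"
proof -
  have "Inv k (fold (\<lambda>k t. exec p (set_index x k t)) [0..<k] s)" if "k \<le> N" for k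
    using that by (induction k) (auto simp: assms)
  then show ?thesis using assms(2) by simp
qed

text \<open>The common form of programs that treat the entries of a matrix one by one; \<open>body\<close> finds the position in
  variables 23 and 24. The bounds are fixed on entry, since the inner one is evaluated again for every row.
  Variable 22 is left for a further bound that \<open>body\<close> needs.\<close>

definition fill :: "index_expr \<Rightarrow> index_expr \<Rightarrow> prog \<Rightarrow> prog" where
  "fill re ce body = Seq (SetIndex 20 re) (Seq (SetIndex 21 ce) (For 23 (Var 20) (For 24 (Var 21) body)))"

text \<open>Reduces the double loop to a single entry: \<open>body\<close> is considered in any state in which this entry and all
  arrays other than \<open>a\<close> and the scratch array 99 are as at the start of the loop.\<close>

lemma exec_fill:
  fixes N :: "'a::field mat"
  assumes s: "snapshot V E c s" "known_val V re = Some r" "known_val V ce = Some q" "a \<noteq> 99"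
    and N: "dim_row N = r" "dim_col N = q"
    and body: "\<And>i j t. i < r \<Longrightarrow> j < q \<Longrightarrow> (\<forall>d. d \<noteq> a \<longrightarrow> d \<noteq> 99 \<longrightarrow> mem t d = mem s d) \<Longrightarrow>
        mem t a i j = mem s a i j \<Longrightarrow> (\<forall>v. v < 20 \<or> v = 22 \<longrightarrow> idx t v = idx s v) \<Longrightarrow>
        idx t 23 = i \<Longrightarrow> idx t 24 = j \<Longrightarrow>
        mem (exec body t) = (mem t)(a := (mem t a)(i := (mem t a i)(j := N $$ (i,j))), 99 := mem (exec body t) 99) \<and>
        (\<forall>v\<le>24. idx (exec body t) v = idx t v) \<and> ops (exec body t) \<le> ops t + k"
  shows "snapshot V (E(a \<mapsto> N)) (c + r * q * k) (exec (fill re ce body) s)"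
proof -
  define s1 where "s1 = set_index 21 q (set_index 20 r s)"
  have V20: "V x = Some k \<Longrightarrow> x < 20" for x k using s(1) by (auto simp: snapshot_def)
  have idx1: "index_val ce (idx (set_index 20 r s)) = q"
    using s(1,3) V20 by (intro known_val_sound[of V]) (auto simp: snapshot_def set_index_def)
  have ex: "exec (fill re ce body) s = exec (For 23 (Var 20) (For 24 (Var 21) body)) s1"
    using snapshot_known_val[OF s(1,2)] idx1 by (simp add: fill_def s1_def)
  define filled where "filled i j t \<longleftrightarrow> (\<forall>d. d \<noteq> a \<longrightarrow> d \<noteq> 99 \<longrightarrow> mem t d = mem s d) \<and>
     (\<forall>i' j'. mem t a i' j' = (if (i' < i \<and> j' < q) \<or> (i' = i \<and> j' < j) then N $$ (i',j') else mem s a i' j')) \<and>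
     (\<forall>v. v < 20 \<or> v = 22 \<longrightarrow> idx t v = idx s v) \<and> idx t 20 = r \<and> idx t 21 = q \<and>
     ops t \<le> ops s + i * q * k + j * k" for i j and t :: "'a state"
  have "filled r 0 (exec (For 23 (Var 20) (For 24 (Var 21) body)) s1)"
  proof (rule For_rule[where Inv = "\<lambda>i. filled i 0"])
    show "filled 0 0 s1" by (simp add: filled_def s1_def set_index_def)
    show "index_val (Var 20) (idx s1) = r" by (simp add: s1_def set_index_def)
    fix i t assume i: "i < r" and t: "filled i 0 t"
    have "filled i q (exec (For 24 (Var 21) body) (set_index 23 i t)) \<and>
      idx (exec (For 24 (Var 21) body) (set_index 23 i t)) 23 = i"
    proof (rule For_rule[where Inv = "\<lambda>j u. filled i j u \<and> idx u 23 = i"])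
      show "filled i 0 (set_index 23 i t) \<and> idx (set_index 23 i t) 23 = i"
        using t by (simp add: filled_def set_index_def)
      show "index_val (Var 21) (idx (set_index 23 i t)) = q"
        using t by (simp add: filled_def set_index_def)
      fix j u assume j: "j < q" and u: "filled i j u \<and> idx u 23 = i"
      let ?u = "set_index 24 j u"
      have "(\<forall>d. d \<noteq> a \<longrightarrow> d \<noteq> 99 \<longrightarrow> mem ?u d = mem s d)" "mem ?u a i j = mem s a i j"
        "(\<forall>v. v < 20 \<or> v = 22 \<longrightarrow> idx ?u v = idx s v)" "idx ?u 23 = i" "idx ?u 24 = j"
        using u by (auto simp: filled_def set_index_def)
      from body[OF i j this]
      have b: "mem (exec body ?u) = (mem u)(a := (mem u a)(i := (mem u a i)(j := N $$ (i,j))), 99 := mem (exec body ?u) 99)"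
        "\<And>v. v \<le> 24 \<Longrightarrow> idx (exec body ?u) v = (if v = 24 then j else idx u v)" "ops (exec body ?u) \<le> ops u + k"
        by (auto simp: set_index_def)
      have m: "mem (exec body ?u) d = mem s d" if "d \<noteq> a" "d \<noteq> 99" for d
        using that u by (subst b(1)) (simp add: filled_def)
      have m2: "mem (exec body ?u) a i' j' = (if (i' < i \<and> j' < q) \<or> (i' = i \<and> j' < Suc j) then N $$ (i',j') else mem s a i' j')" for i' j'
        using u \<open>a \<noteq> 99\<close> by (subst b(1)) (auto simp: filled_def less_Suc_eq)
      show "filled i (Suc j) (exec body ?u) \<and> idx (exec body ?u) 23 = i"
        using u b(3) by (auto simp: filled_def m m2 b(2))
    qed
    then show "filled (Suc i) 0 (exec (For 24 (Var 21) body) (set_index 23 i t))"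
      by (auto simp: filled_def less_Suc_eq algebra_simps)
  qed
  then have filled: "filled r 0 (exec (fill re ce body) s)" by (simp add: ex)
  show ?thesis unfolding snapshot_def
  proof (intro conjI allI impI)
    fix x k assume "V x = Some k"
    then show "idx (exec (fill re ce body) s) x = k" using filled V20[of x k] s(1) by (auto simp: filled_def snapshot_def)
  next
    fix b A i j assume "(E(a \<mapsto> N)) b = Some A" "i < dim_row A" "j < dim_col A"
    moreover have "E 99 = None" using s(1) by (simp add: snapshot_def)
    ultimately show "mem (exec (fill re ce body) s) b i j = A $$ (i, j)"
      using filled s(1,4) N by (cases "b = 99") (auto simp: filled_def snapshot_def split: if_splits)
  qed (use filled s(1,4) in \<open>auto simp: filled_def snapshot_def\<close>)
qed

text \<open>The entry is one where the two index expressions agree. This covers zero matrices, identities and unit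
  vectors. Equality of indices is expressed by two comparisons.\<close>

definition delta_fill :: "nat \<Rightarrow> index_expr \<Rightarrow> index_expr \<Rightarrow> index_expr \<Rightarrow> index_expr \<Rightarrow> prog" where
  "delta_fill a re ce e f =
     (let x = Cell a (Var 23) (Var 24)
      in fill re ce (IfLess e f (SetZero x) (IfLess f e (SetZero x) (SetOne x))))"

lemma exec_delta_fill:
  assumes s: "snapshot V E c s" "known_val V re = Some r" "known_val V ce = Some q" "a \<noteq> 99"
    and e: "\<And>i j. i < r \<Longrightarrow> j < q \<Longrightarrow> known_val (V(23 \<mapsto> i, 24 \<mapsto> j)) e = Some (u i j)"
    and f: "\<And>i j. i < r \<Longrightarrow> j < q \<Longrightarrow> known_val (V(23 \<mapsto> i, 24 \<mapsto> j)) f = Some (w i j)"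
  shows "snapshot V (E(a \<mapsto> mat r q (\<lambda>(i,j). if u i j = w i j then 1 else 0))) c (exec (delta_fill a re ce e f) s)"
proof -
  have V20: "V x = Some k \<Longrightarrow> x < 20 \<and> idx s x = k" for x k using s(1) by (auto simp: snapshot_def)
  have "snapshot V (E(a \<mapsto> mat r q (\<lambda>(i,j). if u i j = w i j then 1 else 0))) (c + r * q * 0) (exec (delta_fill a re ce e f) s)"
    unfolding delta_fill_def Let_def
  proof (rule exec_fill[OF s])
    let ?x = "Cell a (Var 23) (Var 24)"
    let ?body = "IfLess e f (SetZero ?x) (IfLess f e (SetZero ?x) (SetOne ?x))"
    let ?N = "mat r q (\<lambda>(i,j). if u i j = w i j then 1 else 0)"
    fix i j and t :: "'a state" assume ij: "i < r" "j < q" and t: "\<forall>v. v < 20 \<or> v = 22 \<longrightarrow> idx t v = idx s v" "idx t 23 = i" "idx t 24 = j"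
    have "index_val e (idx t) = u i j"
      by (rule known_val_sound[OF _ e[OF ij]]) (use t V20 in \<open>auto split: if_splits\<close>)
    moreover have "index_val f (idx t) = w i j"
      by (rule known_val_sound[OF _ f[OF ij]]) (use t V20 in \<open>auto split: if_splits\<close>)
    ultimately show "mem (exec ?body t) =
          (mem t)(a := (mem t a)(i := (mem t a i)(j := ?N $$ (i, j))),
           99 := mem (exec ?body t) 99) \<and>
          (\<forall>v\<le>24. idx (exec ?body t) v = idx t v) \<and>
          ops (exec ?body t) \<le> ops t + 0"
      using ij t \<open>a \<noteq> 99\<close> by (auto simp: Let_def fun_eq_iff)
  qed simp_all
  then show ?thesis by simp
qed

definition copy_block :: "nat \<Rightarrow> nat \<Rightarrow> index_expr \<Rightarrow> index_expr \<Rightarrow> index_expr \<Rightarrow> index_expr \<Rightarrow> prog" where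
  "copy_block a b ro co re ce =
     fill re ce (Copy (Cell a (Var 23) (Var 24)) (Cell b (Plus ro (Var 23)) (Plus co (Var 24))))"

lemma exec_copy_block:
  assumes s: "snapshot V E c s" "known_val V re = Some r" "known_val V ce = Some q" "a \<noteq> 99"
    and o: "known_val V ro = Some ioff" "known_val V co = Some joff"
    and b: "E b = Some B" "ioff + r \<le> dim_row B" "joff + q \<le> dim_col B" "a \<noteq> b"
  shows "snapshot V (E(a \<mapsto> mat r q (\<lambda>(i,j). B $$ (ioff + i, joff + j)))) c (exec (copy_block a b ro co re ce) s)"
proof -
  have V20: "V x = Some k \<Longrightarrow> x < 20 \<and> idx s x = k" for x k using s(1) by (auto simp: snapshot_def)
  have b99: "b \<noteq> 99" using s(1) b(1) by (auto simp: snapshot_def)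
  have "snapshot V (E(a \<mapsto> mat r q (\<lambda>(i,j). B $$ (ioff + i, joff + j)))) (c + r * q * 0) (exec (copy_block a b ro co re ce) s)"
    unfolding copy_block_def
  proof (rule exec_fill[OF s])
    let ?body = "Copy (Cell a (Var 23) (Var 24)) (Cell b (Plus ro (Var 23)) (Plus co (Var 24)))"
    let ?N = "mat r q (\<lambda>(i,j). B $$ (ioff + i, joff + j))"
    fix i j and t :: "'a state" assume ij: "i < r" "j < q" and t: "\<forall>v. v < 20 \<or> v = 22 \<longrightarrow> idx t v = idx s v" "idx t 23 = i" "idx t 24 = j"
      and m: "\<forall>d. d \<noteq> a \<longrightarrow> d \<noteq> 99 \<longrightarrow> mem t d = mem s d"
    have "index_val ro (idx t) = ioff"
      by (rule known_val_sound[OF _ o(1)]) (use t V20 in auto)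
    moreover have "index_val co (idx t) = joff"
      by (rule known_val_sound[OF _ o(2)]) (use t V20 in auto)
    moreover have "mem t b (ioff + i) (joff + j) = B $$ (ioff + i, joff + j)"
      using m b b99 ij snapshot_mem[OF s(1) b(1)] by simp
    ultimately show "mem (exec ?body t) =
          (mem t)(a := (mem t a)(i := (mem t a i)(j := ?N $$ (i, j))),
           99 := mem (exec ?body t) 99) \<and>
          (\<forall>v\<le>24. idx (exec ?body t) v = idx t v) \<and>
          ops (exec ?body t) \<le> ops t + 0"
      using ij t \<open>a \<noteq> 99\<close> by (auto simp: Let_def fun_eq_iff)
  qed simp_all
  then show ?thesis by simp
qed

definition accumulate :: "arith_op \<Rightarrow> nat \<Rightarrow> nat \<Rightarrow> nat \<Rightarrow> index_expr \<Rightarrow> index_expr \<Rightarrow> index_expr \<Rightarrow> prog" where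
  "accumulate f a b c re ke ce =
     Seq (SetIndex 22 ke)
       (fill re ce
         (For 25 (Var 22)
           (Seq (Arith (Cell 99 (Const 0) (Const 0)) Mult (Cell b (Var 23) (Var 25)) (Cell c (Var 25) (Var 24)))
             (Arith (Cell a (Var 23) (Var 24)) f (Cell a (Var 23) (Var 24)) (Cell 99 (Const 0) (Const 0))))))"

text \<open>The scalar \<open>g\<close> lets one proof serve for addition and subtraction.\<close>

lemma exec_accumulate:
  fixes A B C :: "'a::field mat"
  assumes f: "\<And>x y :: 'a. arith_val f x y = x + g * y"
    and s: "snapshot V E c s" "known_val V re = Some r" "known_val V ke = Some l" "known_val V ce = Some q"
    and a: "E a = Some A" "dim_row A = r" "dim_col A = q"
    and b: "E b = Some B" "dim_row B = r" "dim_col B = l" "b \<noteq> a"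
    and d: "E d = Some D" "dim_row D = l" "dim_col D = q" "d \<noteq> a"
  shows "snapshot V (E(a \<mapsto> A + g \<cdot>\<^sub>m (B * D))) (c + 2 * (r * l * q)) (exec (accumulate f a b d re ke ce) s)"
proof -
  let ?body = "For 25 (Var 22)
           (Seq (Arith (Cell 99 (Const 0) (Const 0)) Mult (Cell b (Var 23) (Var 25)) (Cell d (Var 25) (Var 24)))
             (Arith (Cell a (Var 23) (Var 24)) f (Cell a (Var 23) (Var 24)) (Cell 99 (Const 0) (Const 0))))"
  let ?s = "set_index 22 l s"
  have n99: "a \<noteq> 99" "b \<noteq> 99" "d \<noteq> 99" using s(1) a(1) b(1) d(1) by (auto simp: snapshot_def)
  have s': "snapshot V E c ?s" using s(1) unfolding snapshot_def set_index_def by (auto split: if_splits)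
  have "snapshot V (E(a \<mapsto> A + g \<cdot>\<^sub>m (B * D))) (c + r * q * (2 * l)) (exec (fill re ce ?body) ?s)"
  proof (rule exec_fill[OF s' s(2,4) n99(1)])
    fix i j and t :: "'a state" assume ij: "i < r" "j < q" and t: "\<forall>v. v < 20 \<or> v = 22 \<longrightarrow> idx t v = idx ?s v" "idx t 23 = i" "idx t 24 = j"
      and m: "\<forall>d. d \<noteq> a \<longrightarrow> d \<noteq> 99 \<longrightarrow> mem t d = mem ?s d" and ma: "mem t a i j = mem ?s a i j"
    have mB: "mem t b i k = B $$ (i,k)" "mem t d k j = D $$ (k,j)" if "k < l" for k
      using m n99 b d ij that snapshot_mem[OF s' b(1)] snapshot_mem[OF s' d(1)] by auto
    have mA: "mem t a i j = A $$ (i,j)" using ma ij a snapshot_mem[OF s' a(1)] by simp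
    define I where "I k u \<longleftrightarrow> mem u = (mem t)(a := (mem t a)(i := (mem t a i)(j := A $$ (i,j) + g * (\<Sum>k'<k. B $$ (i,k') * D $$ (k',j)))), 99 := mem u 99) \<and>
       (\<forall>v\<le>24. idx u v = idx t v) \<and> ops u \<le> ops t + 2 * k" for k and u :: "'a state"
    have I: "I l (exec ?body t)"
    proof (rule For_rule)
      show "I 0 t" using mA by (simp add: I_def fun_eq_iff)
      show "index_val (Var 22) (idx t) = l" using t(1) by (simp add: set_index_def)
      fix k u assume k: "k < l" and u: "I k u"
      have mu: "mem u = (mem t)(a := (mem t a)(i := (mem t a i)(j := A $$ (i,j) + g * (\<Sum>k'<k. B $$ (i,k') * D $$ (k',j)))), 99 := mem u 99)"
        and iu: "\<And>v. v \<le> 24 \<Longrightarrow> idx u v = idx t v" "ops u \<le> ops t + 2 * k"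
        using u by (auto simp: I_def)
      have i2: "idx u 23 = i" "idx u 24 = j" using iu t by auto
      have mub: "mem u b i k = B $$ (i,k)" "mem u d k j = D $$ (k,j)"
        by (subst mu, use mB[OF k] n99 b(4) d(4) in simp)+
      have mua: "mem u a i j = A $$ (i,j) + g * (\<Sum>k'<k. B $$ (i,k') * D $$ (k',j))"
        by (subst mu) (use n99 in simp)
      let ?u = "exec (Seq (Arith (Cell 99 (Const 0) (Const 0)) Mult (Cell b (Var 23) (Var 25)) (Cell d (Var 25) (Var 24)))
             (Arith (Cell a (Var 23) (Var 24)) f (Cell a (Var 23) (Var 24)) (Cell 99 (Const 0) (Const 0)))) (set_index 25 k u)"
      have "mem ?u = (mem u)(a := (mem u a)(i := (mem u a i)(j := A $$ (i,j) + g * (\<Sum>k'<Suc k. B $$ (i,k') * D $$ (k',j)))), 99 := mem ?u 99)"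
        using n99 i2 mub mua by (simp add: set_index_def Let_def tick_def f fun_eq_iff algebra_simps)
      also have "\<dots> = (mem t)(a := (mem t a)(i := (mem t a i)(j := A $$ (i,j) + g * (\<Sum>k'<Suc k. B $$ (i,k') * D $$ (k',j)))), 99 := mem ?u 99)"
        by (subst (1 2 3) mu) (use n99 in \<open>simp add: fun_eq_iff\<close>)
      finally show "I (Suc k) ?u"
        using iu unfolding I_def by (auto simp: set_index_def Let_def tick_def)
    qed
    have eq: "(A + g \<cdot>\<^sub>m (B * D)) $$ (i,j) = A $$ (i,j) + g * (\<Sum>k'<l. B $$ (i,k') * D $$ (k',j))"
      using ij a b d by (simp add: scalar_prod_def atLeast0LessThan)
    show "mem (exec ?body t) = (mem t)(a := (mem t a)(i := (mem t a i)(j := (A + g \<cdot>\<^sub>m (B * D)) $$ (i,j))), 99 := mem (exec ?body t) 99) \<and>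
       (\<forall>v\<le>24. idx (exec ?body t) v = idx t v) \<and> ops (exec ?body t) \<le> ops t + 2 * l"
      unfolding eq using I unfolding I_def by blast
  qed (use a b d in simp_all)
  moreover have "exec (accumulate f a b d re ke ce) s = exec (fill re ce ?body) ?s"
    using snapshot_known_val[OF s(1,3)] by (simp add: accumulate_def)
  ultimately show ?thesis by (simp add: mult.assoc mult.commute mult.left_commute)
qed

lemma exec_accumulate_Add:
  fixes A B D :: "'a::field mat"
  assumes s: "snapshot V E c s" "known_val V re = Some r" "known_val V ke = Some l" "known_val V ce = Some q"
    and a: "E a = Some A" "dim_row A = r" "dim_col A = q"
    and b: "E b = Some B" "dim_row B = r" "dim_col B = l" "b \<noteq> a"
    and d: "E d = Some D" "dim_row D = l" "dim_col D = q" "d \<noteq> a"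
  shows "snapshot V (E(a \<mapsto> A + B * D)) (c + 2 * (r * l * q)) (exec (accumulate Add a b d re ke ce) s)"
proof -
  have "A + 1 \<cdot>\<^sub>m (B * D) = A + B * D" by (rule eq_matI) simp_all
  then show ?thesis using exec_accumulate[OF _ s a b d, of Add 1] by simp
qed

lemma exec_accumulate_Sub:
  fixes A B D :: "'a::field mat"
  assumes s: "snapshot V E c s" "known_val V re = Some r" "known_val V ke = Some l" "known_val V ce = Some q"
    and a: "E a = Some A" "dim_row A = r" "dim_col A = q"
    and b: "E b = Some B" "dim_row B = r" "dim_col B = l" "b \<noteq> a"
    and d: "E d = Some D" "dim_row D = l" "dim_col D = q" "d \<noteq> a"
  shows "snapshot V (E(a \<mapsto> A - B * D)) (c + 2 * (r * l * q)) (exec (accumulate Sub a b d re ke ce) s)"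
proof -
  have "A + (- 1) \<cdot>\<^sub>m (B * D) = A - B * D" by (rule eq_matI) (simp_all add: a b d)
  then show ?thesis using exec_accumulate[OF _ s a b d, of Sub "- 1"] by simp
qed

definition zero_fill :: "nat \<Rightarrow> index_expr \<Rightarrow> index_expr \<Rightarrow> prog" where
  "zero_fill a re ce = delta_fill a re ce (Const 0) (Const 1)"

lemma exec_zero_fill:
  assumes s: "snapshot V E c s" "known_val V re = Some r" "known_val V ce = Some q" "a \<noteq> 99"
  shows "snapshot V (E(a \<mapsto> 0\<^sub>m r q)) c (exec (zero_fill a re ce) s)"
proof -
  have "mat r q (\<lambda>(i,j). if (0::nat) = 1 then 1 else 0) = (0\<^sub>m r q :: 'a::field mat)" by (rule eq_matI) simp_all
  then show ?thesis using exec_delta_fill[OF s, of "Const 0" "\<lambda>_ _. 0" "Const 1" "\<lambda>_ _. 1"]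
    by (simp add: zero_fill_def)
qed

definition identity_fill :: "nat \<Rightarrow> index_expr \<Rightarrow> prog" where
  "identity_fill a re = delta_fill a re re (Var 23) (Var 24)"

lemma exec_identity_fill:
  assumes s: "snapshot V E c s" "known_val V re = Some r" "a \<noteq> 99"
  shows "snapshot V (E(a \<mapsto> 1\<^sub>m r)) c (exec (identity_fill a re) s)"
proof -
  have "mat r r (\<lambda>(i,j). if i = j then 1 else 0) = (1\<^sub>m r :: 'a::field mat)" by (rule eq_matI) simp_all
  then show ?thesis using exec_delta_fill[OF s(1,2,2,3), of "Var 23" "\<lambda>i j. i" "Var 24" "\<lambda>i j. j"]
    by (simp add: identity_fill_def)
qed

definition unit_row_fill :: "nat \<Rightarrow> index_expr \<Rightarrow> nat \<Rightarrow> prog" where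
  "unit_row_fill a ne x = delta_fill a (Const 1) ne (Var 24) (Var x)"

lemma exec_unit_row_fill:
  assumes s: "snapshot V E c s" "known_val V ne = Some n" "a \<noteq> 99" and x: "V x = Some k"
  shows "snapshot V (E(a \<mapsto> unit_row n k)) c (exec (unit_row_fill a ne x) s)"
proof -
  have "x < 20" using s(1) x by (auto simp: snapshot_def)
  then show ?thesis
    using exec_delta_fill[OF s(1) _ s(2,3), of "Const 1" 1 "Var 24" "\<lambda>i j. j" "Var x" "\<lambda>i j. k"] x
    by (simp add: unit_row_fill_def unit_row_def)
qed

definition unit_col_fill :: "nat \<Rightarrow> index_expr \<Rightarrow> nat \<Rightarrow> prog" where
  "unit_col_fill a ne x = delta_fill a ne (Const 1) (Var 23) (Var x)"

lemma exec_unit_col_fill: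
  assumes s: "snapshot V E c s" "known_val V ne = Some n" "a \<noteq> 99" and x: "V x = Some k"
  shows "snapshot V (E(a \<mapsto> unit_col n k)) c (exec (unit_col_fill a ne x) s)"
proof -
  have "x < 20" using s(1) x by (auto simp: snapshot_def)
  then show ?thesis
    using exec_delta_fill[OF s(1,2) _ s(3), of "Const 1" 1 "Var 23" "\<lambda>i j. i" "Var x" "\<lambda>i j. k"] x
    by (simp add: unit_col_fill_def unit_col_def)
qed

definition product :: "nat \<Rightarrow> nat \<Rightarrow> nat \<Rightarrow> index_expr \<Rightarrow> index_expr \<Rightarrow> index_expr \<Rightarrow> prog" where
  "product a b c re ke ce = Seq (zero_fill a re ce) (accumulate Add a b c re ke ce)"

lemma exec_product:
  fixes B D :: "'a::field mat"
  assumes s: "snapshot V E c s" "known_val V re = Some r" "known_val V ke = Some l" "known_val V ce = Some q"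
    and b: "E b = Some B" "dim_row B = r" "dim_col B = l" "b \<noteq> a"
    and d: "E d = Some D" "dim_row D = l" "dim_col D = q" "d \<noteq> a" and a: "a \<noteq> 99"
  shows "snapshot V (E(a \<mapsto> B * D)) (c + 2 * (r * l * q)) (exec (product a b d re ke ce) s)"
proof -
  have eq: "0\<^sub>m r q + B * D = B * D" by (rule zero_add_dim) (simp_all add: b d)
  have "snapshot V (E(a \<mapsto> 0\<^sub>m r q, a \<mapsto> 0\<^sub>m r q + B * D)) (c + 2 * (r * l * q)) (exec (product a b d re ke ce) s)"
    unfolding product_def exec.simps
    by (rule exec_accumulate_Add[OF exec_zero_fill[OF s(1,2,4) a] s(2,3,4)]) (use b d in simp_all)
  then show ?thesis by (simp add: eq)
qed

definition reciprocal :: "nat \<Rightarrow> nat \<Rightarrow> index_expr \<Rightarrow> index_expr \<Rightarrow> prog" where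
  "reciprocal a b e f =
     Seq (SetOne (Cell a (Const 0) (Const 0)))
       (Arith (Cell a (Const 0) (Const 0)) Divide (Cell a (Const 0) (Const 0)) (Cell b e f))"

lemma exec_reciprocal:
  assumes s: "snapshot V E c s" "known_val V e = Some i" "known_val V f = Some j"
    and b: "E b = Some B" "i < dim_row B" "j < dim_col B" "b \<noteq> a" and a: "a \<noteq> 99"
  shows "snapshot V (E(a \<mapsto> mat 1 1 (\<lambda>_. 1 / B $$ (i,j)))) (Suc c) (exec (reciprocal a b e f) s)"
  using s(1) a snapshot_mem[OF s(1) b(1-3)] b(4) snapshot_known_val[OF s(1,2)] snapshot_known_val[OF s(1,3)]
  by (auto simp: snapshot_def reciprocal_def tick_def Let_def)

lemma exec_SetOne:
  assumes s: "snapshot V E c s" "known_val V e = Some i" "known_val V f = Some j" and a: "E a = Some A"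
  shows "snapshot V (E(a \<mapsto> mat (dim_row A) (dim_col A) (\<lambda>(i',j'). if i' = i \<and> j' = j then 1 else A $$ (i',j')))) c
           (exec (SetOne (Cell a e f)) s)"
  using s(1) snapshot_mem[OF s(1) a] snapshot_known_val[OF s(1,2)] snapshot_known_val[OF s(1,3)] a
  by (auto simp: snapshot_def Let_def)

text \<open>Variable \<open>z\<close> reports whether a nonzero entry was found; \<open>x\<close> and \<open>y\<close> receive its position and keep
  their old values if there is none. The last nonzero entry wins, because loops cannot be left early.\<close>

definition search :: "nat \<Rightarrow> index_expr \<Rightarrow> index_expr \<Rightarrow> nat \<Rightarrow> nat \<Rightarrow> nat \<Rightarrow> prog" where
  "search a re ce x y z =
     Seq (SetIndex 20 re) (Seq (SetIndex 21 ce) (Seq (SetIndex z (Const 0))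
       (For 23 (Var 20) (For 24 (Var 21)
         (IfZero (Cell a (Var 23) (Var 24)) Skip
           (Seq (SetIndex x (Var 23)) (Seq (SetIndex y (Var 24)) (SetIndex z (Const 1)))))))))"

lemma exec_search:
  fixes A :: "'a::field mat"
  assumes s: "snapshot V E c s" "known_val V re = Some r" "known_val V ce = Some q"
    and A: "E a = Some A" "dim_row A = r" "dim_col A = q"
    and xyz: "x < 20" "y < 20" "z < 20" "distinct [x,y,z]"
  obtains (zero) "A = 0\<^sub>m r q" "snapshot (V(z \<mapsto> 0)) E (c + r * q) (exec (search a re ce x y z) s)"
  | (nonzero) i j where "i < r" "j < q" "A $$ (i,j) \<noteq> 0"
      "snapshot (V(x \<mapsto> i, y \<mapsto> j, z \<mapsto> 1)) E (c + r * q) (exec (search a re ce x y z) s)"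
proof -
  define s1 where "s1 = set_index z 0 (set_index 21 q (set_index 20 r s))"
  let ?body = "IfZero (Cell a (Var 23) (Var 24)) Skip
           (Seq (SetIndex x (Var 23)) (Seq (SetIndex y (Var 24)) (SetIndex z (Const 1))))"
  have V20: "V x = Some k \<Longrightarrow> x < 20" for x k using s(1) by (auto simp: snapshot_def)
  have idx1: "index_val ce (idx (set_index 20 r s)) = q"
    using s(1,3) V20 by (intro known_val_sound[of V]) (auto simp: snapshot_def set_index_def)
  have ex: "exec (search a re ce x y z) s = exec (For 23 (Var 20) (For 24 (Var 21) ?body)) s1"
    using snapshot_known_val[OF s(1,2)] idx1 by (simp add: search_def s1_def)
  define I where "I i j t \<longleftrightarrow> mem t = mem s \<and> idx t 20 = r \<and> idx t 21 = q \<and> ops t \<le> ops s + i * q + j \<and>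
      (\<forall>v<20. v \<noteq> x \<longrightarrow> v \<noteq> y \<longrightarrow> v \<noteq> z \<longrightarrow> idx t v = idx s v) \<and>
      ((idx t x = idx s x \<and> idx t y = idx s y \<and> idx t z = 0 \<and>
        (\<forall>i' j'. ((i' < i \<and> j' < q) \<or> (i' = i \<and> j' < j)) \<longrightarrow> mem s a i' j' = 0)) \<or>
       (idx t z = 1 \<and> idx t x < r \<and> idx t y < q \<and> mem s a (idx t x) (idx t y) \<noteq> 0))"
    for i j and t :: "'a state"
  have "I r 0 (exec (For 23 (Var 20) (For 24 (Var 21) ?body)) s1)"
  proof (rule For_rule[where Inv = "\<lambda>i. I i 0"])
    show "I 0 0 s1" using xyz by (simp add: I_def s1_def set_index_def)
    show "index_val (Var 20) (idx s1) = r" using xyz by (simp add: s1_def set_index_def)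
    fix i t assume i: "i < r" and t: "I i 0 t"
    have "I i q (exec (For 24 (Var 21) ?body) (set_index 23 i t)) \<and>
      idx (exec (For 24 (Var 21) ?body) (set_index 23 i t)) 23 = i"
    proof (rule For_rule[where Inv = "\<lambda>j u. I i j u \<and> idx u 23 = i"])
      show "I i 0 (set_index 23 i t) \<and> idx (set_index 23 i t) 23 = i"
        using t xyz by (simp add: I_def set_index_def)
      show "index_val (Var 21) (idx (set_index 23 i t)) = q"
        using t by (simp add: I_def set_index_def)
      fix j u assume j: "j < q" and u: "I i j u \<and> idx u 23 = i"
      then show "I i (Suc j) (exec ?body (set_index 24 j u)) \<and> idx (exec ?body (set_index 24 j u)) 23 = i"
        using xyz i by (auto simp: I_def set_index_def tick_def less_Suc_eq)
    qed
    then show "I (Suc i) 0 (exec (For 24 (Var 21) ?body) (set_index 23 i t))"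
      by (auto simp: I_def less_Suc_eq algebra_simps)
  qed
  then have I: "I r 0 (exec (search a re ce x y z) s)" by (simp only: ex)
  let ?t = "exec (search a re ce x y z) s"
  have mA: "mem s a i j = A $$ (i,j)" if "i < r" "j < q" for i j
    using snapshot_mem[OF s(1) A(1)] A that by simp
  have V: "V v = Some k \<Longrightarrow> idx s v = k" for v k using s(1) by (auto simp: snapshot_def)
  show thesis
  proof (cases "idx ?t z = 0")
    case True
    then have "\<And>i j. i < r \<Longrightarrow> j < q \<Longrightarrow> A $$ (i,j) = 0" using I mA by (auto simp: I_def)
    then have "A = 0\<^sub>m r q" using A by (intro eq_matI) simp_all
    moreover have "idx ?t v = idx s v" if "v < 20" "v \<noteq> z" for v
      using I True that by (cases "v = x"; cases "v = y") (auto simp: I_def)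
    then have "snapshot (V(z \<mapsto> 0)) E (c + r * q) ?t"
      using s(1) I True xyz V20 V unfolding snapshot_def by (auto simp: I_def)
    ultimately show thesis by (rule zero)
  next
    case False
    then have *: "idx ?t z = 1" "idx ?t x < r" "idx ?t y < q" "A $$ (idx ?t x, idx ?t y) \<noteq> 0"
      using I mA by (auto simp: I_def)
    moreover have "snapshot (V(x \<mapsto> idx ?t x, y \<mapsto> idx ?t y, z \<mapsto> 1)) E (c + r * q) ?t"
      using s(1) I xyz V20 V * unfolding snapshot_def by (auto simp: I_def)
    ultimately show thesis using nonzero by blast
  qed
qed

section \<open>Computing a generalized inverse\<close>

primrec block :: "prog list \<Rightarrow> prog" where
  "block [] = Skip"
| "block (p # ps) = Seq p (block ps)"

lemma snapshot_le: "snapshot V E c s \<Longrightarrow> c \<le> c' \<Longrightarrow> snapshot V E c' s"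
  by (auto simp: snapshot_def)

text \<open>The rules for products once more, with a free choice of the bound on the cost and with the result under
  a name of its own, so that they can be chained without terms building up.\<close>

lemma step_product:
  assumes "snapshot V E c s" "E b = Some B" "E d = Some D" "N = B * D"
    "known_val V re = Some (dim_row B)" "known_val V ke = Some (dim_col B)" "known_val V ce = Some (dim_col D)"
    "dim_row D = dim_col B" "b \<noteq> a" "d \<noteq> a" "a \<noteq> 99" "dim_row B * dim_col B * dim_col D \<le> K"
  shows "snapshot V (E(a \<mapsto> N)) (c + 2 * K) (exec (product a b d re ke ce) s)"
  unfolding assms(4)
  by (rule snapshot_le[OF exec_product[OF assms(1,5-7,2) refl refl assms(9,3,8) refl assms(10,11)]])
     (use assms(12) in linarith)

lemma step_add:
  assumes "snapshot V E c s" "E a = Some A" "E b = Some B" "E d = Some D" "N = A + B * D"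
    "known_val V re = Some (dim_row B)" "known_val V ke = Some (dim_col B)" "known_val V ce = Some (dim_col D)"
    "dim_row D = dim_col B" "dim_row A = dim_row B" "dim_col A = dim_col D" "b \<noteq> a" "d \<noteq> a"
    "dim_row B * dim_col B * dim_col D \<le> K"
  shows "snapshot V (E(a \<mapsto> N)) (c + 2 * K) (exec (accumulate Add a b d re ke ce) s)"
  unfolding assms(5)
  by (rule snapshot_le[OF exec_accumulate_Add[OF assms(1,6-8,2,10,11,3) refl refl assms(12,4,9) refl assms(13)]])
     (use assms(14) in linarith)

lemma step_sub:
  assumes "snapshot V E c s" "E a = Some A" "E b = Some B" "E d = Some D" "N = A - B * D"
    "known_val V re = Some (dim_row B)" "known_val V ke = Some (dim_col B)" "known_val V ce = Some (dim_col D)"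
    "dim_row D = dim_col B" "dim_row A = dim_row B" "dim_col A = dim_col D" "b \<noteq> a" "d \<noteq> a"
    "dim_row B * dim_col B * dim_col D \<le> K"
  shows "snapshot V (E(a \<mapsto> N)) (c + 2 * K) (exec (accumulate Sub a b d re ke ce) s)"
  unfolding assms(5)
  by (rule snapshot_le[OF exec_accumulate_Sub[OF assms(1,6-8,2,10,11,3) refl refl assms(12,4,9) refl assms(13)]])
     (use assms(14) in linarith)

lemma map_le_forget:
  assumes "\<And>x. x \<in> K \<Longrightarrow> E' x = None" "\<And>x. x \<notin> K \<Longrightarrow> E x = E' x"
  shows "E' \<subseteq>\<^sub>m E"
  unfolding map_le_def
proof
  fix x assume "x \<in> dom E'"
  then have "x \<notin> K" using assms(1) by auto
  then show "E' x = E x" using assms(2) by simp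
qed

text \<open>One step of \<open>ginv_upto_step\<close> is carried out by \<open>ginv_row\<close>, which leaves the case of a nonzero row of the
  residual to \<open>ginv_update\<close>. Array \<open>a\<close> holds \<open>A\<close>, array \<open>b\<close> the current \<open>B\<close>, and variable 10 the row.
  Array 50 holds the row \<open>q\<close> of \<open>1 - A * B\<close>, array 52 the row \<open>q * A\<close> of the residual, and array 53 the
  column of \<open>1 - B * A\<close> with the index of the pivot. Only products of a vector with a
  matrix or a vector occur, which keeps a row within quadratic cost.\<close>

definition ginv_update :: "nat \<Rightarrow> nat \<Rightarrow> index_expr \<Rightarrow> prog" where
  "ginv_update a b ne = block
     [unit_col_fill 53 ne 12,
      product 54 a 53 ne ne (Const 1),
      accumulate Sub 53 b 54 ne ne (Const 1),
      reciprocal 55 52 (Const 0) (Var 12),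
      product 56 53 55 ne (Const 1) (Const 1),
      accumulate Add b 56 50 ne (Const 1) ne]"

definition ginv_row :: "nat \<Rightarrow> nat \<Rightarrow> index_expr \<Rightarrow> prog" where
  "ginv_row a b ne = block
     [unit_row_fill 50 ne 10,
      product 51 50 a (Const 1) ne ne,
      accumulate Sub 50 51 b (Const 1) ne ne,
      product 52 50 a (Const 1) ne ne,
      search 52 (Const 1) ne 11 12 13,
      IfLess (Const 0) (Var 13) (ginv_update a b ne) Skip]"

definition ginv_prog :: "nat \<Rightarrow> nat \<Rightarrow> index_expr \<Rightarrow> prog" where
  "ginv_prog a b ne = Seq (zero_fill b ne ne) (For 10 ne (ginv_row a b ne))"

lemma exec_ginv_row:
  fixes A B :: "'a::field mat"
  assumes s: "snapshot (V(10 \<mapsto> i)) (E(b \<mapsto> B)) c s"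
    and n: "known_val (V(10 \<mapsto> i)) ne = Some n"
       "\<And>j. known_val (V(10 \<mapsto> i, 11 \<mapsto> 0, 12 \<mapsto> j, 13 \<mapsto> 1)) ne = Some n"
    and i: "i < n"
    and A: "E a = Some A" "dim_row A = n" "dim_col A = n" and ab: "a < 50" "b < 50" "a \<noteq> b"
    and E: "\<And>k. k \<in> {50..56} \<Longrightarrow> E k = None"
    and V: "\<And>k. k \<in> {10..13} \<Longrightarrow> V k = None"
    and inv: "ginv_upto i A B"
  shows "\<exists>B'. snapshot V (E(b \<mapsto> B')) (c + 16 * (n * n)) (exec (ginv_row a b ne) s) \<and> ginv_upto (Suc i) A B'"
proof -
  have B: "dim_row B = n" "dim_col B = n" using inv A by (auto simp: ginv_upto_def)
  have n1: "n \<le> n * n" "1 \<le> n * n" using i by auto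
  define V0 where "V0 = V(10 \<mapsto> i)"
  define E0 where "E0 = E(b \<mapsto> B)"
  have V0: "V0 10 = Some i" by (simp add: V0_def)
  note s0 = s[folded V0_def E0_def]
  have E0: "E0 a = Some A" "E0 b = Some B" using A ab by (simp_all add: E0_def)
  define u where "u = (unit_row n i :: 'a mat)"
  define h where "h = u * A"
  define q where "q = u - h * B"
  define t where "t = q * A"
  have d: "dim_row u = 1" "dim_col u = n" "dim_row h = 1" "dim_col h = n" "dim_row q = 1" "dim_col q = n"
    "dim_row t = 1" "dim_col t = n"
    using A B by (simp_all add: u_def h_def q_def t_def)
  have neq: "50 \<le> k \<Longrightarrow> a \<noteq> k" "50 \<le> k \<Longrightarrow> b \<noteq> k" for k using ab by auto
  note simps = E0 A(2,3) B d n[folded V0_def, unfolded One_nat_def] V0 n1 ab neq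
  let ?E4 = "E0(50 \<mapsto> u, 51 \<mapsto> h, 50 \<mapsto> q, 52 \<mapsto> t)"
  define s1 where "s1 = exec (unit_row_fill 50 ne 10) s"
  define s2 where "s2 = exec (product 51 50 a (Const 1) ne ne) s1"
  define s3 where "s3 = exec (accumulate Sub 50 51 b (Const 1) ne ne) s2"
  define s4 where "s4 = exec (product 52 50 a (Const 1) ne ne) s3"
  define s5 where "s5 = exec (search 52 (Const 1) ne 11 12 13) s4"
  have s1: "snapshot V0 (E0(50 \<mapsto> u)) c s1"
    unfolding s1_def u_def by (rule exec_unit_row_fill[OF s0]) (simp_all add: simps)
  have s2: "snapshot V0 (E0(50 \<mapsto> u, 51 \<mapsto> h)) (c + 2 * (n * n)) s2"
    unfolding s2_def by (rule step_product[where B = u and D = A, OF s1]) (simp_all add: simps h_def)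
  have s3: "snapshot V0 (E0(50 \<mapsto> u, 51 \<mapsto> h, 50 \<mapsto> q)) (c + 2 * (n * n) + 2 * (n * n)) s3"
    unfolding s3_def by (rule step_sub[where A = u and B = h and D = B, OF s2]) (simp_all add: simps q_def)
  have s4: "snapshot V0 ?E4 (c + 2 * (n * n) + 2 * (n * n) + 2 * (n * n)) s4"
    unfolding s4_def by (rule step_product[where B = q and D = A, OF s3]) (simp_all add: simps t_def)
  have ex: "exec (ginv_row a b ne) s = exec (IfLess (Const 0) (Var 13) (ginv_update a b ne) Skip) s5"
    by (simp add: ginv_row_def s5_def s4_def s3_def s2_def s1_def)
  have iv1: "known_val V0 (Const 1) = Some 1" by simp
  show ?thesis
  proof (rule exec_search[OF s4 iv1 n(1)[folded V0_def], where a = 52 and A = t and x = 11 and y = 12 and z = 13])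
    assume t0: "t = 0\<^sub>m 1 n"
      and s5: "snapshot (V0(13 \<mapsto> 0)) ?E4 (c + 2 * (n * n) + 2 * (n * n) + 2 * (n * n) + 1 * n) (exec (search 52 (Const 1) ne 11 12 13) s4)"
    have "exec (IfLess (Const 0) (Var 13) (ginv_update a b ne) Skip) s5 = s5"
      using exec_IfLess[OF s5, of "Const 0" 0 "Var 13" 0] by (simp add: s5_def)
    moreover have "V \<subseteq>\<^sub>m V0(13 \<mapsto> 0)"
      by (rule map_le_forget[of "{10..13}"]) (auto simp: V V0_def)
    moreover have "E(b \<mapsto> B) \<subseteq>\<^sub>m ?E4"
      by (rule map_le_forget[of "{50..56}"]) (use ab in \<open>auto simp: E E0_def\<close>)
    ultimately have "snapshot V (E(b \<mapsto> B)) (c + 16 * (n * n)) (exec (ginv_row a b ne) s)"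
      unfolding ex using snapshot_weaken[OF s5[folded s5_def]] n1 by simp
    moreover have "ginv_upto (Suc i) A B"
      using ginv_upto_skip[OF inv] t0 A by (simp add: t_def q_def h_def u_def)
    ultimately show ?thesis by blast
  next
    fix i' j assume "i' < 1" and j: "j < n" and nz: "t $$ (i',j) \<noteq> 0"
      and "snapshot (V0(11 \<mapsto> i', 12 \<mapsto> j, 13 \<mapsto> 1)) ?E4 (c + 2 * (n * n) + 2 * (n * n) + 2 * (n * n) + 1 * n) (exec (search 52 (Const 1) ne 11 12 13) s4)"
    then have i': "i' = 0" and s5: "snapshot (V0(11 \<mapsto> 0, 12 \<mapsto> j, 13 \<mapsto> 1)) ?E4 (c + 2 * (n * n) + 2 * (n * n) + 2 * (n * n) + 1 * n) s5"
      by (simp_all add: s5_def)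
    let ?V = "V0(11 \<mapsto> 0, 12 \<mapsto> j, 13 \<mapsto> 1)"
    let ?c = "c + 2 * (n * n) + 2 * (n * n) + 2 * (n * n) + 1 * n"
    define e where "e = (unit_col n j :: 'a mat)"
    define Ae where "Ae = A * e"
    define p where "p = e - B * Ae"
    define z where "z = mat 1 1 (\<lambda>_. 1 / t $$ (0, j))"
    define pz where "pz = p * z"
    define B' where "B' = B + pz * q"
    have d2: "dim_row e = n" "dim_col e = 1" "dim_row Ae = n" "dim_col Ae = 1" "dim_row p = n" "dim_col p = 1"
      "dim_row z = 1" "dim_col z = 1" "dim_row pz = n" "dim_col pz = 1"
      by (simp_all add: simps e_def Ae_def p_def z_def pz_def)
    define s6 where "s6 = exec (unit_col_fill 53 ne 12) s5"
    define s7 where "s7 = exec (product 54 a 53 ne ne (Const 1)) s6"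
    define s8 where "s8 = exec (accumulate Sub 53 b 54 ne ne (Const 1)) s7"
    define s9 where "s9 = exec (reciprocal 55 52 (Const 0) (Var 12)) s8"
    define s10 where "s10 = exec (product 56 53 55 ne (Const 1) (Const 1)) s9"
    define s11 where "s11 = exec (accumulate Add b 56 50 ne (Const 1) ne) s10"
    note simps2 = simps d2
    have s6: "snapshot ?V (?E4(53 \<mapsto> e)) ?c s6"
      unfolding s6_def e_def by (rule exec_unit_col_fill[OF s5]) (simp_all add: simps)
    have s7: "snapshot ?V (?E4(53 \<mapsto> e, 54 \<mapsto> Ae)) (?c + 2 * (n * n)) s7"
      unfolding s7_def by (rule step_product[where B = A and D = e, OF s6]) (simp_all add: simps2 Ae_def)
    have s8: "snapshot ?V (?E4(53 \<mapsto> e, 54 \<mapsto> Ae, 53 \<mapsto> p)) (?c + 2 * (n * n) + 2 * (n * n)) s8"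
      unfolding s8_def by (rule step_sub[where A = e and B = B and D = Ae, OF s7]) (simp_all add: simps2 p_def)
    have s9: "snapshot ?V (?E4(53 \<mapsto> e, 54 \<mapsto> Ae, 53 \<mapsto> p, 55 \<mapsto> z)) (Suc (?c + 2 * (n * n) + 2 * (n * n))) s9"
      unfolding s9_def z_def by (rule exec_reciprocal[OF s8]) (simp_all add: simps2 j)
    have s10: "snapshot ?V (?E4(53 \<mapsto> e, 54 \<mapsto> Ae, 53 \<mapsto> p, 55 \<mapsto> z, 56 \<mapsto> pz)) (Suc (?c + 2 * (n * n) + 2 * (n * n)) + 2 * n) s10"
      unfolding s10_def by (rule step_product[where B = p and D = z, OF s9]) (simp_all add: simps2 pz_def)
    have s11: "snapshot ?V (?E4(53 \<mapsto> e, 54 \<mapsto> Ae, 53 \<mapsto> p, 55 \<mapsto> z, 56 \<mapsto> pz, b \<mapsto> B')) (Suc (?c + 2 * (n * n) + 2 * (n * n)) + 2 * n + 2 * (n * n)) s11"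
      unfolding s11_def by (rule step_add[where A = B and B = pz and D = q, OF s10]) (simp_all add: simps2 B'_def)
    have "exec (ginv_row a b ne) s = s11"
      unfolding ex using exec_IfLess[OF s5, of "Const 0" 0 "Var 13" 1]
      by (simp add: ginv_update_def s11_def s10_def s9_def s8_def s7_def s6_def)
    moreover have "snapshot V (E(b \<mapsto> B')) (c + 16 * (n * n)) s11"
    proof (rule snapshot_weaken[OF s11])
      show "V \<subseteq>\<^sub>m ?V" by (rule map_le_forget[of "{10..13}"]) (auto simp: V V0_def)
      show "E(b \<mapsto> B') \<subseteq>\<^sub>m ?E4(53 \<mapsto> e, 54 \<mapsto> Ae, 53 \<mapsto> p, 55 \<mapsto> z, 56 \<mapsto> pz, b \<mapsto> B')"
        by (rule map_le_forget[of "{50..56}"]) (use ab in \<open>auto simp: E E0_def\<close>)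
    qed (use n1 in linarith)
    moreover have "ginv_upto (Suc i) A B'"
    proof -
      have "q * A * e * z = 1\<^sub>m 1"
        using scalar_recip[of "t * e"] mult_unit_col[of 0 t j n] nz i' j unfolding t_def[symmetric] z_def
        by (simp add: simps2 e_def)
      then show ?thesis
        unfolding B'_def pz_def p_def Ae_def
        by (intro ginv_upto_step[OF inv]) (use i in \<open>simp_all add: simps2 q_def h_def u_def\<close>)
    qed
    ultimately show ?thesis by metis
  qed (simp_all add: simps)
qed

lemma exec_ginv_prog:
  fixes A :: "'a::field mat"
  assumes s: "snapshot V E c s"
    and n: "\<And>W. V \<subseteq>\<^sub>m W \<Longrightarrow> known_val W ne = Some n"
    and A: "E a = Some A" "dim_row A = n" "dim_col A = n" and ab: "a < 50" "b < 50" "a \<noteq> b"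
    and E: "\<And>k. k \<in> {50..56} \<Longrightarrow> E k = None"
    and V: "\<And>k. k \<in> {10..13} \<Longrightarrow> V k = None"
  obtains G where "is_ginv A G" "snapshot V (E(b \<mapsto> G)) (c + 16 * (n * n * n)) (exec (ginv_prog a b ne) s)"
proof -
  have Vle: "V \<subseteq>\<^sub>m W" if "\<And>k. k \<notin> {10..13} \<Longrightarrow> W k = V k" for W
    by (rule map_le_forget[of "{10..13}"]) (use V that in auto)
  have n0: "known_val V ne = Some n" by (rule n) simp
  have "\<exists>B. snapshot V (E(b \<mapsto> B)) (c + n * (16 * (n * n))) (exec (For 10 ne (ginv_row a b ne)) (exec (zero_fill b ne ne) s)) \<and> ginv_upto n A B"
  proof (rule For_rule[where Inv = "\<lambda>i t. \<exists>B. snapshot V (E(b \<mapsto> B)) (c + i * (16 * (n * n))) t \<and> ginv_upto i A B"])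
    have s0: "snapshot V (E(b \<mapsto> 0\<^sub>m n n)) c (exec (zero_fill b ne ne) s)"
      by (rule exec_zero_fill[OF s n0 n0]) (use ab in simp)
    then show "\<exists>B. snapshot V (E(b \<mapsto> B)) (c + 0 * (16 * (n * n))) (exec (zero_fill b ne ne) s) \<and> ginv_upto 0 A B"
      using ginv_upto_0[of A] A by auto
    show "index_val ne (idx (exec (zero_fill b ne ne) s)) = n" by (rule snapshot_known_val[OF s0 n0])
    fix i t assume i: "i < n" and "\<exists>B. snapshot V (E(b \<mapsto> B)) (c + i * (16 * (n * n))) t \<and> ginv_upto i A B"
    then obtain B where t: "snapshot V (E(b \<mapsto> B)) (c + i * (16 * (n * n))) t" and B: "ginv_upto i A B" by blast
    have "\<exists>B'. snapshot V (E(b \<mapsto> B')) (c + i * (16 * (n * n)) + 16 * (n * n)) (exec (ginv_row a b ne) (set_index 10 i t)) \<and> ginv_upto (Suc i) A B'"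
    proof (rule exec_ginv_row[OF snapshot_set_index[OF t]])
      show "known_val (V(10 \<mapsto> i)) ne = Some n" by (intro n Vle) auto
      show "known_val (V(10 \<mapsto> i, 11 \<mapsto> 0, 12 \<mapsto> j, 13 \<mapsto> 1)) ne = Some n" for j
        by (intro n Vle) auto
    qed (use i A ab E V B in auto)
    then show "\<exists>B. snapshot V (E(b \<mapsto> B)) (c + Suc i * (16 * (n * n))) (exec (ginv_row a b ne) (set_index 10 i t)) \<and> ginv_upto (Suc i) A B"
      by (simp add: algebra_simps)
  qed
  then obtain B where "snapshot V (E(b \<mapsto> B)) (c + n * (16 * (n * n))) (exec (ginv_prog a b ne) s)" "ginv_upto n A B"
    by (auto simp: ginv_prog_def)
  with ginv_upto_is_ginv[of A B] A show thesis by (intro that[of B]) (simp_all add: algebra_simps)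
qed

section \<open>One round of the loop\<close>

abbreviation "dim_m \<equiv> Var 0"
abbreviation "dim_n \<equiv> Var 1"
abbreviation "ix1 \<equiv> Const 1"
abbreviation "ix0 \<equiv> Const 0"

text \<open>The choice of \<open>y\<close> and \<open>v\<close>. A vector is sought on which two linear forms are both nonzero, given a unit vector
  for each form on which that form is nonzero. One of the two unit vectors or their sum will do: if neither
  unit vector serves both forms, then each form vanishes on the unit vector of the other.
  This works over every field, even the one with two elements.\<close>

definition choose_row :: prog where
  "choose_row = block
     [unit_row_fill 22 dim_n 8,
      IfZero (Cell 21 (Var 8) ix0)
        (block [unit_row_fill 22 dim_n 6,
           IfZero (Cell 19 (Var 6) (Var 9)) (SetOne (Cell 22 ix0 (Var 8))) Skip])
        Skip]"

definition choose_col :: prog where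
  "choose_col = block
     [unit_col_fill 24 dim_m 9,
      IfZero (Cell 20 ix0 (Var 9))
        (block [unit_col_fill 24 dim_m 4,
           IfZero (Cell 23 ix0 (Var 4)) (SetOne (Cell 24 (Var 9) ix0)) Skip])
        Skip]"

text \<open>The forms are multiplication by \<open>x\<close> and by column \<open>b\<close> of \<open>M\<close>. If \<open>M\<close> is zero, then \<open>a = a'\<close> makes the
  unit vector for the first form the outcome.\<close>

lemma exec_choose_row:
  fixes M x :: "'a::field mat"
  assumes s: "snapshot V E c s" and V: "V (Suc 0) = Some n" "V 6 = Some a'" "V 8 = Some a" "V 9 = Some b"
    and E: "E 21 = Some x" "E 19 = Some M"
    and d: "dim_row x = n" "dim_col x = 1" "dim_row M = n" "dim_col M = m" "a < n" "a' < n" "b < m"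
    and x: "x $$ (a', 0) \<noteq> 0" and M: "(M = 0\<^sub>m n m \<and> a = a') \<or> M $$ (a, b) \<noteq> 0"
  obtains y where "dim_row y = 1" "dim_col y = n" "snapshot V (E(22 \<mapsto> y)) (c + 2) (exec choose_row s)"
    "(y * x) $$ (0, 0) \<noteq> 0" "M = 0\<^sub>m n m \<or> (y * M) $$ (0, b) \<noteq> 0"
proof -
  let ?s1 = "exec (unit_row_fill 22 dim_n 8) s"
  have s1: "snapshot V (E(22 \<mapsto> unit_row n a)) c ?s1"
    by (rule exec_unit_row_fill[OF s]) (simp_all add: V)
  have if1: "exec choose_row s = (if x $$ (a,0) = 0 then exec (block [unit_row_fill 22 dim_n 6,
           IfZero (Cell 19 (Var 6) (Var 9)) (SetOne (Cell 22 ix0 (Var 8))) Skip]) (tick ?s1) else tick ?s1)"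
    using exec_IfZero[OF s1, of "Var 8" a ix0 0 21 x] V E d by (simp add: choose_row_def)
  show thesis
  proof (cases "x $$ (a,0) = 0")
    case False
    have "snapshot V (E(22 \<mapsto> unit_row n a)) (c + 2) (exec choose_row s)"
      using snapshot_le[OF snapshot_tick[OF s1], of "c + 2"] False by (simp add: if1)
    moreover have "(unit_row n a * x) $$ (0,0) \<noteq> 0" using unit_row_mult[of a x 0 n] d False by simp
    moreover have "M = 0\<^sub>m n m \<or> (unit_row n a * M) $$ (0,b) \<noteq> 0" using unit_row_mult[of a M b n] d M by auto
    ultimately show thesis by (intro that[of "unit_row n a"]) simp_all
  next
    case True
    then have M: "M $$ (a, b) \<noteq> 0" and aa: "a \<noteq> a'" using M x by auto
    let ?s2 = "exec (unit_row_fill 22 dim_n 6) (tick ?s1)"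
    have "snapshot V (E(22 \<mapsto> unit_row n a, 22 \<mapsto> unit_row n a')) (Suc c) ?s2"
      by (rule exec_unit_row_fill[OF snapshot_tick[OF s1]]) (simp_all add: V)
    then have s2: "snapshot V (E(22 \<mapsto> unit_row n a')) (Suc c) ?s2" by simp
    have if2: "exec choose_row s = (if M $$ (a',b) = 0 then exec (SetOne (Cell 22 ix0 (Var 8))) (tick ?s2) else tick ?s2)"
      using exec_IfZero[OF s2, of "Var 6" a' "Var 9" b 19 M] V E d True by (simp add: if1)
    show thesis
    proof (cases "M $$ (a',b) = 0")
      case False
      have "snapshot V (E(22 \<mapsto> unit_row n a')) (c + 2) (exec choose_row s)"
        using snapshot_tick[OF s2] False by (simp add: if2)
      moreover have "(unit_row n a' * x) $$ (0,0) \<noteq> 0" using unit_row_mult[of a' x 0 n] d x by simp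
      moreover have "(unit_row n a' * M) $$ (0,b) \<noteq> 0" using unit_row_mult[of a' M b n] d False by auto
      ultimately show thesis by (intro that[of "unit_row n a'"]) simp_all
    next
      case M0: True
      let ?y = "unit_row n a' + unit_row n a :: 'a mat"
      have "mat 1 n (\<lambda>(i',j'). if i' = 0 \<and> j' = a then 1 else unit_row n a' $$ (i',j')) = ?y"
        using aa by (intro eq_matI) (auto simp: unit_row_def)
      then have "snapshot V (E(22 \<mapsto> ?y)) (c + 2) (exec choose_row s)"
        using exec_SetOne[OF snapshot_tick[OF s2], of ix0 0 "Var 8" a 22 "unit_row n a'"] M0 V by (simp add: if2)
      moreover have "(?y * x) $$ (0,0) \<noteq> 0"
        using unit_row_mult[of a' x 0 n] unit_row_mult[of a x 0 n] d x True by (simp add: add_mult_dim del: index_mult_mat(1))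
      moreover have "(?y * M) $$ (0,b) \<noteq> 0"
        using unit_row_mult[of a' M b n] unit_row_mult[of a M b n] d M M0 by (simp add: add_mult_dim del: index_mult_mat(1))
      ultimately show thesis by (intro that[of ?y]) simp_all
    qed
  qed
qed

lemma exec_choose_col:
  fixes w h :: "'a::field mat"
  assumes s: "snapshot V E c s" and V: "V 0 = Some m" "V 4 = Some b'" "V 9 = Some b"
    and E: "E 20 = Some w" "E 23 = Some h"
    and d: "dim_row w = 1" "dim_col w = m" "dim_row h = 1" "dim_col h = m" "b < m" "b' < m"
    and w: "w $$ (0, b') \<noteq> 0" and h: "(Z \<and> b = b') \<or> h $$ (0, b) \<noteq> 0"
  obtains v where "dim_row v = m" "dim_col v = 1" "snapshot V (E(24 \<mapsto> v)) (c + 2) (exec choose_col s)"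
    "(w * v) $$ (0, 0) \<noteq> 0" "Z \<or> (h * v) $$ (0, 0) \<noteq> 0"
proof -
  let ?s1 = "exec (unit_col_fill 24 dim_m 9) s"
  have s1: "snapshot V (E(24 \<mapsto> unit_col m b)) c ?s1"
    by (rule exec_unit_col_fill[OF s]) (simp_all add: V)
  have if1: "exec choose_col s = (if w $$ (0,b) = 0 then exec (block [unit_col_fill 24 dim_m 4,
           IfZero (Cell 23 ix0 (Var 4)) (SetOne (Cell 24 (Var 9) ix0)) Skip]) (tick ?s1) else tick ?s1)"
    using exec_IfZero[OF s1, of ix0 0 "Var 9" b 20 w] V E d by (simp add: choose_col_def)
  show thesis
  proof (cases "w $$ (0,b) = 0")
    case False
    have "snapshot V (E(24 \<mapsto> unit_col m b)) (c + 2) (exec choose_col s)"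
      using snapshot_le[OF snapshot_tick[OF s1], of "c + 2"] False by (simp add: if1)
    moreover have "(w * unit_col m b) $$ (0,0) \<noteq> 0" using mult_unit_col[of 0 w b m] d False by simp
    moreover have "Z \<or> (h * unit_col m b) $$ (0,0) \<noteq> 0" using mult_unit_col[of 0 h b m] d h by auto
    ultimately show thesis by (intro that[of "unit_col m b"]) simp_all
  next
    case True
    then have h: "h $$ (0, b) \<noteq> 0" and bb: "b \<noteq> b'" using h w by auto
    let ?s2 = "exec (unit_col_fill 24 dim_m 4) (tick ?s1)"
    have "snapshot V (E(24 \<mapsto> unit_col m b, 24 \<mapsto> unit_col m b')) (Suc c) ?s2"
      by (rule exec_unit_col_fill[OF snapshot_tick[OF s1]]) (simp_all add: V)
    then have s2: "snapshot V (E(24 \<mapsto> unit_col m b')) (Suc c) ?s2" by simp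
    have if2: "exec choose_col s = (if h $$ (0,b') = 0 then exec (SetOne (Cell 24 (Var 9) ix0)) (tick ?s2) else tick ?s2)"
      using exec_IfZero[OF s2, of ix0 0 "Var 4" b' 23 h] V E d True by (simp add: if1)
    show thesis
    proof (cases "h $$ (0,b') = 0")
      case False
      have "snapshot V (E(24 \<mapsto> unit_col m b')) (c + 2) (exec choose_col s)"
        using snapshot_tick[OF s2] False by (simp add: if2)
      moreover have "(w * unit_col m b') $$ (0,0) \<noteq> 0" using mult_unit_col[of 0 w b' m] d w by simp
      moreover have "(h * unit_col m b') $$ (0,0) \<noteq> 0" using mult_unit_col[of 0 h b' m] d False by auto
      ultimately show thesis by (intro that[of "unit_col m b'"]) simp_all
    next
      case h0: True
      let ?v = "unit_col m b' + unit_col m b :: 'a mat"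
      have "mat m 1 (\<lambda>(i',j'). if i' = b \<and> j' = 0 then 1 else unit_col m b' $$ (i',j')) = ?v"
        using bb by (intro eq_matI) (auto simp: unit_col_def)
      then have "snapshot V (E(24 \<mapsto> ?v)) (c + 2) (exec choose_col s)"
        using exec_SetOne[OF snapshot_tick[OF s2], of "Var 9" b ix0 0 24 "unit_col m b'"] h0 V by (simp add: if2)
      moreover have "(w * ?v) $$ (0,0) \<noteq> 0"
        using mult_unit_col[of 0 w b' m] mult_unit_col[of 0 w b m] d w True by (simp add: mult_add_dim del: index_mult_mat(1))
      moreover have "(h * ?v) $$ (0,0) \<noteq> 0"
        using mult_unit_col[of 0 h b' m] mult_unit_col[of 0 h b m] d h h0 by (simp add: mult_add_dim del: index_mult_mat(1))
      ultimately show thesis by (intro that[of ?v]) simp_all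
    qed
  qed
qed

text \<open>During the loop, arrays 10, 4, 11 and 12 hold the blocks \<open>P1\<close> to \<open>P4\<close>, and arrays 13 and 14 the lower
  blocks \<open>Q3\<close> and \<open>Q4\<close> of the inverse. Arrays 1, 19, 18 and 16 hold \<open>L\<close>, \<open>M\<close>, \<open>W\<close> and \<open>X\<close>.
  The position of a nonzero entry is kept in variables 3 and 4 for row \<open>i\<close> of \<open>W\<close>, in 6 and 7 for \<open>X\<close>, and in
  8 and 9 for \<open>M\<close>. The latter pair is preset to the row for \<open>X\<close> and the column for \<open>W\<close>, which are what \<open>y\<close> and
  \<open>v\<close> have to hit when \<open>M\<close> is zero. The vectors \<open>S3 L * v\<close> and \<open>y * F L\<close> are obtained from \<open>L\<close> by products with
  vectors only; no product of two full matrices is formed inside the loop.\<close>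

definition loop_update :: prog where
  "loop_update = block
     [search 16 dim_n dim_n 6 7 5,
      SetIndex 8 (Var 6), SetIndex 9 (Var 4),
      search 19 dim_n dim_m 8 9 5,
      unit_col_fill 46 dim_n 7, product 21 16 46 dim_n dim_n ix1,
      choose_row,
      product 23 22 19 ix1 dim_n dim_m,
      choose_col,
      product 25 23 24 ix1 dim_m ix1,
      IfZero (Cell 25 ix0 ix0) (identity_fill 26 ix1) (reciprocal 26 25 ix0 ix0),
      product 27 20 24 ix1 dim_m ix1, reciprocal 28 27 ix0 ix0,
      product 29 22 21 ix1 dim_n ix1, reciprocal 30 29 ix0 ix0,
      product 31 11 24 dim_n dim_m ix1, product 32 10 24 dim_m dim_m ix1, accumulate Sub 31 1 32 dim_n dim_m ix1,
      product 33 22 13 ix1 dim_n dim_m, product 34 22 14 ix1 dim_n dim_n, accumulate Add 33 34 1 ix1 dim_n dim_m,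
      product 35 31 26 dim_n ix1 ix1, accumulate Sub 1 35 33 dim_n ix1 dim_m,
      product 36 19 24 dim_n dim_m ix1, product 37 36 26 dim_n ix1 ix1, accumulate Sub 19 37 23 dim_n ix1 dim_m,
      product 38 18 24 dim_n dim_m ix1, product 39 38 28 dim_n ix1 ix1, accumulate Sub 18 39 20 dim_n ix1 dim_m,
      product 40 22 16 ix1 dim_n dim_n, product 41 21 30 dim_n ix1 ix1, accumulate Sub 16 41 40 dim_n ix1 dim_n]"

definition loop_row :: prog where
  "loop_row = block
     [unit_row_fill 45 dim_n 2, product 20 45 18 ix1 dim_n dim_m,
      search 20 ix1 dim_m 3 4 5,
      IfLess ix0 (Var 5) loop_update Skip]"

context inverse_blocks
begin

definition env :: "nat \<rightharpoonup> 'a mat" where "env = [10 \<mapsto> P1, 4 \<mapsto> P2, 11 \<mapsto> P3, 12 \<mapsto> P4, 13 \<mapsto> Q3, 14 \<mapsto> Q4]"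

definition loop_env :: "'a mat \<Rightarrow> 'a mat \<Rightarrow> 'a mat \<Rightarrow> 'a mat \<Rightarrow> nat \<rightharpoonup> 'a mat" where "loop_env L M W X = env(1 \<mapsto> L, 19 \<mapsto> M, 18 \<mapsto> W, 16 \<mapsto> X)"

text \<open>The bound \<open>K\<close> stands for \<open>(m + n)\<^sup>2\<close>. As an opaque number with the listed properties it keeps the cost
  arithmetic linear.\<close>

lemma exec_loop_update:
  assumes K: "n * n \<le> K" "n * m \<le> K" "m * n \<le> K" "m * m \<le> K" "n \<le> K" "m \<le> K" "Suc 0 \<le> K"
    and s: "snapshot [0 \<mapsto> m, 1 \<mapsto> n, 2 \<mapsto> i, 3 \<mapsto> 0, 4 \<mapsto> b', 5 \<mapsto> 1]
       ((loop_env L M W X)(45 \<mapsto> u, 20 \<mapsto> w)) c s"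
    and inv: "loop_inv i L M W X" and i: "i < n" and w: "w = unit_row n i * W" and b': "b' < m" "w $$ (0,b') \<noteq> 0"
  shows "\<exists>L' M' W' X'. snapshot [0 \<mapsto> m, 1 \<mapsto> n] (loop_env L' M' W' X') (c + 60 * K) (exec loop_update s) \<and>
    loop_inv (Suc i) L' M' W' X'"
proof -
  have dL: "dim_row L = n" "dim_col L = m" "dim_row X = n" "dim_col X = n" "dim_row W = n" "dim_col W = m"
    and M: "M = Q4 * S3 L"
    using inv by (auto simp: loop_inv_def)
  have dM: "dim_row M = n" "dim_col M = m" by (simp_all add: M dims dL)
  have dw: "dim_row w = 1" "dim_col w = m" by (simp_all add: w dL)
  note d0 = dL dM dw dims
  define E0 where "E0 = (loop_env L M W X)(45 \<mapsto> u, 20 \<mapsto> w)"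
  have E0: "E0 1 = Some L" "E0 19 = Some M" "E0 18 = Some W" "E0 16 = Some X" "E0 20 = Some w"
    "E0 10 = Some P1" "E0 4 = Some P2" "E0 11 = Some P3" "E0 13 = Some Q3" "E0 14 = Some Q4"
    by (simp_all add: E0_def loop_env_def env_def)
  have "unit_row n i * W \<noteq> 0\<^sub>m 1 m" using b' w by auto
  then have X0: "X \<noteq> 0\<^sub>m n n" by (rule loop_inv_X_nonzero[OF inv])
  let ?s1 = "exec (search 16 dim_n dim_n 6 7 5) s"
  obtain a' jx where a': "a' < n" "jx < n" "X $$ (a', jx) \<noteq> 0" and
    s1: "snapshot [0 \<mapsto> m, 1 \<mapsto> n, 2 \<mapsto> i, 3 \<mapsto> 0, 4 \<mapsto> b', 5 \<mapsto> 1, 6 \<mapsto> a', 7 \<mapsto> jx, 5 \<mapsto> 1] E0 (c + K) ?s1"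
  proof (rule exec_search[OF s[folded E0_def], of dim_n n dim_n n 16 X 6 7 5])
    fix a' jx assume "a' < n" "jx < n" "X $$ (a', jx) \<noteq> 0"
      "snapshot ([0 \<mapsto> m, 1 \<mapsto> n, 2 \<mapsto> i, 3 \<mapsto> 0, 4 \<mapsto> b', 5 \<mapsto> 1](6 \<mapsto> a', 7 \<mapsto> jx, 5 \<mapsto> 1)) E0 (c + n * n) ?s1"
    from that[OF this(1-3) snapshot_le[OF this(4)]] show thesis using K(1) by simp
  qed (simp_all add: X0 E0 d0)
  define V3 :: "nat \<rightharpoonup> nat" where "V3 = [0 \<mapsto> m, 1 \<mapsto> n, 2 \<mapsto> i, 3 \<mapsto> 0, 4 \<mapsto> b', 5 \<mapsto> 1, 6 \<mapsto> a', 7 \<mapsto> jx, 5 \<mapsto> 1, 8 \<mapsto> a', 9 \<mapsto> b']"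
  let ?s3 = "exec (SetIndex 9 (Var 4)) (exec (SetIndex 8 (Var 6)) ?s1)"
  have s3: "snapshot V3 E0 (c + K) ?s3"
    unfolding V3_def by (rule exec_SetIndex exec_SetIndex[OF s1] | simp)+
  let ?s4 = "exec (search 19 dim_n dim_m 8 9 5) ?s3"
  have "\<exists>V a b. snapshot V E0 (c + 2 * K) ?s4 \<and> V 0 = Some m \<and> V 1 = Some n \<and> V 4 = Some b' \<and> V 6 = Some a' \<and>
     V 7 = Some jx \<and> V 8 = Some a \<and> V 9 = Some b \<and> a < n \<and> b < m \<and>
     ((M = 0\<^sub>m n m \<and> a = a' \<and> b = b') \<or> M $$ (a, b) \<noteq> 0)"
  proof (rule exec_search[OF s3, of dim_n n dim_m m 19 M 8 9 5])
    assume "M = 0\<^sub>m n m" "snapshot (V3(5 \<mapsto> 0)) E0 (c + K + n * m) ?s4"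
    then show ?thesis using a' b' K
      by (intro exI[of _ "V3(5 \<mapsto> 0)"] exI[of _ a'] exI[of _ b']) (auto simp: V3_def intro: snapshot_le)
  next
    fix a b assume "a < n" "b < m" "M $$ (a, b) \<noteq> 0"
      "snapshot (V3(8 \<mapsto> a, 9 \<mapsto> b, 5 \<mapsto> 1)) E0 (c + K + n * m) ?s4"
    then show ?thesis using a' b' K
      by (intro exI[of _ "V3(8 \<mapsto> a, 9 \<mapsto> b, 5 \<mapsto> 1)"] exI[of _ a] exI[of _ b]) (auto simp: V3_def intro: snapshot_le)
  qed (simp_all add: V3_def E0 d0)
  then obtain V a b where s4: "snapshot V E0 (c + 2 * K) ?s4" and
    V: "V 0 = Some m" "V (Suc 0) = Some n" "V 4 = Some b'" "V 6 = Some a'" "V 7 = Some jx" "V 8 = Some a" "V 9 = Some b" and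
    ab: "a < n" "b < m" "(M = 0\<^sub>m n m \<and> a = a' \<and> b = b') \<or> M $$ (a, b) \<noteq> 0" by auto
  define e where "e = (unit_col n jx :: 'a mat)"
  define x where "x = X * e"
  have d1: "dim_row e = n" "dim_col e = 1" "dim_row x = n" "dim_col x = 1" by (simp_all add: e_def x_def d0)
  note simps = E0 E0(1)[unfolded One_nat_def] d0 d1 V K
  let ?s5 = "exec (unit_col_fill 46 dim_n 7) ?s4"
  have s5: "snapshot V (E0(46 \<mapsto> e)) (c + 2 * K) ?s5"
    unfolding e_def by (rule exec_unit_col_fill[OF s4]) (simp_all add: simps)
  let ?s6 = "exec (product 21 16 46 dim_n dim_n ix1) ?s5"
  let ?E6 = "E0(46 \<mapsto> e, 21 \<mapsto> x)"
  have s6: "snapshot V ?E6 (c + 2 * K + 2 * K) ?s6"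
    by (rule step_product[where B = X and D = e, OF s5]) (simp_all add: simps x_def)
  have xa: "x $$ (a', 0) \<noteq> 0" using mult_unit_col[of a' X jx n] a' by (simp add: x_def e_def d0)
  let ?s7 = "exec choose_row ?s6"
  obtain y where dy: "dim_row y = 1" "dim_col y = n" and s7: "snapshot V (?E6(22 \<mapsto> y)) (c + 2 * K + 2 * K + 2) ?s7"
    and yx: "(y * x) $$ (0, 0) \<noteq> 0" and yM: "M = 0\<^sub>m n m \<or> (y * M) $$ (0, b) \<noteq> 0"
    by (rule exec_choose_row[OF s6, of n a' a b x M m]) (use ab xa a' in \<open>auto simp: simps\<close>)
  define h where "h = y * M"
  have dh: "dim_row h = 1" "dim_col h = m" by (simp_all add: h_def dy d0)
  let ?s8 = "exec (product 23 22 19 ix1 dim_n dim_m) ?s7"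
  let ?E8 = "?E6(22 \<mapsto> y, 23 \<mapsto> h)"
  have s8: "snapshot V ?E8 (c + 2 * K + 2 * K + 2 + 2 * K) ?s8"
    by (rule step_product[where B = y and D = M, OF s7]) (simp_all add: simps dy h_def)
  let ?s9 = "exec choose_col ?s8"
  obtain v where dv: "dim_row v = m" "dim_col v = 1"
    and s9: "snapshot V (?E8(24 \<mapsto> v)) (c + 2 * K + 2 * K + 2 + 2 * K + 2) ?s9"
    and wv: "(w * v) $$ (0, 0) \<noteq> 0" and hv: "M = 0\<^sub>m n m \<or> (h * v) $$ (0, 0) \<noteq> 0"
  proof (rule exec_choose_col[OF s8, of m b' b w h "M = 0\<^sub>m n m"])
    show "(M = 0\<^sub>m n m \<and> b = b') \<or> h $$ (0, b) \<noteq> 0" using ab yM by (auto simp: h_def)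
  qed (assumption | use ab b' in \<open>simp add: simps dh\<close>)+
  note simps = simps dy dv dh
  let ?c9 = "c + 2 * K + 2 * K + 2 + 2 * K + 2"
  define g where "g = h * v"
  have dg: "dim_row g = 1" "dim_col g = 1" by (simp_all add: g_def simps)
  let ?s10 = "exec (product 25 23 24 ix1 dim_m ix1) ?s9"
  let ?E10 = "?E8(24 \<mapsto> v, 25 \<mapsto> g)"
  have s10: "snapshot V ?E10 (?c9 + 2 * K) ?s10"
    by (rule step_product[where B = h and D = v, OF s9]) (simp_all add: simps g_def)
  \<comment> \<open>If \<open>y * M * v\<close> is zero, then \<open>M\<close> is zero and any nonzero scalar is admissible.\<close>
  define \<sigma> where "\<sigma> = (if g $$ (0,0) = 0 then 1\<^sub>m 1 else mat 1 1 (\<lambda>_. 1 / g $$ (0,0)))"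
  let ?s11 = "exec (IfZero (Cell 25 ix0 ix0) (identity_fill 26 ix1) (reciprocal 26 25 ix0 ix0)) ?s10"
  have s11: "snapshot V (?E10(26 \<mapsto> \<sigma>)) (Suc (Suc (?c9 + 2 * K))) ?s11"
  proof (cases "g $$ (0,0) = 0")
    case True
    have "snapshot V (?E10(26 \<mapsto> 1\<^sub>m 1)) (Suc (?c9 + 2 * K)) (exec (identity_fill 26 ix1) (tick ?s10))"
      by (rule exec_identity_fill[OF snapshot_tick[OF s10]]) simp_all
    then show ?thesis using exec_IfZero[OF s10, of ix0 0 ix0 0 25 g] True
      by (auto simp: dg \<sigma>_def intro: snapshot_le)
  next
    case False
    have "snapshot V (?E10(26 \<mapsto> mat 1 1 (\<lambda>_. 1 / g $$ (0,0)))) (Suc (Suc (?c9 + 2 * K))) (exec (reciprocal 26 25 ix0 ix0) (tick ?s10))"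
      by (rule exec_reciprocal[OF snapshot_tick[OF s10]]) (simp_all add: dg)
    then show ?thesis using exec_IfZero[OF s10, of ix0 0 ix0 0 25 g] False
      by (auto simp: dg \<sigma>_def)
  qed
  let ?c11 = "Suc (Suc (?c9 + 2 * K))"
  have d\<sigma>: "dim_row \<sigma> = 1" "dim_col \<sigma> = 1" by (simp_all add: \<sigma>_def)
  define \<sigma>' where "\<sigma>' = (if g $$ (0,0) = 0 then 1\<^sub>m 1 else g)"
  have d\<sigma>': "dim_row \<sigma>' = 1" "dim_col \<sigma>' = 1" by (simp_all add: \<sigma>'_def dg)
  have \<sigma>: "\<sigma> * \<sigma>' = 1\<^sub>m 1" and g\<sigma>: "M = 0\<^sub>m n m \<or> g * \<sigma> = 1\<^sub>m 1"
    using scalar_recip[of g] scalar_inverse_comm[of g \<sigma>] dg d\<sigma> hv by (auto simp: \<sigma>_def \<sigma>'_def g_def)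
  define wv where "wv = w * v"
  define \<alpha> where "\<alpha> = mat 1 1 (\<lambda>_. 1 / wv $$ (0,0))"
  define yx where "yx = y * x"
  define \<beta> where "\<beta> = mat 1 1 (\<lambda>_. 1 / yx $$ (0,0))"
  have d3: "dim_row wv = 1" "dim_col wv = 1" "dim_row \<alpha> = 1" "dim_col \<alpha> = 1"
     "dim_row yx = 1" "dim_col yx = 1" "dim_row \<beta> = 1" "dim_col \<beta> = 1"
    by (simp_all add: wv_def \<alpha>_def yx_def \<beta>_def simps)
  have \<alpha>: "w * v * \<alpha> = 1\<^sub>m 1" and \<beta>: "y * x * \<beta> = 1\<^sub>m 1"
    using scalar_recip[of wv] scalar_recip[of yx] wv yx d3 by (simp_all add: \<alpha>_def \<beta>_def wv_def yx_def)
  note simps = simps dg d\<sigma> d3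
  let ?E11 = "?E10(26 \<mapsto> \<sigma>)"
  let ?s12 = "exec (product 27 20 24 ix1 dim_m ix1) ?s11"
  have s12: "snapshot V (?E11(27 \<mapsto> wv)) (?c11 + 2 * K) ?s12"
    by (rule step_product[where B = w and D = v, OF s11]) (simp_all add: simps wv_def)
  let ?s13 = "exec (reciprocal 28 27 ix0 ix0) ?s12"
  have s13: "snapshot V (?E11(27 \<mapsto> wv, 28 \<mapsto> \<alpha>)) (Suc (?c11 + 2 * K)) ?s13"
    unfolding \<alpha>_def by (rule exec_reciprocal[OF s12]) (simp_all add: simps)
  let ?s14 = "exec (product 29 22 21 ix1 dim_n ix1) ?s13"
  have s14: "snapshot V (?E11(27 \<mapsto> wv, 28 \<mapsto> \<alpha>, 29 \<mapsto> yx)) (Suc (?c11 + 2 * K) + 2 * K) ?s14"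
    by (rule step_product[where B = y and D = x, OF s13]) (simp_all add: simps yx_def)
  let ?s15 = "exec (reciprocal 30 29 ix0 ix0) ?s14"
  let ?E15 = "?E11(27 \<mapsto> wv, 28 \<mapsto> \<alpha>, 29 \<mapsto> yx, 30 \<mapsto> \<beta>)"
  let ?c15 = "Suc (Suc (?c11 + 2 * K) + 2 * K)"
  have s15: "snapshot V ?E15 ?c15 ?s15"
    unfolding \<beta>_def by (rule exec_reciprocal[OF s14]) (simp_all add: simps)
  \<comment> \<open>The vectors \<open>e1 = S3 L * v\<close> and \<open>f1 = y * F L\<close>, from which the update of \<open>L\<close> is formed.\<close>
  define e0 where "e0 = P3 * v"
  define p1v where "p1v = P1 * v"
  define e1 where "e1 = e0 - L * p1v"
  define f0 where "f0 = y * Q3"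
  define yq where "yq = y * Q4"
  define f1 where "f1 = f0 + yq * L"
  define es where "es = e1 * \<sigma>"
  define L' where "L' = L - es * f1"
  have d4: "dim_row e0 = n" "dim_col e0 = 1" "dim_row p1v = m" "dim_col p1v = 1" "dim_row e1 = n" "dim_col e1 = 1"
     "dim_row f0 = 1" "dim_col f0 = m" "dim_row yq = 1" "dim_col yq = n" "dim_row f1 = 1" "dim_col f1 = m"
     "dim_row es = n" "dim_col es = 1" "dim_row L' = n" "dim_col L' = m"
    by (simp_all add: e0_def p1v_def e1_def f0_def yq_def f1_def es_def L'_def simps)
  note simps = simps d4
  let ?s16 = "exec (product 31 11 24 dim_n dim_m ix1) ?s15"
  have s16: "snapshot V (?E15(31 \<mapsto> e0)) (?c15 + 2 * K) ?s16"
    by (rule step_product[where B = P3 and D = v, OF s15]) (simp_all add: simps e0_def)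
  let ?s17 = "exec (product 32 10 24 dim_m dim_m ix1) ?s16"
  have s17: "snapshot V (?E15(31 \<mapsto> e0, 32 \<mapsto> p1v)) (?c15 + 2 * K + 2 * K) ?s17"
    by (rule step_product[where B = P1 and D = v, OF s16]) (simp_all add: simps p1v_def)
  let ?s18 = "exec (accumulate Sub 31 1 32 dim_n dim_m ix1) ?s17"
  have s18: "snapshot V (?E15(31 \<mapsto> e0, 32 \<mapsto> p1v, 31 \<mapsto> e1)) (?c15 + 2 * K + 2 * K + 2 * K) ?s18"
    by (rule step_sub[where A = e0 and B = L and D = p1v, OF s17]) (simp_all add: simps e1_def)
  let ?s19 = "exec (product 33 22 13 ix1 dim_n dim_m) ?s18"
  have s19: "snapshot V (?E15(31 \<mapsto> e0, 32 \<mapsto> p1v, 31 \<mapsto> e1, 33 \<mapsto> f0)) (?c15 + 2 * K + 2 * K + 2 * K + 2 * K) ?s19"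
    by (rule step_product[where B = y and D = Q3, OF s18]) (simp_all add: simps f0_def)
  let ?s20 = "exec (product 34 22 14 ix1 dim_n dim_n) ?s19"
  have s20: "snapshot V (?E15(31 \<mapsto> e0, 32 \<mapsto> p1v, 31 \<mapsto> e1, 33 \<mapsto> f0, 34 \<mapsto> yq)) (?c15 + 2 * K + 2 * K + 2 * K + 2 * K + 2 * K) ?s20"
    by (rule step_product[where B = y and D = Q4, OF s19]) (simp_all add: simps yq_def)
  let ?s21 = "exec (accumulate Add 33 34 1 ix1 dim_n dim_m) ?s20"
  have s21: "snapshot V (?E15(31 \<mapsto> e0, 32 \<mapsto> p1v, 31 \<mapsto> e1, 33 \<mapsto> f0, 34 \<mapsto> yq, 33 \<mapsto> f1)) (?c15 + 2 * K + 2 * K + 2 * K + 2 * K + 2 * K + 2 * K) ?s21"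
    by (rule step_add[where A = f0 and B = yq and D = L, OF s20]) (simp_all add: simps f1_def)
  let ?s22 = "exec (product 35 31 26 dim_n ix1 ix1) ?s21"
  have s22: "snapshot V (?E15(31 \<mapsto> e0, 32 \<mapsto> p1v, 31 \<mapsto> e1, 33 \<mapsto> f0, 34 \<mapsto> yq, 33 \<mapsto> f1, 35 \<mapsto> es)) (?c15 + 2 * K + 2 * K + 2 * K + 2 * K + 2 * K + 2 * K + 2 * K) ?s22"
    by (rule step_product[where B = e1 and D = \<sigma>, OF s21]) (simp_all add: simps es_def)
  let ?s23 = "exec (accumulate Sub 1 35 33 dim_n ix1 dim_m) ?s22"
  let ?E23 = "?E15(31 \<mapsto> e0, 32 \<mapsto> p1v, 31 \<mapsto> e1, 33 \<mapsto> f0, 34 \<mapsto> yq, 33 \<mapsto> f1, 35 \<mapsto> es, 1 \<mapsto> L')"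
  let ?c23 = "?c15 + 2 * K + 2 * K + 2 * K + 2 * K + 2 * K + 2 * K + 2 * K + 2 * K"
  have s23: "snapshot V ?E23 ?c23 ?s23"
    by (rule step_sub[where A = L and B = es and D = f1, OF s22]) (simp_all add: simps L'_def)
  define Mv where "Mv = M * v"
  define Ms where "Ms = Mv * \<sigma>"
  define M' where "M' = M - Ms * h"
  define Wv where "Wv = W * v"
  define Ws where "Ws = Wv * \<alpha>"
  define W' where "W' = W - Ws * w"
  define yX where "yX = y * X"
  define xs where "xs = x * \<beta>"
  define X' where "X' = X - xs * yX"
  have d5: "dim_row Mv = n" "dim_col Mv = 1" "dim_row Ms = n" "dim_col Ms = 1" "dim_row M' = n" "dim_col M' = m"
     "dim_row Wv = n" "dim_col Wv = 1" "dim_row Ws = n" "dim_col Ws = 1" "dim_row W' = n" "dim_col W' = m"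
     "dim_row yX = 1" "dim_col yX = n" "dim_row xs = n" "dim_col xs = 1" "dim_row X' = n" "dim_col X' = n"
    by (simp_all add: Mv_def Ms_def M'_def Wv_def Ws_def W'_def yX_def xs_def X'_def simps)
  note simps = simps d5
  let ?s24 = "exec (product 36 19 24 dim_n dim_m ix1) ?s23"
  have s24: "snapshot V (?E23(36 \<mapsto> Mv)) (?c23 + 2 * K) ?s24"
    by (rule step_product[where B = M and D = v, OF s23]) (simp_all add: simps Mv_def)
  let ?s25 = "exec (product 37 36 26 dim_n ix1 ix1) ?s24"
  have s25: "snapshot V (?E23(36 \<mapsto> Mv, 37 \<mapsto> Ms)) (?c23 + 2 * K + 2 * K) ?s25"
    by (rule step_product[where B = Mv and D = \<sigma>, OF s24]) (simp_all add: simps Ms_def)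
  let ?s26 = "exec (accumulate Sub 19 37 23 dim_n ix1 dim_m) ?s25"
  let ?E26 = "?E23(36 \<mapsto> Mv, 37 \<mapsto> Ms, 19 \<mapsto> M')"
  let ?c26 = "?c23 + 2 * K + 2 * K + 2 * K"
  have s26: "snapshot V ?E26 ?c26 ?s26"
    by (rule step_sub[where A = M and B = Ms and D = h, OF s25]) (simp_all add: simps M'_def)
  let ?s27 = "exec (product 38 18 24 dim_n dim_m ix1) ?s26"
  have s27: "snapshot V (?E26(38 \<mapsto> Wv)) (?c26 + 2 * K) ?s27"
    by (rule step_product[where B = W and D = v, OF s26]) (simp_all add: simps Wv_def)
  let ?s28 = "exec (product 39 38 28 dim_n ix1 ix1) ?s27"
  have s28: "snapshot V (?E26(38 \<mapsto> Wv, 39 \<mapsto> Ws)) (?c26 + 2 * K + 2 * K) ?s28"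
    by (rule step_product[where B = Wv and D = \<alpha>, OF s27]) (simp_all add: simps Ws_def)
  let ?s29 = "exec (accumulate Sub 18 39 20 dim_n ix1 dim_m) ?s28"
  let ?E29 = "?E26(38 \<mapsto> Wv, 39 \<mapsto> Ws, 18 \<mapsto> W')"
  let ?c29 = "?c26 + 2 * K + 2 * K + 2 * K"
  have s29: "snapshot V ?E29 ?c29 ?s29"
    by (rule step_sub[where A = W and B = Ws and D = w, OF s28]) (simp_all add: simps W'_def)
  let ?s30 = "exec (product 40 22 16 ix1 dim_n dim_n) ?s29"
  have s30: "snapshot V (?E29(40 \<mapsto> yX)) (?c29 + 2 * K) ?s30"
    by (rule step_product[where B = y and D = X, OF s29]) (simp_all add: simps yX_def)
  let ?s31 = "exec (product 41 21 30 dim_n ix1 ix1) ?s30"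
  have s31: "snapshot V (?E29(40 \<mapsto> yX, 41 \<mapsto> xs)) (?c29 + 2 * K + 2 * K) ?s31"
    by (rule step_product[where B = x and D = \<beta>, OF s30]) (simp_all add: simps xs_def)
  let ?s32 = "exec (accumulate Sub 16 41 40 dim_n ix1 dim_n) ?s31"
  let ?E32 = "?E29(40 \<mapsto> yX, 41 \<mapsto> xs, 16 \<mapsto> X')"
  let ?c32 = "?c29 + 2 * K + 2 * K + 2 * K"
  have s32: "snapshot V ?E32 ?c32 ?s32"
    by (rule step_sub[where A = X and B = xs and D = yX, OF s31]) (simp_all add: simps X'_def)
  have "exec loop_update s = ?s32" unfolding loop_update_def block.simps by (simp only: exec.simps(1,2))
  moreover have "snapshot [0 \<mapsto> m, 1 \<mapsto> n] (loop_env L' M' W' X') (c + 60 * K) ?s32"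
  proof (rule snapshot_weaken[OF s32])
    show "[0 \<mapsto> m, 1 \<mapsto> n] \<subseteq>\<^sub>m V" by (auto simp: map_le_def V)
    show "loop_env L' M' W' X' \<subseteq>\<^sub>m ?E32" by (auto simp: map_le_def loop_env_def env_def E0_def)
    show "?c32 \<le> c + 60 * K" using K(7) by linarith
  qed
  moreover have "loop_inv (Suc i) L' M' W' X'"
  proof -
    have "loop_inv (Suc i) (L - S3 L * v * \<sigma> * (y * F L)) (M - M * v * \<sigma> * (y * M))
           (W - W * v * \<alpha> * w) (X - x * \<beta> * (y * X))"
      by (rule loop_inv_step[OF inv i _ _ x_def _ _ _ _ w _ _ _ _ \<sigma> _ _ \<alpha> _ _ \<beta>])
         (use g\<sigma> in \<open>simp_all add: simps d\<sigma>' g_def h_def\<close>)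
    moreover have "S3 L * v = e1" by (simp add: S3_def e1_def e0_def p1v_def mat_ring simps)
    moreover have "y * F L = f1" by (simp add: F_def f1_def f0_def yq_def mat_ring simps)
    ultimately show ?thesis
      by (simp add: L'_def M'_def W'_def X'_def es_def Ms_def Mv_def Ws_def Wv_def xs_def yX_def h_def)
  qed
  ultimately show ?thesis by metis
qed

end

section \<open>The complete algorithm\<close>

text \<open>The generalized inverse of the invertible matrix in array 0 is its inverse.\<close>

definition setup_blocks :: prog where
  "setup_blocks = block
     [ginv_prog 0 6 (Plus dim_m dim_n),
      copy_block 10 0 ix0 ix0 dim_m dim_m, copy_block 4 0 ix0 dim_m dim_m dim_n,
      copy_block 11 0 dim_m ix0 dim_n dim_m, copy_block 12 0 dim_m dim_m dim_n dim_n,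
      copy_block 13 6 dim_m ix0 dim_n dim_m, copy_block 14 6 dim_m dim_m dim_n dim_n]"

text \<open>The loop starts from \<open>L = 0\<close>. With the generalized inverse \<open>G\<close> of \<open>P4\<close> in array 15, the projections onto the
  kernels of \<open>P4\<close> are \<open>1 - P4 * G\<close> in array 17, from which \<open>W\<close> is formed, and \<open>X = 1 - G * P4\<close>.\<close>

definition prepare :: prog where
  "prepare = block
     [ginv_prog 12 15 dim_n,
      zero_fill 1 dim_n dim_m,
      product 19 14 11 dim_n dim_n dim_m,
      identity_fill 17 dim_n, accumulate Sub 17 12 15 dim_n dim_n dim_n,
      product 18 17 11 dim_n dim_n dim_m,
      identity_fill 16 dim_n, accumulate Sub 16 15 12 dim_n dim_n dim_n]"

definition finish :: prog where
  "finish = block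
     [copy_block 5 12 ix0 ix0 dim_n dim_n, accumulate Sub 5 1 4 dim_n dim_m dim_n,
      copy_block 43 11 ix0 ix0 dim_n dim_m, accumulate Sub 43 1 10 dim_n dim_m dim_m,
      ginv_prog 5 44 dim_n,
      product 2 44 43 dim_n dim_n dim_m,
      copy_block 3 10 ix0 ix0 dim_m dim_m, accumulate Sub 3 4 2 dim_m dim_n dim_m]"

definition decompose :: prog where
  "decompose = block [setup_blocks, prepare, For 2 dim_n loop_row, finish]"

lemma four_block_mat_inject:
  assumes "four_block_mat A B C D = four_block_mat A' B' C' D'"
    and "A \<in> carrier_mat m k" "B \<in> carrier_mat m l" "C \<in> carrier_mat n k" "D \<in> carrier_mat n l"
    and "A' \<in> carrier_mat m k" "B' \<in> carrier_mat m l" "C' \<in> carrier_mat n k" "D' \<in> carrier_mat n l"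
  shows "A = A'" "B = B'" "C = C'" "D = D'"
proof -
  have e: "four_block_mat A B C D $$ (i, j) = four_block_mat A' B' C' D' $$ (i, j)" for i j using assms(1) by simp
  note d = carrier_matD[OF assms(2)] carrier_matD[OF assms(3)] carrier_matD[OF assms(4)] carrier_matD[OF assms(5)]
    carrier_matD[OF assms(6)] carrier_matD[OF assms(7)] carrier_matD[OF assms(8)] carrier_matD[OF assms(9)]
  show "A = A'"
  proof (rule eq_matI)
    fix i j assume "i < dim_row A'" "j < dim_col A'" then show "A $$ (i,j) = A' $$ (i,j)" using e[of i j] by (simp add: d)
  qed (simp_all add: d)
  show "B = B'"
  proof (rule eq_matI)
    fix i j assume "i < dim_row B'" "j < dim_col B'" then show "B $$ (i,j) = B' $$ (i,j)" using e[of i "k + j"] by (simp add: d)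
  qed (simp_all add: d)
  show "C = C'"
  proof (rule eq_matI)
    fix i j assume "i < dim_row C'" "j < dim_col C'" then show "C $$ (i,j) = C' $$ (i,j)" using e[of "m + i" j] by (simp add: d)
  qed (simp_all add: d)
  show "D = D'"
  proof (rule eq_matI)
    fix i j assume "i < dim_row D'" "j < dim_col D'" then show "D $$ (i,j) = D' $$ (i,j)" using e[of "m + i" "k + j"] by (simp add: d)
  qed (simp_all add: d)
qed

lemma add_eq_imp_eq_minus:
  fixes A :: "'a::comm_ring_1 mat"
  assumes "A + B = C" "dim_row A = r" "dim_col A = q" "dim_row B = r" "dim_col B = q" shows "A = C - B"
  unfolding assms(1)[symmetric] by (rule eq_matI) (simp_all add: assms(2-))

lemma inverse_blocksI:
  fixes P1 P2 P3 P4 Q1 Q2 Q3 Q4 :: "'a::field mat"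
  assumes P: "P1 \<in> carrier_mat m m" "P2 \<in> carrier_mat m n" "P3 \<in> carrier_mat n m" "P4 \<in> carrier_mat n n"
    and Q: "Q1 \<in> carrier_mat m m" "Q2 \<in> carrier_mat m n" "Q3 \<in> carrier_mat n m" "Q4 \<in> carrier_mat n n"
    and PQ: "four_block_mat P1 P2 P3 P4 * four_block_mat Q1 Q2 Q3 Q4 = 1\<^sub>m (m + n)"
  shows "inverse_blocks m n P1 P2 P3 P4 Q1 Q2 Q3 Q4"
proof -
  note d = carrier_matD[OF P(1)] carrier_matD[OF P(2)] carrier_matD[OF P(3)] carrier_matD[OF P(4)]
    carrier_matD[OF Q(1)] carrier_matD[OF Q(2)] carrier_matD[OF Q(3)] carrier_matD[OF Q(4)]
  have QP: "four_block_mat Q1 Q2 Q3 Q4 * four_block_mat P1 P2 P3 P4 = 1\<^sub>m (m + n)"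
    by (rule mat_mult_left_right_inverse[OF _ _ PQ]) (use P Q in auto)
  have 1: "four_block_mat (P1 * Q1 + P2 * Q3) (P1 * Q2 + P2 * Q4) (P3 * Q1 + P4 * Q3) (P3 * Q2 + P4 * Q4) =
     four_block_mat (1\<^sub>m m) (0\<^sub>m m n) (0\<^sub>m n m) (1\<^sub>m n)"
    using PQ unfolding mult_four_block_mat[OF P Q] by simp
  have 2: "four_block_mat (Q1 * P1 + Q2 * P3) (Q1 * P2 + Q2 * P4) (Q3 * P1 + Q4 * P3) (Q3 * P2 + Q4 * P4) =
     four_block_mat (1\<^sub>m m) (0\<^sub>m m n) (0\<^sub>m n m) (1\<^sub>m n)"
    using QP unfolding mult_four_block_mat[OF Q P] by simp
  have e1: "P1 * Q1 + P2 * Q3 = 1\<^sub>m m" "P1 * Q2 + P2 * Q4 = 0\<^sub>m m n"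
     "P3 * Q1 + P4 * Q3 = 0\<^sub>m n m" "P3 * Q2 + P4 * Q4 = 1\<^sub>m n"
    by (rule four_block_mat_inject[OF 1, of m m n n]; use P Q in auto)+
  have e2: "Q1 * P1 + Q2 * P3 = 1\<^sub>m m" "Q3 * P1 + Q4 * P3 = 0\<^sub>m n m" "Q3 * P2 + Q4 * P4 = 1\<^sub>m n"
    by (rule four_block_mat_inject[OF 2, of m m n n]; use P Q in auto)+
  have neg: "0\<^sub>m (dim_row A) (dim_col A) - A = - A" for A :: "'a mat" by (rule eq_matI) simp_all
  show ?thesis
  proof
    show "Q1 * P1 = 1\<^sub>m m - Q2 * P3" by (rule add_eq_imp_eq_minus[OF e2(1)]) (simp_all add: d)
    show "Q3 * P2 = 1\<^sub>m n - Q4 * P4" by (rule add_eq_imp_eq_minus[OF e2(3)]) (simp_all add: d)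
    show "P1 * Q1 = 1\<^sub>m m - P2 * Q3" by (rule add_eq_imp_eq_minus[OF e1(1)]) (simp_all add: d)
    show "P3 * Q2 = 1\<^sub>m n - P4 * Q4" by (rule add_eq_imp_eq_minus[OF e1(4)]) (simp_all add: d)
    have "Q3 * P1 = 0\<^sub>m n m - Q4 * P3" by (rule add_eq_imp_eq_minus[OF e2(2)]) (simp_all add: d)
    then show "Q3 * P1 = - (Q4 * P3)" using neg[of "Q4 * P3"] by (simp add: d)
    have "P1 * Q2 = 0\<^sub>m m n - P2 * Q4" by (rule add_eq_imp_eq_minus[OF e1(2)]) (simp_all add: d)
    then show "P1 * Q2 = - (P2 * Q4)" using neg[of "P2 * Q4"] by (simp add: d)
    have "P3 * Q1 = 0\<^sub>m n m - P4 * Q3" by (rule add_eq_imp_eq_minus[OF e1(3)]) (simp_all add: d)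
    then show "P3 * Q1 = - (P4 * Q3)" using neg[of "P4 * Q3"] by (simp add: d)
  qed (simp_all add: d)
qed

lemma exec_setup_blocks:
  fixes P1 P2 P3 P4 :: "'a::field mat"
  assumes GL: "partitioned_GL m n P1 P2 P3 P4"
  shows "\<exists>Q1 Q2 Q3 Q4. inverse_blocks m n P1 P2 P3 P4 Q1 Q2 Q3 Q4 \<and>
    snapshot [0 \<mapsto> m, 1 \<mapsto> n] [10 \<mapsto> P1, 4 \<mapsto> P2, 11 \<mapsto> P3, 12 \<mapsto> P4, 13 \<mapsto> Q3, 14 \<mapsto> Q4]
      (16 * (m + n) ^ 3) (exec setup_blocks (initial_state m n (four_block_mat P1 P2 P3 P4)))"
proof -
  have P: "P1 \<in> carrier_mat m m" "P2 \<in> carrier_mat m n" "P3 \<in> carrier_mat n m" "P4 \<in> carrier_mat n n"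
    and inv: "invertible_mat (four_block_mat P1 P2 P3 P4)"
    using GL by (auto simp: partitioned_GL_def)
  note d = carrier_matD[OF P(1)] carrier_matD[OF P(2)] carrier_matD[OF P(3)] carrier_matD[OF P(4)]
  define P where "P = four_block_mat P1 P2 P3 P4"
  have dP: "dim_row P = m + n" "dim_col P = m + n" by (simp_all add: P_def d)
  let ?V = "[0 \<mapsto> m, 1 \<mapsto> n] :: nat \<rightharpoonup> nat"
  have s0: "snapshot ?V [0 \<mapsto> P] 0 (initial_state m n P)"
    by (auto simp: snapshot_def initial_state_def dP split: if_splits)
  have ne: "known_val W (Plus dim_m dim_n) = Some (m + n)" if "?V \<subseteq>\<^sub>m W" for W
    using that by (auto simp: map_le_def dom_def split: if_splits)
  obtain G where G: "is_ginv P G" and s1: "snapshot ?V [0 \<mapsto> P, 6 \<mapsto> G] (0 + 16 * ((m + n) * (m + n) * (m + n)))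
      (exec (ginv_prog 0 6 (Plus dim_m dim_n)) (initial_state m n P))"
    by (rule exec_ginv_prog[OF s0 ne, where a = 0 and b = 6 and A = P]) (simp_all add: dP)
  have dG: "dim_row G = m + n" "dim_col G = m + n" and PGP: "P * G * P = P" using G by (auto simp: is_ginv_def dP)
  obtain B where "inverts_mat P B" "inverts_mat B P"
    using inv unfolding P_def[symmetric] invertible_mat_def by blast
  then have PB: "P * B = 1\<^sub>m (m + n)" and BP: "B * P = 1\<^sub>m (dim_row B)" by (auto simp: inverts_mat_def dP)
  have "dim_row (B * P) = dim_row B" "dim_col (B * P) = m + n" by (simp_all add: dP)
  then have dB: "dim_row B = m + n" by (simp add: BP)
  have "P * G = P * G * (P * B)" by (simp add: PB mult_one_dim dG)
  also have "\<dots> = P * G * P * B" by (simp add: mult_assoc_dim dP dG dB)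
  also have "\<dots> = 1\<^sub>m (m + n)" by (simp add: PGP PB)
  finally have PG: "P * G = 1\<^sub>m (m + n)" .
  define Q1 where "Q1 = mat m m (\<lambda>(i,j). G $$ (i, j))"
  define Q2 where "Q2 = mat m n (\<lambda>(i,j). G $$ (i, m + j))"
  define Q3 where "Q3 = mat n m (\<lambda>(i,j). G $$ (m + i, 0 + j))"
  define Q4 where "Q4 = mat n n (\<lambda>(i,j). G $$ (m + i, m + j))"
  have Q: "Q1 \<in> carrier_mat m m" "Q2 \<in> carrier_mat m n" "Q3 \<in> carrier_mat n m" "Q4 \<in> carrier_mat n n"
    by (simp_all add: Q1_def Q2_def Q3_def Q4_def)
  have "four_block_mat Q1 Q2 Q3 Q4 = G"
    by (rule eq_matI) (auto simp: Q1_def Q2_def Q3_def Q4_def dG)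
  then have ib: "inverse_blocks m n P1 P2 P3 P4 Q1 Q2 Q3 Q4"
    using inverse_blocksI[OF \<open>P1 \<in> _\<close> \<open>P2 \<in> _\<close> \<open>P3 \<in> _\<close> \<open>P4 \<in> _\<close> Q] PG unfolding P_def by simp
  have PP: "mat m m (\<lambda>(i,j). P $$ (0 + i, 0 + j)) = P1" "mat m n (\<lambda>(i,j). P $$ (0 + i, m + j)) = P2"
     "mat n m (\<lambda>(i,j). P $$ (m + i, 0 + j)) = P3" "mat n n (\<lambda>(i,j). P $$ (m + i, m + j)) = P4"
    by (rule eq_matI; simp add: P_def d)+
  let ?c = "0 + 16 * ((m + n) * (m + n) * (m + n))"
  let ?s1 = "exec (ginv_prog 0 6 (Plus dim_m dim_n)) (initial_state m n P)"
  let ?s2 = "exec (copy_block 10 0 ix0 ix0 dim_m dim_m) ?s1"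
  let ?s3 = "exec (copy_block 4 0 ix0 dim_m dim_m dim_n) ?s2"
  let ?s4 = "exec (copy_block 11 0 dim_m ix0 dim_n dim_m) ?s3"
  let ?s5 = "exec (copy_block 12 0 dim_m dim_m dim_n dim_n) ?s4"
  let ?s6 = "exec (copy_block 13 6 dim_m ix0 dim_n dim_m) ?s5"
  let ?s7 = "exec (copy_block 14 6 dim_m dim_m dim_n dim_n) ?s6"
  have s2: "snapshot ?V [0 \<mapsto> P, 6 \<mapsto> G, 10 \<mapsto> P1] ?c ?s2"
    by (rule exec_copy_block[OF s1, where B = P and ro = ix0 and ioff = 0 and co = ix0 and joff = 0 and r = m and q = m, unfolded PP])
       (simp_all add: dP)
  have s3: "snapshot ?V [0 \<mapsto> P, 6 \<mapsto> G, 10 \<mapsto> P1, 4 \<mapsto> P2] ?c ?s3"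
    by (rule exec_copy_block[OF s2, where B = P and ro = ix0 and ioff = 0 and co = dim_m and joff = m and r = m and q = n, unfolded PP])
       (simp_all add: dP)
  have s4: "snapshot ?V [0 \<mapsto> P, 6 \<mapsto> G, 10 \<mapsto> P1, 4 \<mapsto> P2, 11 \<mapsto> P3] ?c ?s4"
    by (rule exec_copy_block[OF s3, where B = P and ro = dim_m and ioff = m and co = ix0 and joff = 0 and r = n and q = m, unfolded PP])
       (simp_all add: dP)
  have s5: "snapshot ?V [0 \<mapsto> P, 6 \<mapsto> G, 10 \<mapsto> P1, 4 \<mapsto> P2, 11 \<mapsto> P3, 12 \<mapsto> P4] ?c ?s5"
    by (rule exec_copy_block[OF s4, where B = P and ro = dim_m and ioff = m and co = dim_m and joff = m and r = n and q = n, unfolded PP])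
       (simp_all add: dP)
  have s6: "snapshot ?V [0 \<mapsto> P, 6 \<mapsto> G, 10 \<mapsto> P1, 4 \<mapsto> P2, 11 \<mapsto> P3, 12 \<mapsto> P4, 13 \<mapsto> Q3] ?c ?s6"
    unfolding Q3_def
    by (rule exec_copy_block[OF s5, where B = G and ro = dim_m and ioff = m and co = ix0 and joff = 0 and r = n and q = m])
       (simp_all add: dG)
  have s7: "snapshot ?V [0 \<mapsto> P, 6 \<mapsto> G, 10 \<mapsto> P1, 4 \<mapsto> P2, 11 \<mapsto> P3, 12 \<mapsto> P4, 13 \<mapsto> Q3, 14 \<mapsto> Q4] ?c ?s7"
    unfolding Q4_def
    by (rule exec_copy_block[OF s6, where B = G and ro = dim_m and ioff = m and co = dim_m and joff = m and r = n and q = n])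
       (simp_all add: dG)
  have "snapshot ?V [10 \<mapsto> P1, 4 \<mapsto> P2, 11 \<mapsto> P3, 12 \<mapsto> P4, 13 \<mapsto> Q3, 14 \<mapsto> Q4] (16 * (m + n) ^ 3) ?s7"
    by (rule snapshot_weaken[OF s7]) (auto simp: map_le_def power3_eq_cube)
  moreover have "exec setup_blocks (initial_state m n P) = ?s7"
    unfolding setup_blocks_def block.simps by (simp only: exec.simps(1,2))
  ultimately show ?thesis using ib unfolding P_def by metis
qed

context inverse_blocks
begin

lemma exec_loop_row:
  assumes K: "n * n \<le> K" "n * m \<le> K" "m * n \<le> K" "m * m \<le> K" "n \<le> K" "m \<le> K" "Suc 0 \<le> K"
    and s: "snapshot [0 \<mapsto> m, 1 \<mapsto> n, 2 \<mapsto> i] (loop_env L M W X) c s"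
    and inv: "loop_inv i L M W X" and i: "i < n"
  shows "\<exists>L' M' W' X'. snapshot [0 \<mapsto> m, 1 \<mapsto> n] (loop_env L' M' W' X') (c + 63 * K) (exec loop_row s) \<and>
    loop_inv (Suc i) L' M' W' X'"
proof -
  have dW: "dim_row W = n" "dim_col W = m"
    using inv by (auto simp: loop_inv_def)
  define u where "u = (unit_row n i :: 'a mat)"
  define w where "w = u * W"
  have d: "dim_row u = 1" "dim_col u = n" "dim_row w = 1" "dim_col w = m" by (simp_all add: u_def w_def dW)
  have W: "loop_env L M W X 18 = Some W" by (simp add: loop_env_def)
  let ?V = "[0 \<mapsto> m, 1 \<mapsto> n, 2 \<mapsto> i] :: nat \<rightharpoonup> nat"
  let ?E = "(loop_env L M W X)(45 \<mapsto> u, 20 \<mapsto> w)"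
  let ?s1 = "exec (unit_row_fill 45 dim_n 2) s"
  let ?s2 = "exec (product 20 45 18 ix1 dim_n dim_m) ?s1"
  let ?s3 = "exec (search 20 ix1 dim_m 3 4 5) ?s2"
  have s1: "snapshot ?V ((loop_env L M W X)(45 \<mapsto> u)) c ?s1"
    unfolding u_def by (rule exec_unit_row_fill[OF s]) simp_all
  have s2: "snapshot ?V ?E (c + 2 * K) ?s2"
    by (rule step_product[where B = u and D = W, OF s1]) (simp_all add: w_def d W dW K)
  have ex: "exec loop_row s = exec (IfLess ix0 (Var 5) loop_update Skip) ?s3"
    by (simp add: loop_row_def)
  show ?thesis
  proof (rule exec_search[OF s2, of ix1 1 dim_m m 20 w 3 4 5])
    assume w0: "w = 0\<^sub>m 1 m" and s3: "snapshot (?V(5 \<mapsto> 0)) ?E (c + 2 * K + 1 * m) ?s3"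
    have "exec loop_row s = ?s3" unfolding ex using exec_IfLess[OF s3, of ix0 0 "Var 5" 0] by simp
    moreover have "snapshot [0 \<mapsto> m, 1 \<mapsto> n] (loop_env L M W X) (c + 63 * K) ?s3"
      by (rule snapshot_weaken[OF s3]) (use K in \<open>auto simp: map_le_def loop_env_def env_def\<close>)
    moreover have "loop_inv (Suc i) L M W X"
      by (rule loop_inv_skip[OF inv]) (use w0 in \<open>simp add: w_def u_def\<close>)
    ultimately show ?thesis by metis
  next
    fix i' b' assume "i' < 1" and b': "b' < m" "w $$ (i', b') \<noteq> 0"
      and s3: "snapshot (?V(3 \<mapsto> i', 4 \<mapsto> b', 5 \<mapsto> 1)) ?E (c + 2 * K + 1 * m) ?s3"
    then have i': "i' = 0" by simp
    have "exec loop_row s = exec loop_update ?s3" unfolding ex using exec_IfLess[OF s3, of ix0 0 "Var 5" 1] by simp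
    moreover have "snapshot (?V(3 \<mapsto> 0, 4 \<mapsto> b', 5 \<mapsto> 1)) ?E (c + 3 * K) ?s3"
      by (rule snapshot_le[OF s3[unfolded i']]) (use K(6) in simp)
    from exec_loop_update[OF K this inv i _ b'(1)] obtain L' M' W' X' where
      "snapshot [0 \<mapsto> m, 1 \<mapsto> n] (loop_env L' M' W' X') (c + 3 * K + 60 * K) (exec loop_update ?s3)"
      "loop_inv (Suc i) L' M' W' X'"
      using b'(2) i' by (auto simp: w_def u_def)
    moreover have "c + 3 * K + 60 * K = c + 63 * K" by simp
    ultimately show ?thesis by metis
  qed (simp_all add: d)
qed

lemma exec_prepare:
  assumes s: "snapshot [0 \<mapsto> m, 1 \<mapsto> n] env c s"
  shows "\<exists>L M W X. snapshot [0 \<mapsto> m, 1 \<mapsto> n] (loop_env L M W X) (c + 24 * (m + n) ^ 3) (exec prepare s) \<and> loop_inv 0 L M W X"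
proof -
  let ?V = "[0 \<mapsto> m, 1 \<mapsto> n] :: nat \<rightharpoonup> nat"
  define K where "K = (m + n) ^ 3"
  have K: "n * n * n \<le> K" "n * n * m \<le> K"
    unfolding K_def power3_eq_cube by (auto intro!: mult_le_mono)
  have ne: "known_val W dim_n = Some n" if "?V \<subseteq>\<^sub>m W" for W
    using that by (auto simp: map_le_def dom_def split: if_splits)
  let ?s1 = "exec (ginv_prog 12 15 dim_n) s"
  obtain G where G: "is_ginv P4 G" and s1: "snapshot ?V (env(15 \<mapsto> G)) (c + 16 * (n * n * n)) ?s1"
    by (rule exec_ginv_prog[OF s ne, where a = 12 and b = 15 and A = P4]) (simp_all add: dims env_def)
  have dG: "dim_row G = n" "dim_col G = n" using G by (auto simp: is_ginv_def dims)
  define L0 where "L0 = (0\<^sub>m n m :: 'a mat)"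
  define M0 where "M0 = Q4 * P3"
  define Z0 where "Z0 = 1\<^sub>m n - P4 * G"
  define W0 where "W0 = Z0 * P3"
  define X0 where "X0 = 1\<^sub>m n - G * P4"
  have dZ: "dim_row Z0 = n" "dim_col Z0 = n" by (simp_all add: Z0_def dG dims)
  note simps = dims dG dZ K env_def
  let ?c = "c + 16 * (n * n * n)"
  let ?s2 = "exec (zero_fill 1 dim_n dim_m) ?s1"
  let ?s3 = "exec (product 19 14 11 dim_n dim_n dim_m) ?s2"
  let ?s4 = "exec (identity_fill 17 dim_n) ?s3"
  let ?s5 = "exec (accumulate Sub 17 12 15 dim_n dim_n dim_n) ?s4"
  let ?s6 = "exec (product 18 17 11 dim_n dim_n dim_m) ?s5"
  let ?s7 = "exec (identity_fill 16 dim_n) ?s6"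
  let ?s8 = "exec (accumulate Sub 16 15 12 dim_n dim_n dim_n) ?s7"
  have s2: "snapshot ?V (env(15 \<mapsto> G, 1 \<mapsto> L0)) ?c ?s2"
    unfolding L0_def by (rule exec_zero_fill[OF s1]) simp_all
  have s3: "snapshot ?V (env(15 \<mapsto> G, 1 \<mapsto> L0, 19 \<mapsto> M0)) (?c + 2 * K) ?s3"
    by (rule step_product[where B = Q4 and D = P3, OF s2]) (simp_all add: simps M0_def)
  have s4: "snapshot ?V (env(15 \<mapsto> G, 1 \<mapsto> L0, 19 \<mapsto> M0, 17 \<mapsto> 1\<^sub>m n)) (?c + 2 * K) ?s4"
    by (rule exec_identity_fill[OF s3]) simp_all
  have s5: "snapshot ?V (env(15 \<mapsto> G, 1 \<mapsto> L0, 19 \<mapsto> M0, 17 \<mapsto> 1\<^sub>m n, 17 \<mapsto> Z0)) (?c + 2 * K + 2 * K) ?s5"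
    by (rule step_sub[where A = "1\<^sub>m n" and B = P4 and D = G, OF s4]) (simp_all add: simps Z0_def)
  have s6: "snapshot ?V (env(15 \<mapsto> G, 1 \<mapsto> L0, 19 \<mapsto> M0, 17 \<mapsto> 1\<^sub>m n, 17 \<mapsto> Z0, 18 \<mapsto> W0)) (?c + 2 * K + 2 * K + 2 * K) ?s6"
    by (rule step_product[where B = Z0 and D = P3, OF s5]) (simp_all add: simps W0_def)
  have s7: "snapshot ?V (env(15 \<mapsto> G, 1 \<mapsto> L0, 19 \<mapsto> M0, 17 \<mapsto> 1\<^sub>m n, 17 \<mapsto> Z0, 18 \<mapsto> W0, 16 \<mapsto> 1\<^sub>m n)) (?c + 2 * K + 2 * K + 2 * K) ?s7"
    by (rule exec_identity_fill[OF s6]) simp_all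
  have s8: "snapshot ?V (env(15 \<mapsto> G, 1 \<mapsto> L0, 19 \<mapsto> M0, 17 \<mapsto> 1\<^sub>m n, 17 \<mapsto> Z0, 18 \<mapsto> W0, 16 \<mapsto> 1\<^sub>m n, 16 \<mapsto> X0)) (?c + 2 * K + 2 * K + 2 * K + 2 * K) ?s8"
    by (rule step_sub[where A = "1\<^sub>m n" and B = G and D = P4, OF s7]) (simp_all add: simps X0_def)
  have "exec prepare s = ?s8" unfolding prepare_def block.simps by (simp only: exec.simps(1,2))
  moreover have "snapshot ?V (loop_env L0 M0 W0 X0) (c + 24 * K) ?s8"
    by (rule snapshot_weaken[OF s8]) (use K(1) in \<open>auto simp: map_le_def loop_env_def env_def\<close>)
  moreover have "loop_inv 0 L0 M0 W0 X0"
    using loop_inv_init[OF G] by (simp add: L0_def M0_def W0_def X0_def Z0_def)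
  ultimately show ?thesis unfolding K_def by metis
qed

text \<open>The lower left block of the triple product is \<open>L * P1 + S4 L * R\<close>; the other blocks are those of \<open>P\<close> for
  any \<open>L\<close> and \<open>R\<close>.\<close>

lemma block_decompositionI:
  assumes L: "dim_row L = n" "dim_col L = m" and R: "dim_row R = n" "dim_col R = m" "S4 L * R = S3 L"
    and rk: "rk L = n - rk P4" "rk R + rk L = max (rk P3) (n + m - rk P4 - rk P1)"
  shows "block_decomposition m n P1 P2 P3 P4 L R (P1 - P2 * R) P2 (S4 L)"
proof -
  let ?C1 = "P1 - P2 * R"
  have c: "L \<in> carrier_mat n m" "R \<in> carrier_mat n m" "?C1 \<in> carrier_mat m m" "P2 \<in> carrier_mat m n" "S4 L \<in> carrier_mat n n"
    by (rule carrier_matI; simp add: L R dims)+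
  note o = one_carrier_mat[of m] zero_carrier_mat[of m n] one_carrier_mat[of n] zero_carrier_mat[of n m]
  have "four_block_mat (1\<^sub>m m) (0\<^sub>m m n) L (1\<^sub>m n) * four_block_mat ?C1 P2 (0\<^sub>m n m) (S4 L) =
    four_block_mat ?C1 P2 (L * ?C1) (L * P2 + S4 L)"
    unfolding mult_four_block_mat[OF o(1,2) c(1) o(3) c(3,4) o(4) c(5)]
    by (intro cong_four_block_mat) (simp_all add: mat_ring L R dims)
  also have "\<dots> * four_block_mat (1\<^sub>m m) (0\<^sub>m m n) R (1\<^sub>m n) =
    four_block_mat (?C1 + P2 * R) P2 (L * ?C1 + (L * P2 + S4 L) * R) (L * P2 + S4 L)"
    by (subst mult_four_block_mat[OF c(3,4) _ _ o(1,2) c(2) o(3)])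
       (auto intro!: cong_four_block_mat carrier_matI simp: mat_ring L R dims)
  also have "\<dots> = four_block_mat P1 P2 P3 P4"
  proof (rule cong_four_block_mat)
    show "?C1 + P2 * R = P1" by (rule eq_matI) (simp_all add: L R dims)
    show "L * P2 + S4 L = P4" by (rule eq_matI) (simp_all add: S4_def L R dims)
    have "L * ?C1 + (L * P2 + S4 L) * R = L * P1 + S4 L * R"
      by (rule eq_matI) (simp_all add: mat_ring L R(1,2) dims)
    also have "\<dots> = P3" unfolding R(3) by (rule eq_matI) (simp_all add: S3_def L R dims)
    finally show "L * ?C1 + (L * P2 + S4 L) * R = P3" .
  qed simp
  finally show ?thesis unfolding block_decomposition_def using c rk by simp
qed

lemma exec_finish:
  assumes s: "snapshot [0 \<mapsto> m, 1 \<mapsto> n] (loop_env L M W X) c s" and inv: "loop_inv n L M W X"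
  shows "\<exists>R C1 C4. snapshot [0 \<mapsto> m, 1 \<mapsto> n] [1 \<mapsto> L, 2 \<mapsto> R, 3 \<mapsto> C1, 4 \<mapsto> P2, 5 \<mapsto> C4]
      (c + 24 * (m + n) ^ 3) (exec finish s) \<and>
    block_decomposition m n P1 P2 P3 P4 L R C1 P2 C4"
proof -
  let ?V = "[0 \<mapsto> m, 1 \<mapsto> n] :: nat \<rightharpoonup> nat"
  define K where "K = (m + n) ^ 3"
  have K: "n * n * n \<le> K" "n * n * m \<le> K" "n * m * n \<le> K" "n * m * m \<le> K" "m * n * m \<le> K"
    unfolding K_def power3_eq_cube by (auto intro!: mult_le_mono)
  have L: "dim_row L = n" "dim_col L = m" using inv by (auto simp: loop_inv_def)
  have ne: "known_val W dim_n = Some n" if "?V \<subseteq>\<^sub>m W" for W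
    using that by (auto simp: map_le_def dom_def split: if_splits)
  have cp: "mat n n (\<lambda>(i,j). P4 $$ (0 + i, 0 + j)) = P4" "mat n m (\<lambda>(i,j). P3 $$ (0 + i, 0 + j)) = P3"
     "mat m m (\<lambda>(i,j). P1 $$ (0 + i, 0 + j)) = P1"
    by (rule eq_matI; simp add: dims)+
  define E where "E = loop_env L M W X"
  have E: "E 1 = Some L" "E 10 = Some P1" "E 4 = Some P2" "E 11 = Some P3" "E 12 = Some P4"
    "\<And>k. k \<in> {50..56} \<Longrightarrow> E k = None"
    by (auto simp: E_def loop_env_def env_def)
  note simps = E E(1)[unfolded One_nat_def] L dims K
  let ?s1 = "exec (copy_block 5 12 ix0 ix0 dim_n dim_n) s"
  let ?s2 = "exec (accumulate Sub 5 1 4 dim_n dim_m dim_n) ?s1"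
  let ?s3 = "exec (copy_block 43 11 ix0 ix0 dim_n dim_m) ?s2"
  let ?s4 = "exec (accumulate Sub 43 1 10 dim_n dim_m dim_m) ?s3"
  let ?s5 = "exec (ginv_prog 5 44 dim_n) ?s4"
  let ?s6 = "exec (product 2 44 43 dim_n dim_n dim_m) ?s5"
  let ?s7 = "exec (copy_block 3 10 ix0 ix0 dim_m dim_m) ?s6"
  let ?s8 = "exec (accumulate Sub 3 4 2 dim_m dim_n dim_m) ?s7"
  have s1: "snapshot ?V (E(5 \<mapsto> P4)) c ?s1"
    by (rule exec_copy_block[OF s[folded E_def], where B = P4 and ioff = 0 and joff = 0 and r = n and q = n, unfolded cp])
       (simp_all add: simps)
  have s2: "snapshot ?V (E(5 \<mapsto> P4, 5 \<mapsto> S4 L)) (c + 2 * K) ?s2"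
    by (rule step_sub[where A = P4 and B = L and D = P2, OF s1]) (simp_all add: simps S4_def)
  have s3: "snapshot ?V (E(5 \<mapsto> P4, 5 \<mapsto> S4 L, 43 \<mapsto> P3)) (c + 2 * K) ?s3"
    by (rule exec_copy_block[OF s2, where B = P3 and ioff = 0 and joff = 0 and r = n and q = m, unfolded cp])
       (simp_all add: simps)
  have s4: "snapshot ?V (E(5 \<mapsto> P4, 5 \<mapsto> S4 L, 43 \<mapsto> P3, 43 \<mapsto> S3 L)) (c + 2 * K + 2 * K) ?s4"
    by (rule step_sub[where A = P3 and B = L and D = P1, OF s3]) (simp_all add: simps S3_def)
  obtain G where G: "is_ginv (S4 L) G" and
    s5: "snapshot ?V (E(5 \<mapsto> P4, 5 \<mapsto> S4 L, 43 \<mapsto> P3, 43 \<mapsto> S3 L, 44 \<mapsto> G)) (c + 2 * K + 2 * K + 16 * (n * n * n)) ?s5"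
    by (rule exec_ginv_prog[OF s4 ne, where a = 5 and b = 44 and A = "S4 L"]) (simp_all add: simps)
  have dG: "dim_row G = n" "dim_col G = n" using G by (auto simp: is_ginv_def L)
  define R where "R = G * S3 L"
  have R: "dim_row R = n" "dim_col R = m" by (simp_all add: R_def dG)
  let ?E6 = "E(5 \<mapsto> P4, 5 \<mapsto> S4 L, 43 \<mapsto> P3, 43 \<mapsto> S3 L, 44 \<mapsto> G, 2 \<mapsto> R)"
  let ?c6 = "c + 2 * K + 2 * K + 16 * (n * n * n) + 2 * K"
  have s6: "snapshot ?V ?E6 ?c6 ?s6"
    by (rule step_product[where B = G and D = "S3 L", OF s5]) (simp_all add: simps dG R_def)
  have s7: "snapshot ?V (?E6(3 \<mapsto> P1)) ?c6 ?s7"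
    by (rule exec_copy_block[OF s6, where B = P1 and ioff = 0 and joff = 0 and r = m and q = m, unfolded cp])
       (simp_all add: simps)
  have s8: "snapshot ?V (?E6(3 \<mapsto> P1, 3 \<mapsto> P1 - P2 * R)) (?c6 + 2 * K) ?s8"
    by (rule step_sub[where A = P1 and B = P2 and D = R, OF s7]) (simp_all add: simps R)
  have "exec finish s = ?s8" unfolding finish_def block.simps by (simp only: exec.simps(1,2))
  moreover have "snapshot ?V [1 \<mapsto> L, 2 \<mapsto> R, 3 \<mapsto> P1 - P2 * R, 4 \<mapsto> P2, 5 \<mapsto> S4 L] (c + 24 * K) ?s8"
    by (rule snapshot_weaken[OF s8]) (use K(1) in \<open>auto simp: map_le_def simps\<close>)
  moreover have "block_decomposition m n P1 P2 P3 P4 L R (P1 - P2 * R) P2 (S4 L)"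
    using block_decompositionI[OF L R] loop_inv_end[OF inv G] by (simp add: R_def)
  ultimately show ?thesis unfolding K_def by metis
qed

end

text \<open>The cost \<open>127 * (m + n) ^ 3\<close> is made up of 16 for the inverse of \<open>P\<close>, 24 for the preparation, 63 for at
  most \<open>m + n\<close> rounds of quadratic cost, and 24 for the conclusion.\<close>

lemma exec_decompose:
  fixes P1 P2 P3 P4 :: "'a::field mat"
  assumes GL: "partitioned_GL m n P1 P2 P3 P4"
  shows "\<exists>L R C1 C2 C4. snapshot [0 \<mapsto> m, 1 \<mapsto> n] [1 \<mapsto> L, 2 \<mapsto> R, 3 \<mapsto> C1, 4 \<mapsto> C2, 5 \<mapsto> C4]
      (127 * (m + n) ^ 3) (exec decompose (initial_state m n (four_block_mat P1 P2 P3 P4))) \<and>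
    block_decomposition m n P1 P2 P3 P4 L R C1 C2 C4"
proof -
  let ?V = "[0 \<mapsto> m, 1 \<mapsto> n] :: nat \<rightharpoonup> nat"
  let ?s1 = "exec setup_blocks (initial_state m n (four_block_mat P1 P2 P3 P4))"
  obtain Q1 Q2 Q3 Q4 where "inverse_blocks m n P1 P2 P3 P4 Q1 Q2 Q3 Q4" and
    s1: "snapshot ?V [10 \<mapsto> P1, 4 \<mapsto> P2, 11 \<mapsto> P3, 12 \<mapsto> P4, 13 \<mapsto> Q3, 14 \<mapsto> Q4] (16 * (m + n) ^ 3) ?s1"
    using exec_setup_blocks[OF GL] by blast
  then interpret inverse_blocks m n P1 P2 P3 P4 Q1 Q2 Q3 Q4 by simp
  let ?s2 = "exec prepare ?s1"
  let ?s3 = "exec (For 2 dim_n loop_row) ?s2"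
  define K where "K = (m + n) * (m + n)"
  let ?Inv = "\<lambda>i t. \<exists>L M W X. snapshot ?V (loop_env L M W X) (40 * (m + n) ^ 3 + i * (63 * K)) t \<and> loop_inv i L M W X"
  have s2: "?Inv 0 ?s2"
    using exec_prepare[OF s1[folded env_def]] by simp
  then obtain L0 M0 W0 X0 c0 where "snapshot ?V (loop_env L0 M0 W0 X0) c0 ?s2" by blast
  then have idx: "index_val dim_n (idx ?s2) = n" by (rule snapshot_known_val) simp
  have "?Inv n ?s3"
  proof (rule For_rule[where Inv = ?Inv])
    show "?Inv 0 ?s2" by (rule s2)
    show "index_val dim_n (idx ?s2) = n" by (rule idx)
    fix i t assume i: "i < n" and "?Inv i t"
    then obtain L M W X where t: "snapshot ?V (loop_env L M W X) (40 * (m + n) ^ 3 + i * (63 * K)) t" and inv: "loop_inv i L M W X"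
      by blast
    have N: "m + n \<le> (m + n) * (m + n)" using i by simp
    have K: "n * n \<le> K" "n * m \<le> K" "m * n \<le> K" "m * m \<le> K" "n \<le> K" "m \<le> K" "Suc 0 \<le> K"
      unfolding K_def using i N by (auto intro!: mult_le_mono intro: order_trans[OF _ N])
    show "?Inv (Suc i) (exec loop_row (set_index 2 i t))"
      using exec_loop_row[OF K snapshot_set_index[OF t] inv i] by (simp add: algebra_simps)
  qed
  then obtain L M W X where s3: "snapshot ?V (loop_env L M W X) (40 * (m + n) ^ 3 + n * (63 * K)) ?s3" and inv: "loop_inv n L M W X"
    by blast
  have "n * K \<le> (m + n) ^ 3" unfolding K_def power3_eq_cube by (simp add: algebra_simps)
  then have le: "40 * (m + n) ^ 3 + n * (63 * K) + 24 * (m + n) ^ 3 \<le> 127 * (m + n) ^ 3" by simp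
  have ex: "exec decompose (initial_state m n (four_block_mat P1 P2 P3 P4)) = exec finish ?s3"
    unfolding decompose_def block.simps by (simp only: exec.simps(1,2))
  from exec_finish[OF s3 inv] show ?thesis unfolding ex using snapshot_le[OF _ le] by blast
qed

lemma read_mat_snapshot:
  assumes "snapshot V E c s" "E a = Some A" "A \<in> carrier_mat r q"
  shows "read_mat s a r q = A"
  using assms(3) snapshot_mem[OF assms(1,2)] unfolding read_mat_def by (intro eq_matI) auto

theorem theorem2:
  shows "(\<forall>m n (P1 :: 'a::field mat) P2 P3 P4.
            partitioned_GL m n P1 P2 P3 P4 \<longrightarrow>
              (\<exists>L R C1 C2 C4. block_decomposition m n P1 P2 P3 P4 L R C1 C2 C4)) \<and>
         (\<exists>p c. \<forall>m n (P1 :: 'a mat) P2 P3 P4.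
            partitioned_GL m n P1 P2 P3 P4 \<longrightarrow>
              (let s = exec p (initial_state m n (four_block_mat P1 P2 P3 P4))
               in block_decomposition m n P1 P2 P3 P4
                    (read_mat s 1 n m) (read_mat s 2 n m)
                    (read_mat s 3 m m) (read_mat s 4 m n) (read_mat s 5 n n) \<and>
                  ops s \<le> c * (m + n) ^ 3))"
proof (intro conjI exI[of _ decompose] exI[of _ 127] allI impI)
  fix m n and P1 P2 P3 P4 :: "'a mat"
  assume GL: "partitioned_GL m n P1 P2 P3 P4"
  show "\<exists>L R C1 C2 C4. block_decomposition m n P1 P2 P3 P4 L R C1 C2 C4"
    using exec_decompose[OF GL] by blast
  define s where "s = exec decompose (initial_state m n (four_block_mat P1 P2 P3 P4))"
  obtain L R C1 C2 C4 where
    s: "snapshot [0 \<mapsto> m, 1 \<mapsto> n] [1 \<mapsto> L, 2 \<mapsto> R, 3 \<mapsto> C1, 4 \<mapsto> C2, 5 \<mapsto> C4] (127 * (m + n) ^ 3) s" and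
    dec: "block_decomposition m n P1 P2 P3 P4 L R C1 C2 C4"
    using exec_decompose[OF GL] unfolding s_def by blast
  have c: "L \<in> carrier_mat n m" "R \<in> carrier_mat n m" "C1 \<in> carrier_mat m m" "C2 \<in> carrier_mat m n" "C4 \<in> carrier_mat n n"
    using dec by (auto simp: block_decomposition_def)
  have "read_mat s 1 n m = L" "read_mat s 2 n m = R" "read_mat s 3 m m = C1" "read_mat s 4 m n = C2" "read_mat s 5 n n = C4"
    by (rule read_mat_snapshot[OF s]; use c in simp)+
  moreover have "ops s \<le> 127 * (m + n) ^ 3" using s by (simp add: snapshot_def)
  ultimately show "let s = exec decompose (initial_state m n (four_block_mat P1 P2 P3 P4))
     in block_decomposition m n P1 P2 P3 P4 (read_mat s 1 n m) (read_mat s 2 n m)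
          (read_mat s 3 m m) (read_mat s 4 m n) (read_mat s 5 n n) \<and> ops s \<le> 127 * (m + n) ^ 3"
    using dec by (simp add: s_def[symmetric])
qed

end
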